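(* Let $k$ be a commutative ring, let $X$ be a set, and let $A\in\mathcal M_k(X)$. There is a bijective correspondence between bimonoid structures on $A$ over the duoidal category $(\mathcal M_k(X),\odot,I,\bullet,J,\delta,\varpi,\tau,\zeta)$ described in the context and $\mathcal C(\mathcal M_k)$-category structures on $A$ (with underlying class $X$).
   Context: $\mathcal M_k(X)$ is the category of families $M=(M_{x,y})_{x,y\in X}$ of $k$-modules, with families of $k$-linear maps as morphisms ($\otimes=\otimes_k$). It is a duoidal category (a category with two compatible monoidal structures) with the data: - $(M\bullet N)_{x,y}=M_{x,y}\otimes N_{x,y}$ with unit $J$, $J_{x,y}=k e_{x,y}$ (free of rank one) for all $x,y$; - $(M\odot N)_{x,z}=\bigoplus_{y\in X}M_{x,y}\otimes N_{y,z}$ with unit $I$, $I_{x,x}=ke_{x,x}$, $I_{x,y}=0$ if $x\neq y$; - $\tau:I\to J$ the natural inclusion; $\delta:I\to I\bullet I=I$ the identity; - $\varpi:J\odot J\to J$, $\varpi_{x,y}\big(\sum_z\alpha_z\,e_{x,z}\otimes e_{z,y}\big)=\sum_z\alpha_z e_{x,y}$; - $\zeta_{M,N,P,Q}:(M\bullet N)\odot(P\bullet Q)\to(M\odot P)\bullet(N\odot Q)$, whose $(x,y)$-component $\bigoplus_{z}M_{x,z}\otimes N_{x,z}\otimes P_{z,y}\otimes Q_{z,y}\to\bigoplus_{u,v}M_{x,u}\otimes P_{u,y}\otimes N_{x,v}\otimes Q_{v,y}$ switches the second and third tensor factors, followed by the natural inclusion. A bimonoid in a duoidal category is an object $A$ with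 an algebra structure $(\mu,\eta)$ in $(\mathcal M,\odot,I)$ and a coalgebra structure $(\Delta,\varepsilon)$ in $(\mathcal M,\bullet,J)$ such that $\Delta\circ\mu=(\mu\bullet\mu)\circ\zeta\circ(\Delta\odot\Delta)$, $\varpi\circ(\varepsilon\odot\varepsilon)=\varepsilon\circ\mu$, $(\eta\bullet\eta)\circ\delta=\Delta\circ\eta$, $\varepsilon\circ\eta=\tau$. A $\mathcal C(\mathcal M_k)$-category structure on $A\in\mathcal M_k(X)$ consists of $k$-coalgebra structures $(\Delta_{x,y},\varepsilon_{x,y})$ on all $A_{x,y}$ and $k$-coalgebra morphisms $m_{x,y,z}:A_{x,y}\otimes A_{y,z}\to A_{x,z}$, $\eta_x:k\to A_{x,x}$ satisfying the associativity and unit conditions $m_{x,y,t}\circ(\mathrm{id}\otimes m_{y,z,t})=m_{x,z,t}\circ(m_{x,y,z}\otimes\mathrm{id})$, $m_{x,x,y}\circ(\eta_x\otimes\mathrm{id})=\mathrm{id}=m_{x,y,y}\circ(\mathrm{id}\otimes\eta_y)$. *)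

theory Defs
  imports "HOL-Algebra.Module" "HOL-Algebra.AbelCoset"
begin

text \<open>
  Modules are records of type \<^typ>\<open>('r, 'a) module\<close>; their multiplicative fields carry no
  meaning and are left undefined. Linear maps are extensional functions on the carrier, so
  that a linear map is determined by its values on the carrier. Linear maps out of a tensor
  product or a direct sum are introduced as the unique linear map with prescribed values on
  generators.
\<close>

context
  fixes R :: "('r, 'm) ring_scheme" (structure)
begin

section \<open>Modules over a commutative ring\<close>

definition lin :: "('r, 'a) module \<Rightarrow> ('r, 'b) module \<Rightarrow> ('a \<Rightarrow> 'b) set" where
  "lin M N = {f \<in> carrier M \<rightarrow>\<^sub>E carrier N.
     (\<forall>a\<in>carrier M. \<forall>b\<in>carrier M. f (a \<oplus>\<^bsub>M\<^esub> b) = f a \<oplus>\<^bsub>N\<^esub> f b) \<and>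
     (\<forall>r\<in>carrier R. \<forall>a\<in>carrier M. f (r \<odot>\<^bsub>M\<^esub> a) = r \<odot>\<^bsub>N\<^esub> f a)}"

definition reg_mod :: "('r, 'r) module" where
  "reg_mod = \<lparr>carrier = carrier R, mult = undefined, one = undefined,
     zero = \<zero>, add = (\<oplus>), smult = (\<otimes>)\<rparr>"

definition free_mod :: "'s set \<Rightarrow> ('r, 's \<Rightarrow> 'r) module" where
  "free_mod S = \<lparr>carrier = {u. (\<forall>s. u s \<in> carrier R) \<and> (\<forall>s. s \<notin> S \<longrightarrow> u s = \<zero>) \<and> finite {s. u s \<noteq> \<zero>}},
     mult = undefined, one = undefined,
     zero = (\<lambda>s. \<zero>), add = (\<lambda>u v s. u s \<oplus> v s), smult = (\<lambda>r u s. r \<otimes> u s)\<rparr>"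

definition basis_vec :: "'s \<Rightarrow> 's \<Rightarrow> 'r" where
  "basis_vec s = (\<lambda>t. if t = s then \<one> else \<zero>)"

definition quot_mod :: "('r, 'a) module \<Rightarrow> 'a set \<Rightarrow> ('r, 'a set) module" where
  "quot_mod M K = \<lparr>carrier = a_rcosets\<^bsub>M\<^esub> K, mult = undefined, one = undefined,
     zero = K, add = set_add M, smult = (\<lambda>r C. \<Union>u\<in>C. K +>\<^bsub>M\<^esub> (r \<odot>\<^bsub>M\<^esub> u))\<rparr>"

definition span_mod :: "('r, 'a) module \<Rightarrow> 'a set \<Rightarrow> 'a set" where
  "span_mod M S = \<Inter>{K. submodule K R M \<and> S \<subseteq> K}"


section \<open>Tensor products\<close>

definition tensor_relators :: "('r, 'a) module \<Rightarrow> ('r, 'b) module \<Rightarrow> ('a \<times> 'b \<Rightarrow> 'r) set" where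
  "tensor_relators M N = (let F = free_mod (carrier M \<times> carrier N) in
     {basis_vec (a \<oplus>\<^bsub>M\<^esub> a', b) \<ominus>\<^bsub>F\<^esub> (basis_vec (a, b) \<oplus>\<^bsub>F\<^esub> basis_vec (a', b)) | a a' b.
        a \<in> carrier M \<and> a' \<in> carrier M \<and> b \<in> carrier N} \<union>
     {basis_vec (a, b \<oplus>\<^bsub>N\<^esub> b') \<ominus>\<^bsub>F\<^esub> (basis_vec (a, b) \<oplus>\<^bsub>F\<^esub> basis_vec (a, b')) | a b b'.
        a \<in> carrier M \<and> b \<in> carrier N \<and> b' \<in> carrier N} \<union>
     {basis_vec (r \<odot>\<^bsub>M\<^esub> a, b) \<ominus>\<^bsub>F\<^esub> (r \<odot>\<^bsub>F\<^esub> basis_vec (a, b)) | r a b.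
        r \<in> carrier R \<and> a \<in> carrier M \<and> b \<in> carrier N} \<union>
     {basis_vec (a, r \<odot>\<^bsub>N\<^esub> b) \<ominus>\<^bsub>F\<^esub> (r \<odot>\<^bsub>F\<^esub> basis_vec (a, b)) | r a b.
        r \<in> carrier R \<and> a \<in> carrier M \<and> b \<in> carrier N})"

definition tensor_kernel :: "('r, 'a) module \<Rightarrow> ('r, 'b) module \<Rightarrow> ('a \<times> 'b \<Rightarrow> 'r) set" where
  "tensor_kernel M N = span_mod (free_mod (carrier M \<times> carrier N)) (tensor_relators M N)"

definition tensor :: "('r, 'a) module \<Rightarrow> ('r, 'b) module \<Rightarrow> ('r, ('a \<times> 'b \<Rightarrow> 'r) set) module" where
  "tensor M N = quot_mod (free_mod (carrier M \<times> carrier N)) (tensor_kernel M N)"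

definition pure_tensor ::
  "('r, 'a) module \<Rightarrow> ('r, 'b) module \<Rightarrow> 'a \<Rightarrow> 'b \<Rightarrow> ('a \<times> 'b \<Rightarrow> 'r) set" where
  "pure_tensor M N a b =
     tensor_kernel M N +>\<^bsub>free_mod (carrier M \<times> carrier N)\<^esub> basis_vec (a, b)"

text \<open>\<open>f \<otimes> g : M \<otimes> N \<rightarrow> M' \<otimes> N'\<close>\<close>
definition tensor_map where
  "tensor_map M N M' N' f g = (THE h. h \<in> lin (tensor M N) (tensor M' N') \<and>
     (\<forall>a\<in>carrier M. \<forall>b\<in>carrier N.
        h (pure_tensor M N a b) = pure_tensor M' N' (f a) (g b)))"

definition tensor_assoc where
  "tensor_assoc M N P = (THE h. h \<in> lin (tensor (tensor M N) P) (tensor M (tensor N P)) \<and>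
     (\<forall>a\<in>carrier M. \<forall>b\<in>carrier N. \<forall>c\<in>carrier P.
        h (pure_tensor (tensor M N) P (pure_tensor M N a b) c) =
        pure_tensor M (tensor N P) a (pure_tensor N P b c)))"

definition tensor_lunit where
  "tensor_lunit M = (THE h. h \<in> lin (tensor reg_mod M) M \<and>
     (\<forall>r\<in>carrier R. \<forall>a\<in>carrier M. h (pure_tensor reg_mod M r a) = r \<odot>\<^bsub>M\<^esub> a))"

definition tensor_runit where
  "tensor_runit M = (THE h. h \<in> lin (tensor M reg_mod) M \<and>
     (\<forall>r\<in>carrier R. \<forall>a\<in>carrier M. h (pure_tensor M reg_mod a r) = r \<odot>\<^bsub>M\<^esub> a))"

text \<open>\<open>(M \<otimes> N) \<otimes> (P \<otimes> Q) \<rightarrow> (M \<otimes> P) \<otimes> (N \<otimes> Q)\<close>, switching the second and third factors\<close>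
definition tensor_switch where
  "tensor_switch M N P Q =
    (THE h. h \<in> lin (tensor (tensor M N) (tensor P Q)) (tensor (tensor M P) (tensor N Q)) \<and>
     (\<forall>a\<in>carrier M. \<forall>b\<in>carrier N. \<forall>c\<in>carrier P. \<forall>d\<in>carrier Q.
        h (pure_tensor (tensor M N) (tensor P Q) (pure_tensor M N a b) (pure_tensor P Q c d)) =
        pure_tensor (tensor M P) (tensor N Q) (pure_tensor M P a c) (pure_tensor N Q b d)))"


section \<open>Coalgebras over the base ring\<close>

definition coalg where
  "coalg C D e \<longleftrightarrow>
     D \<in> lin C (tensor C C) \<and> e \<in> lin C reg_mod \<and>
     (\<forall>c\<in>carrier C.
        tensor_assoc C C C (tensor_map C C (tensor C C) C D (\<lambda>a. a) (D c)) =
          tensor_map C C C (tensor C C) (\<lambda>a. a) D (D c) \<and>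
        tensor_lunit C (tensor_map C C reg_mod C e (\<lambda>a. a) (D c)) = c \<and>
        tensor_runit C (tensor_map C C C reg_mod (\<lambda>a. a) e (D c)) = c)"

text \<open>A morphism from the coalgebra \<open>(C, D, e)\<close> to the coalgebra \<open>(C', D', e')\<close>\<close>
definition coalg_hom where
  "coalg_hom C D e C' D' e' f \<longleftrightarrow> f \<in> lin C C' \<and>
     (\<forall>c\<in>carrier C. D' (f c) = tensor_map C C C' C' f f (D c) \<and> e' (f c) = e c)"

definition base_comult where
  "base_comult = (\<lambda>r\<in>carrier R. pure_tensor reg_mod reg_mod r \<one>)"

definition base_counit :: "'r \<Rightarrow> 'r" where
  "base_counit = (\<lambda>r\<in>carrier R. r)"

definition tensor_comult where
  "tensor_comult C D C' D' = (\<lambda>t\<in>carrier (tensor C C').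
     tensor_switch C C C' C' (tensor_map C C' (tensor C C) (tensor C' C') D D' t))"

definition tensor_counit where
  "tensor_counit C e C' e' = (\<lambda>t\<in>carrier (tensor C C').
     tensor_lunit reg_mod (tensor_map C C' reg_mod reg_mod e e' t))"

end


section \<open>The duoidal category of families of modules indexed by pairs of elements of X\<close>

text \<open>
  An object is a function \<open>M\<close> of which only the values \<open>M x y\<close> with \<open>x, y \<in> X\<close> matter.
\<close>

type_synonym ('x, 'r, 'a) fam = "'x \<Rightarrow> 'x \<Rightarrow> ('r, 'a) module"

definition mor_comp ::
  "('x \<Rightarrow> 'x \<Rightarrow> 'b \<Rightarrow> 'c) \<Rightarrow> ('x \<Rightarrow> 'x \<Rightarrow> 'a \<Rightarrow> 'b) \<Rightarrow> 'x \<Rightarrow> 'x \<Rightarrow> 'a \<Rightarrow> 'c"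
  (infixr \<open>\<circ>\<^sub>X\<close> 55) where
  "g \<circ>\<^sub>X f = (\<lambda>x y. g x y \<circ> f x y)"

definition mor_id :: "'x \<Rightarrow> 'x \<Rightarrow> 'a \<Rightarrow> 'a" where
  "mor_id = (\<lambda>x y a. a)"

context
  fixes R :: "('r, 'm) ring_scheme" (structure)
    and X :: "'x set"
begin

definition mor :: "('x, 'r, 'a) fam \<Rightarrow> ('x, 'r, 'b) fam \<Rightarrow> ('x \<Rightarrow> 'x \<Rightarrow> 'a \<Rightarrow> 'b) set" where
  "mor M N = (\<Pi>\<^sub>E x\<in>X. \<Pi>\<^sub>E y\<in>X. lin R (M x y) (N x y))"

text \<open>Equality of morphisms with source \<open>M\<close>; neither side need be extensional.\<close>
definition mor_eq ::
  "('x, 'r, 'a) fam \<Rightarrow> ('x \<Rightarrow> 'x \<Rightarrow> 'a \<Rightarrow> 'b) \<Rightarrow> ('x \<Rightarrow> 'x \<Rightarrow> 'a \<Rightarrow> 'b) \<Rightarrow> bool" where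
  "mor_eq M f g \<longleftrightarrow> (\<forall>x\<in>X. \<forall>y\<in>X. \<forall>a\<in>carrier (M x y). f x y a = g x y a)"


subsection \<open>The entrywise product \<open>\<bullet>\<close>\<close>

definition bul :: "('x, 'r, 'a) fam \<Rightarrow> ('x, 'r, 'b) fam \<Rightarrow> ('x, 'r, ('a \<times> 'b \<Rightarrow> 'r) set) fam" where
  "bul M N = (\<lambda>x y. tensor R (M x y) (N x y))"

definition bul_map where
  "bul_map M N M' N' f g =
     (\<lambda>x y. tensor_map R (M x y) (N x y) (M' x y) (N' x y) (f x y) (g x y))"

definition bul_unit :: "('x, 'r, 'r) fam" where
  "bul_unit = (\<lambda>x y. reg_mod R)"

definition bul_assoc where
  "bul_assoc M N P = (\<lambda>x y. tensor_assoc R (M x y) (N x y) (P x y))"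

definition bul_lunit where
  "bul_lunit M = (\<lambda>x y. tensor_lunit R (M x y))"

definition bul_runit where
  "bul_runit M = (\<lambda>x y. tensor_runit R (M x y))"


subsection \<open>The matrix product \<open>\<odot>\<close>\<close>

definition dsum :: "('x \<Rightarrow> ('r, 'a) module) \<Rightarrow> ('r, 'x \<Rightarrow> 'a) module" where
  "dsum M = \<lparr>carrier = {s \<in> \<Pi>\<^sub>E y\<in>X. carrier (M y). finite {y \<in> X. s y \<noteq> \<zero>\<^bsub>M y\<^esub>}},
     mult = undefined, one = undefined,
     zero = (\<lambda>y\<in>X. \<zero>\<^bsub>M y\<^esub>), add = (\<lambda>s t. \<lambda>y\<in>X. s y \<oplus>\<^bsub>M y\<^esub> t y),
     smult = (\<lambda>r s. \<lambda>y\<in>X. r \<odot>\<^bsub>M y\<^esub> s y)\<rparr>"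

definition dsum_in :: "('x \<Rightarrow> ('r, 'a) module) \<Rightarrow> 'x \<Rightarrow> 'a \<Rightarrow> 'x \<Rightarrow> 'a" where
  "dsum_in M y a = (\<lambda>z\<in>X. if z = y then a else \<zero>\<^bsub>M z\<^esub>)"

definition odo ::
  "('x, 'r, 'a) fam \<Rightarrow> ('x, 'r, 'b) fam \<Rightarrow> ('x, 'r, 'x \<Rightarrow> ('a \<times> 'b \<Rightarrow> 'r) set) fam" where
  "odo M N = (\<lambda>x z. dsum (\<lambda>y. tensor R (M x y) (N y z)))"

text \<open>The generator \<open>a \<otimes> b\<close> in the \<open>y\<close>-th summand of \<open>odo M N x z\<close>\<close>
definition odo_gen where
  "odo_gen M N x z y a b =
     dsum_in (\<lambda>y. tensor R (M x y) (N y z)) y (pure_tensor R (M x y) (N y z) a b)"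

definition odo_map where
  "odo_map M N M' N' f g = (\<lambda>x z. THE h. h \<in> lin R (odo M N x z) (odo M' N' x z) \<and>
     (\<forall>y\<in>X. \<forall>a\<in>carrier (M x y). \<forall>b\<in>carrier (N y z).
        h (odo_gen M N x z y a b) = odo_gen M' N' x z y (f x y a) (g y z b)))"

definition odo_unit :: "('x, 'r, 'r) fam" where
  "odo_unit = (\<lambda>x y. if x = y then reg_mod R else (reg_mod R)\<lparr>carrier := {\<zero>}\<rparr>)"

definition odo_assoc where
  "odo_assoc M N P =
    (\<lambda>x t. THE h. h \<in> lin R (odo (odo M N) P x t) (odo M (odo N P) x t) \<and>
     (\<forall>y\<in>X. \<forall>z\<in>X. \<forall>a\<in>carrier (M x y). \<forall>b\<in>carrier (N y z). \<forall>c\<in>carrier (P z t).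
        h (odo_gen (odo M N) P x t z (odo_gen M N x z y a b) c) =
        odo_gen M (odo N P) x t y a (odo_gen N P y t z b c)))"

text \<open>
  In \<open>odo odo_unit M x y\<close> only the \<open>x\<close>-th summand can be nonzero, and in
  \<open>odo M odo_unit x y\<close> only the \<open>y\<close>-th one.
\<close>
definition odo_lunit where
  "odo_lunit M = (\<lambda>x y. THE h. h \<in> lin R (odo odo_unit M x y) (M x y) \<and>
     (\<forall>r\<in>carrier R. \<forall>a\<in>carrier (M x y). h (odo_gen odo_unit M x y x r a) = r \<odot>\<^bsub>M x y\<^esub> a))"

definition odo_runit where
  "odo_runit M = (\<lambda>x y. THE h. h \<in> lin R (odo M odo_unit x y) (M x y) \<and>
     (\<forall>r\<in>carrier R. \<forall>a\<in>carrier (M x y). h (odo_gen M odo_unit x y y a r) = r \<odot>\<^bsub>M x y\<^esub> a))"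


subsection \<open>The duoidal structure maps\<close>

definition tau :: "'x \<Rightarrow> 'x \<Rightarrow> 'r \<Rightarrow> 'r" where
  "tau = (\<lambda>x y. \<lambda>r\<in>carrier (odo_unit x y). r)"

text \<open>The identity under the canonical identification of \<open>bul odo_unit odo_unit\<close> with \<open>odo_unit\<close>\<close>
definition delta :: "'x \<Rightarrow> 'x \<Rightarrow> 'r \<Rightarrow> ('r \<times> 'r \<Rightarrow> 'r) set" where
  "delta = (\<lambda>x y. \<lambda>r\<in>carrier (odo_unit x y).
     if x = y then pure_tensor R (odo_unit x y) (odo_unit x y) r \<one> else \<zero>\<^bsub>bul odo_unit odo_unit x y\<^esub>)"

definition varpi where
  "varpi = (\<lambda>x y. THE h. h \<in> lin R (odo bul_unit bul_unit x y) (bul_unit x y) \<and>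
     (\<forall>z\<in>X. \<forall>r\<in>carrier R. \<forall>s\<in>carrier R. h (odo_gen bul_unit bul_unit x y z r s) = r \<otimes> s))"

definition zeta where
  "zeta M N P Q =
    (\<lambda>x y. THE h. h \<in> lin R (odo (bul M N) (bul P Q) x y) (bul (odo M P) (odo N Q) x y) \<and>
     (\<forall>z\<in>X. \<forall>m\<in>carrier (M x z). \<forall>n\<in>carrier (N x z). \<forall>p\<in>carrier (P z y). \<forall>q\<in>carrier (Q z y).
        h (odo_gen (bul M N) (bul P Q) x y z
             (pure_tensor R (M x z) (N x z) m n) (pure_tensor R (P z y) (Q z y) p q)) =
        pure_tensor R (odo M P x y) (odo N Q x y)
          (odo_gen M P x y z m p) (odo_gen N Q x y z n q)))"


section \<open>Bimonoids\<close>

definition odo_algebra where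
  "odo_algebra A \<mu> \<eta> \<longleftrightarrow> \<mu> \<in> mor (odo A A) A \<and> \<eta> \<in> mor odo_unit A \<and>
     mor_eq (odo (odo A A) A)
       (\<mu> \<circ>\<^sub>X odo_map (odo A A) A A A \<mu> mor_id)
       (\<mu> \<circ>\<^sub>X odo_map A (odo A A) A A mor_id \<mu> \<circ>\<^sub>X odo_assoc A A A) \<and>
     mor_eq (odo odo_unit A) (\<mu> \<circ>\<^sub>X odo_map odo_unit A A A \<eta> mor_id) (odo_lunit A) \<and>
     mor_eq (odo A odo_unit) (\<mu> \<circ>\<^sub>X odo_map A odo_unit A A mor_id \<eta>) (odo_runit A)"

definition bul_coalgebra where
  "bul_coalgebra A \<Delta> \<epsilon> \<longleftrightarrow> \<Delta> \<in> mor A (bul A A) \<and> \<epsilon> \<in> mor A bul_unit \<and>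
     mor_eq A
       (bul_assoc A A A \<circ>\<^sub>X bul_map A A (bul A A) A \<Delta> mor_id \<circ>\<^sub>X \<Delta>)
       (bul_map A A A (bul A A) mor_id \<Delta> \<circ>\<^sub>X \<Delta>) \<and>
     mor_eq A (bul_lunit A \<circ>\<^sub>X bul_map A A bul_unit A \<epsilon> mor_id \<circ>\<^sub>X \<Delta>) mor_id \<and>
     mor_eq A (bul_runit A \<circ>\<^sub>X bul_map A A A bul_unit mor_id \<epsilon> \<circ>\<^sub>X \<Delta>) mor_id"

definition bimonoid_structures where
  "bimonoid_structures A = {(\<mu>, \<eta>, \<Delta>, \<epsilon>).
     odo_algebra A \<mu> \<eta> \<and> bul_coalgebra A \<Delta> \<epsilon> \<and>
     mor_eq (odo A A) (\<Delta> \<circ>\<^sub>X \<mu>)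
       (bul_map (odo A A) (odo A A) A A \<mu> \<mu> \<circ>\<^sub>X zeta A A A A \<circ>\<^sub>X
        odo_map A A (bul A A) (bul A A) \<Delta> \<Delta>) \<and>
     mor_eq (odo A A) (varpi \<circ>\<^sub>X odo_map A A bul_unit bul_unit \<epsilon> \<epsilon>) (\<epsilon> \<circ>\<^sub>X \<mu>) \<and>
     mor_eq odo_unit (bul_map odo_unit odo_unit A A \<eta> \<eta> \<circ>\<^sub>X delta) (\<Delta> \<circ>\<^sub>X \<eta>) \<and>
     mor_eq odo_unit (\<epsilon> \<circ>\<^sub>X \<eta>) tau}"


section \<open>Categories enriched in coalgebras\<close>

definition coalg_category_structures where
  "coalg_category_structures A = {(\<Delta>, \<epsilon>, m, \<eta>).
     \<Delta> \<in> (\<Pi>\<^sub>E x\<in>X. \<Pi>\<^sub>E y\<in>X. lin R (A x y) (tensor R (A x y) (A x y))) \<and>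
     \<epsilon> \<in> (\<Pi>\<^sub>E x\<in>X. \<Pi>\<^sub>E y\<in>X. lin R (A x y) (reg_mod R)) \<and>
     m \<in> (\<Pi>\<^sub>E x\<in>X. \<Pi>\<^sub>E y\<in>X. \<Pi>\<^sub>E z\<in>X. lin R (tensor R (A x y) (A y z)) (A x z)) \<and>
     \<eta> \<in> (\<Pi>\<^sub>E x\<in>X. lin R (reg_mod R) (A x x)) \<and>
     (\<forall>x\<in>X. \<forall>y\<in>X. coalg R (A x y) (\<Delta> x y) (\<epsilon> x y)) \<and>
     (\<forall>x\<in>X. \<forall>y\<in>X. \<forall>z\<in>X.
        coalg_hom R
          (tensor R (A x y) (A y z))
          (tensor_comult R (A x y) (\<Delta> x y) (A y z) (\<Delta> y z))
          (tensor_counit R (A x y) (\<epsilon> x y) (A y z) (\<epsilon> y z))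
          (A x z) (\<Delta> x z) (\<epsilon> x z) (m x y z)) \<and>
     (\<forall>x\<in>X.
        coalg_hom R (reg_mod R) (base_comult R) (base_counit R)
          (A x x) (\<Delta> x x) (\<epsilon> x x) (\<eta> x)) \<and>
     (\<forall>x\<in>X. \<forall>y\<in>X. \<forall>z\<in>X. \<forall>t\<in>X.
        \<forall>u\<in>carrier (tensor R (tensor R (A x y) (A y z)) (A z t)).
          m x y t (tensor_map R (A x y) (tensor R (A y z) (A z t)) (A x y) (A y t)
                     (\<lambda>a. a) (m y z t) (tensor_assoc R (A x y) (A y z) (A z t) u)) =
          m x z t (tensor_map R (tensor R (A x y) (A y z)) (A z t) (A x z) (A z t)
                     (m x y z) (\<lambda>a. a) u)) \<and>
     (\<forall>x\<in>X. \<forall>y\<in>X. \<forall>u\<in>carrier (tensor R (reg_mod R) (A x y)).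
        m x x y (tensor_map R (reg_mod R) (A x y) (A x x) (A x y) (\<eta> x) (\<lambda>a. a) u) =
        tensor_lunit R (A x y) u) \<and>
     (\<forall>x\<in>X. \<forall>y\<in>X. \<forall>u\<in>carrier (tensor R (A x y) (reg_mod R)).
        m x y y (tensor_map R (A x y) (reg_mod R) (A x y) (A y y) (\<lambda>a. a) (\<eta> y) u) =
        tensor_runit R (A x y) u)}"

text \<open>
  The correspondence keeps the comultiplications and counits, restricts the
  multiplication to the direct summands, and keeps the diagonal components of the unit (the
  other ones have zero source).
\<close>
definition bimonoid_to_category where
  "bimonoid_to_category A = (\<lambda>(\<mu>, \<eta>, \<Delta>, \<epsilon>).
     (\<Delta>, \<epsilon>,
      (\<lambda>x\<in>X. \<lambda>y\<in>X. \<lambda>z\<in>X. \<lambda>u\<in>carrier (tensor R (A x y) (A y z)).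
         \<mu> x z (dsum_in (\<lambda>y. tensor R (A x y) (A y z)) y u)),
      (\<lambda>x\<in>X. \<eta> x x)))"

end

end

theory Submission
  imports Defs
begin

text \<open>
  A linear map out of \<open>M \<odot> N\<close> is the same as a family of linear maps out of the summands
  \<open>M x y \<otimes> N y z\<close>. On the summand with index \<open>y\<close> each structure map of the duoidal category acts as the
  corresponding structure map of modules: \<open>\<zeta>\<close> becomes the switch of tensor factors followed by
  \<open>\<iota> \<otimes> \<iota>\<close> for the inclusion \<open>\<iota>\<close> of the summand, \<open>\<varpi>\<close> becomes multiplication in the base ring, and the
  associator of \<open>\<odot>\<close> becomes that of \<open>\<otimes>\<close>. Hence each bimonoid axiom, tested on the summands, is one
  of the axioms of a category enriched in coalgebras. Off the diagonal \<open>I\<close> vanishes, so \<open>\<eta>\<close> is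
  determined by its diagonal components.
\<close>

text \<open>Most structure maps (\<open>tensor_map\<close>, \<open>tensor_assoc\<close>,
  \<open>odo_map\<close>, \<open>zeta\<close> and others) are definite descriptions, so nothing is
  known about them until existence and uniqueness are proved. Uniqueness holds because pure tensors
  generate a tensor product and the inclusions of the summands generate a direct sum. Existence is
  the harder half: prescribing values on iterated generators has to be shown consistent, which is
  done by universal properties alone, without an explicit model of the target map.

  A second obstacle is extensionality. Morphisms are \<open>undefined\<close> outside the carriers,
  while composites and identities need not be. The axioms are therefore compared pointwise on
  carriers, and genuine equality of functions is established only where the bijection itself asks
  for it.

  The axioms are compared for fixed data: for arbitrary morphisms \<mu>, \<eta>, \<Delta>,
  \<epsilon> the bimonoid axioms are equivalent to the category axioms of the translated data. After
  that, bijectivity is a statement about data only: a family \<open>m x y z\<close> glues to exactly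
  one \<open>\<mu> x z\<close>, and the diagonal part of \<eta> has exactly one extension.\<close>

section \<open>Linear maps\<close>

text \<open>Identities and composites of linear maps are not extensional and so lie outside \<^const>\<open>lin\<close>.\<close>
definition linear_map ::
  "('r, 'm) ring_scheme \<Rightarrow> ('r, 'a) module \<Rightarrow> ('r, 'b) module \<Rightarrow> ('a \<Rightarrow> 'b) \<Rightarrow> bool" where
  "linear_map R M N f \<longleftrightarrow> f \<in> carrier M \<rightarrow> carrier N \<and>
     (\<forall>a\<in>carrier M. \<forall>b\<in>carrier M. f (a \<oplus>\<^bsub>M\<^esub> b) = f a \<oplus>\<^bsub>N\<^esub> f b) \<and>
     (\<forall>r\<in>carrier R. \<forall>a\<in>carrier M. f (r \<odot>\<^bsub>M\<^esub> a) = r \<odot>\<^bsub>N\<^esub> f a)"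

lemma linear_mapI:
  assumes "\<And>a. a \<in> carrier M \<Longrightarrow> f a \<in> carrier N"
    and "\<And>a b. a \<in> carrier M \<Longrightarrow> b \<in> carrier M \<Longrightarrow> f (a \<oplus>\<^bsub>M\<^esub> b) = f a \<oplus>\<^bsub>N\<^esub> f b"
    and "\<And>r a. r \<in> carrier R \<Longrightarrow> a \<in> carrier M \<Longrightarrow> f (r \<odot>\<^bsub>M\<^esub> a) = r \<odot>\<^bsub>N\<^esub> f a"
  shows "linear_map R M N f"
  using assms by (auto simp: linear_map_def)

lemma
  assumes "linear_map R M N f"
  shows linear_map_closed: "a \<in> carrier M \<Longrightarrow> f a \<in> carrier N"
    and linear_map_add: "a \<in> carrier M \<Longrightarrow> b \<in> carrier M \<Longrightarrow> f (a \<oplus>\<^bsub>M\<^esub> b) = f a \<oplus>\<^bsub>N\<^esub> f b"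
    and linear_map_smult: "r \<in> carrier R \<Longrightarrow> a \<in> carrier M \<Longrightarrow> f (r \<odot>\<^bsub>M\<^esub> a) = r \<odot>\<^bsub>N\<^esub> f a"
  using assms by (auto simp: linear_map_def)

lemma lin_iff: "f \<in> lin R M N \<longleftrightarrow> linear_map R M N f \<and> f \<in> extensional (carrier M)"
  by (auto simp: lin_def linear_map_def PiE_def)

lemma lin_linear: "f \<in> lin R M N \<Longrightarrow> linear_map R M N f"
  by (simp add: lin_iff)

lemma lin_eqI:
  assumes "f \<in> lin R M N" "g \<in> lin R M N" "\<And>a. a \<in> carrier M \<Longrightarrow> f a = g a"
  shows "f = g"
  using assms by (meson extensionalityI lin_iff)

text \<open>\<open>linear_map\<close> evaluates a function only on the carrier: sums and scalar
  multiples of elements stay there because M is a module. Hence a map may be exchanged for its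
  restriction or for any pointwise equal function.\<close>

lemma linear_map_cong:
  assumes "module R M" "\<And>a. a \<in> carrier M \<Longrightarrow> f a = g a"
  shows "linear_map R M N f \<longleftrightarrow> linear_map R M N g"
proof -
  interpret module R M by fact
  show ?thesis using assms(2) by (simp add: linear_map_def Pi_def)
qed

lemma linear_map_restrict:
  "module R M \<Longrightarrow> linear_map R M N (restrict f (carrier M)) \<longleftrightarrow> linear_map R M N f"
  by (rule linear_map_cong) auto

lemma restrict_lin: "module R M \<Longrightarrow> linear_map R M N f \<Longrightarrow> restrict f (carrier M) \<in> lin R M N"
  by (simp add: lin_iff linear_map_restrict)

lemma linear_map_id: "linear_map R M M (\<lambda>a. a)"
  by (simp add: linear_map_def)

lemma linear_map_comp:
  assumes "linear_map R M N f" "linear_map R N P g"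
  shows "linear_map R M P (\<lambda>a. g (f a))"
  using assms by (simp add: linear_map_def Pi_def)

lemma linear_map_const_zero:
  assumes "module R N" shows "linear_map R M N (\<lambda>a. \<zero>\<^bsub>N\<^esub>)"
proof -
  interpret N: module R N by fact
  show ?thesis by (auto intro!: linear_mapI)
qed

lemma linear_map_zero:
  assumes "module R M" "module R N" "linear_map R M N f"
  shows "f \<zero>\<^bsub>M\<^esub> = \<zero>\<^bsub>N\<^esub>"
proof -
  interpret M: module R M by fact
  interpret N: module R N by fact
  \<comment> \<open>Zero is written as 0 times itself, so that homogeneity alone gives the
    claim.\<close>
  have "f (\<zero>\<^bsub>R\<^esub> \<odot>\<^bsub>M\<^esub> \<zero>\<^bsub>M\<^esub>) = \<zero>\<^bsub>R\<^esub> \<odot>\<^bsub>N\<^esub> f \<zero>\<^bsub>M\<^esub>"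
    by (rule linear_map_smult[OF assms(3)]) auto
  then show ?thesis by (simp add: linear_map_closed[OF assms(3)])
qed

lemma linear_map_minus:
  assumes "module R M" "module R N" "linear_map R M N f" "a \<in> carrier M" "b \<in> carrier M"
  shows "f (a \<ominus>\<^bsub>M\<^esub> b) = f a \<ominus>\<^bsub>N\<^esub> f b"
proof -
  interpret M: module R M by fact
  interpret N: module R N by fact
  note f = linear_map_closed[OF assms(3)] linear_map_add[OF assms(3)] linear_map_smult[OF assms(3)]
  \<comment> \<open>Negation is multiplication by -1, which turns the claim into
    homogeneity.\<close>
  have "f (\<ominus>\<^bsub>M\<^esub> b) = f ((\<ominus>\<^bsub>R\<^esub> \<one>\<^bsub>R\<^esub>) \<odot>\<^bsub>M\<^esub> b)"
    using assms by (simp add: M.smult_l_minus)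
  also have "\<dots> = \<ominus>\<^bsub>N\<^esub> f b"
    using assms by (simp add: f N.smult_l_minus)
  finally show ?thesis using assms by (simp add: a_minus_def f)
qed

text \<open>Single entry point for all definite descriptions over \<open>lin\<close>. Existence may
  be supplied by any linear f; the property P is demanded of its restriction, since it is the
  restriction that lies in \<open>lin\<close>. Uniqueness is asked only pointwise on the carrier,
  and extensionality upgrades it to equality of functions.\<close>

lemma lin_the:
  assumes M: "module R M" and f: "linear_map R M N f" and Pf: "P (restrict f (carrier M))"
    and uniq: "\<And>h h' a. linear_map R M N h \<Longrightarrow> linear_map R M N h' \<Longrightarrow> P h \<Longrightarrow> P h' \<Longrightarrow>
      a \<in> carrier M \<Longrightarrow> h a = h' a"
  shows "(THE h. h \<in> lin R M N \<and> P h) \<in> lin R M N \<and> P (THE h. h \<in> lin R M N \<and> P h)"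
proof (rule theI[of _ "restrict f (carrier M)"])
  show "restrict f (carrier M) \<in> lin R M N \<and> P (restrict f (carrier M))"
    using restrict_lin[OF M f] Pf by blast
  fix h assume "h \<in> lin R M N \<and> P h"
  then show "h = restrict f (carrier M)"
    using lin_eqI[of h R M N "restrict f (carrier M)"] restrict_lin[OF M f] Pf uniq
    by (metis lin_linear)
qed

text \<open>Common source of the maps out of free modules and out of direct sums: each vector has
  finitely many nonzero contributions \<open>c s u\<close>, and the map adds them up. The index set
  varies with the vector, so the proof passes to a common finite index set before comparing
  sums.\<close>

lemma linear_map_finsum_support:
  assumes "module R F" "module R P"
    and c: "\<And>s. s \<in> S \<Longrightarrow> linear_map R F P (c s)"
    and fin: "\<And>u. u \<in> carrier F \<Longrightarrow> finite {s \<in> S. c s u \<noteq> \<zero>\<^bsub>P\<^esub>}"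
  shows "linear_map R F P (\<lambda>u. \<Oplus>\<^bsub>P\<^esub>s\<in>{s \<in> S. c s u \<noteq> \<zero>\<^bsub>P\<^esub>}. c s u)"
proof -
  interpret F: module R F by fact
  interpret P: module R P by fact
  define supp where "supp u = {s \<in> S. c s u \<noteq> \<zero>\<^bsub>P\<^esub>}" for u
  have cl: "c s u \<in> carrier P" if "s \<in> S" "u \<in> carrier F" for s u
    using linear_map_closed[OF c] that by blast
  have sum_eq: "(\<Oplus>\<^bsub>P\<^esub>s\<in>supp u. c s u) = (\<Oplus>\<^bsub>P\<^esub>s\<in>T. c s u)"
    if "finite T" "T \<subseteq> S" "supp u \<subseteq> T" "u \<in> carrier F" for u T
    using that cl by (intro P.add.finprod_mono_neutral_cong_left) (auto simp: supp_def)
  have fs: "finite (supp u)" "supp u \<subseteq> S" if "u \<in> carrier F" for u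
    using fin[OF that] by (auto simp: supp_def)
  have "linear_map R F P (\<lambda>u. \<Oplus>\<^bsub>P\<^esub>s\<in>supp u. c s u)"
  proof (rule linear_mapI)
    fix u assume u: "u \<in> carrier F"
    show "(\<Oplus>\<^bsub>P\<^esub>s\<in>supp u. c s u) \<in> carrier P"
      using u fs(2) cl by (intro P.finsum_closed) blast
    fix v assume v: "v \<in> carrier F"
    \<comment> \<open>Cancellation can make the support of the sum smaller than this union, never
      larger.\<close>
    let ?T = "supp u \<union> supp v"
    have T: "finite ?T" "?T \<subseteq> S" using fs u v by auto
    have add: "c s (u \<oplus>\<^bsub>F\<^esub> v) = c s u \<oplus>\<^bsub>P\<^esub> c s v" if "s \<in> S" for s
      using linear_map_add[OF c[OF that]] u v by blast
    have "supp (u \<oplus>\<^bsub>F\<^esub> v) \<subseteq> ?T" using add by (auto simp: supp_def)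
    then have "(\<Oplus>\<^bsub>P\<^esub>s\<in>supp (u \<oplus>\<^bsub>F\<^esub> v). c s (u \<oplus>\<^bsub>F\<^esub> v)) = (\<Oplus>\<^bsub>P\<^esub>s\<in>?T. c s (u \<oplus>\<^bsub>F\<^esub> v))"
      using T u v by (intro sum_eq) auto
    also have "\<dots> = (\<Oplus>\<^bsub>P\<^esub>s\<in>?T. c s u \<oplus>\<^bsub>P\<^esub> c s v)"
      using T u v cl add by (intro P.finsum_cong') (auto simp: subset_iff)
    also have "\<dots> = (\<Oplus>\<^bsub>P\<^esub>s\<in>?T. c s u) \<oplus>\<^bsub>P\<^esub> (\<Oplus>\<^bsub>P\<^esub>s\<in>?T. c s v)"
      using T u v cl by (intro P.finsum_addf) (auto simp: subset_iff)
    also have "(\<Oplus>\<^bsub>P\<^esub>s\<in>?T. c s u) = (\<Oplus>\<^bsub>P\<^esub>s\<in>supp u. c s u)"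
      using T u by (intro sum_eq[symmetric]) auto
    also have "(\<Oplus>\<^bsub>P\<^esub>s\<in>?T. c s v) = (\<Oplus>\<^bsub>P\<^esub>s\<in>supp v. c s v)"
      using T v by (intro sum_eq[symmetric]) auto
    finally show "(\<Oplus>\<^bsub>P\<^esub>s\<in>supp (u \<oplus>\<^bsub>F\<^esub> v). c s (u \<oplus>\<^bsub>F\<^esub> v)) =
      (\<Oplus>\<^bsub>P\<^esub>s\<in>supp u. c s u) \<oplus>\<^bsub>P\<^esub> (\<Oplus>\<^bsub>P\<^esub>s\<in>supp v. c s v)" .
  next
    fix r u assume r: "r \<in> carrier R" and u: "u \<in> carrier F"
    have sm: "c s (r \<odot>\<^bsub>F\<^esub> u) = r \<odot>\<^bsub>P\<^esub> c s u" if "s \<in> S" for s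
      using linear_map_smult[OF c[OF that]] r u by blast
    \<comment> \<open>Only an inclusion: r may annihilate a nonzero contribution.\<close>
    have "supp (r \<odot>\<^bsub>F\<^esub> u) \<subseteq> supp u" using sm r by (auto simp: supp_def)
    then have "(\<Oplus>\<^bsub>P\<^esub>s\<in>supp (r \<odot>\<^bsub>F\<^esub> u). c s (r \<odot>\<^bsub>F\<^esub> u)) = (\<Oplus>\<^bsub>P\<^esub>s\<in>supp u. c s (r \<odot>\<^bsub>F\<^esub> u))"
      using fs r u by (intro sum_eq) auto
    also have "\<dots> = (\<Oplus>\<^bsub>P\<^esub>s\<in>supp u. r \<odot>\<^bsub>P\<^esub> c s u)"
      using r u cl sm by (intro P.finsum_cong') (auto simp: supp_def)
    also have "\<dots> = r \<odot>\<^bsub>P\<^esub> (\<Oplus>\<^bsub>P\<^esub>s\<in>supp u. c s u)"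
      using r u cl fs by (intro P.finsum_smult_ldistr[symmetric]) (auto simp: supp_def)
    finally show "(\<Oplus>\<^bsub>P\<^esub>s\<in>supp (r \<odot>\<^bsub>F\<^esub> u). c s (r \<odot>\<^bsub>F\<^esub> u)) =
      r \<odot>\<^bsub>P\<^esub> (\<Oplus>\<^bsub>P\<^esub>s\<in>supp u. c s u)" .
  qed
  then show ?thesis by (simp add: supp_def)
qed


section \<open>Free modules, quotients and spans\<close>

context cring
begin

lemma module_reg_mod: "module R (reg_mod R)"
proof (rule moduleI)
  show "abelian_group (reg_mod R)"
  proof (rule abelian_groupI)
    fix a assume "a \<in> carrier (reg_mod R)"
    then show "\<exists>b\<in>carrier (reg_mod R). b \<oplus>\<^bsub>reg_mod R\<^esub> a = \<zero>\<^bsub>reg_mod R\<^esub>"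
      by (intro bexI[of _ "\<ominus> a"]) (auto simp: reg_mod_def l_neg)
  qed (auto simp: reg_mod_def a_ac)
qed (auto simp: reg_mod_def is_cring m_assoc l_distr r_distr)

text \<open>This is the value of \<open>odo_unit\<close> off the diagonal: the base ring with its
  carrier cut down to zero.\<close>

lemma module_zero_mod: "module R ((reg_mod R)\<lparr>carrier := {\<zero>}\<rparr>)"
  by (rule moduleI) (auto intro!: abelian_groupI is_cring simp: reg_mod_def)

lemma free_mod_simps:
  "carrier (free_mod R S) =
    {u. (\<forall>s. u s \<in> carrier R) \<and> (\<forall>s. s \<notin> S \<longrightarrow> u s = \<zero>) \<and> finite {s. u s \<noteq> \<zero>}}"
  "\<zero>\<^bsub>free_mod R S\<^esub> = (\<lambda>s. \<zero>)"
  "u \<oplus>\<^bsub>free_mod R S\<^esub> v = (\<lambda>s. u s \<oplus> v s)"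
  "r \<odot>\<^bsub>free_mod R S\<^esub> u = (\<lambda>s. r \<otimes> u s)"
  by (simp_all add: free_mod_def)

lemma module_free_mod: "module R (free_mod R S)"
proof (rule moduleI)
  have add: "(\<lambda>s. u s \<oplus> v s) \<in> carrier (free_mod R S)"
    if "u \<in> carrier (free_mod R S)" "v \<in> carrier (free_mod R S)" for u v
  proof -
    have "{s. u s \<oplus> v s \<noteq> \<zero>} \<subseteq> {s. u s \<noteq> \<zero>} \<union> {s. v s \<noteq> \<zero>}" by auto
    then show ?thesis using that by (auto simp: free_mod_simps elim!: finite_subset)
  qed
  have smult: "(\<lambda>s. r \<otimes> u s) \<in> carrier (free_mod R S)"
    if "r \<in> carrier R" "u \<in> carrier (free_mod R S)" for r u
  proof -
    have "{s. r \<otimes> u s \<noteq> \<zero>} \<subseteq> {s. u s \<noteq> \<zero>}" using that(1) by auto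
    then show ?thesis using that by (auto simp: free_mod_simps elim!: finite_subset)
  qed
  show "abelian_group (free_mod R S)"
  proof (rule abelian_groupI)
    fix u assume u: "u \<in> carrier (free_mod R S)"
    \<comment> \<open>The additive inverse is taken as the multiple by -1, so that finiteness of its
      support is already covered by \<open>smult\<close>.\<close>
    have "(\<lambda>s. \<ominus> \<one> \<otimes> u s) \<in> carrier (free_mod R S)" by (rule smult[OF _ u]) simp
    moreover have "(\<lambda>s. \<ominus> \<one> \<otimes> u s) \<oplus>\<^bsub>free_mod R S\<^esub> u = \<zero>\<^bsub>free_mod R S\<^esub>"
      using u by (auto simp: free_mod_simps l_minus l_neg)
    ultimately show "\<exists>v\<in>carrier (free_mod R S). v \<oplus>\<^bsub>free_mod R S\<^esub> u = \<zero>\<^bsub>free_mod R S\<^esub>" by blast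
  qed (auto simp: add free_mod_simps(2-4), auto simp: free_mod_simps a_ac)
  show "\<And>r u. r \<in> carrier R \<Longrightarrow> u \<in> carrier (free_mod R S) \<Longrightarrow>
    r \<odot>\<^bsub>free_mod R S\<^esub> u \<in> carrier (free_mod R S)"
    by (simp only: free_mod_simps(4) smult)
qed (auto simp: free_mod_simps is_cring l_distr r_distr m_assoc)

lemma basis_vec_closed: "s \<in> S \<Longrightarrow> basis_vec R s \<in> carrier (free_mod R S)"
  by (auto simp: free_mod_simps basis_vec_def)

text \<open>Induction on a finite set containing the support: one coordinate is split off as a
  multiple of a basis vector, and what remains is supported in a smaller set.\<close>

lemma free_mod_induct:
  assumes u: "u \<in> carrier (free_mod R S)"
    and zero: "Q (\<zero>\<^bsub>free_mod R S\<^esub>)"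
    and basis: "\<And>r s. r \<in> carrier R \<Longrightarrow> s \<in> S \<Longrightarrow> Q (r \<odot>\<^bsub>free_mod R S\<^esub> basis_vec R s)"
    and add: "\<And>u v. u \<in> carrier (free_mod R S) \<Longrightarrow> v \<in> carrier (free_mod R S) \<Longrightarrow>
      Q u \<Longrightarrow> Q v \<Longrightarrow> Q (u \<oplus>\<^bsub>free_mod R S\<^esub> v)"
  shows "Q u"
proof -
  interpret F: module R "free_mod R S" by (rule module_free_mod)
  have "Q u" if "finite T" "{s. u s \<noteq> \<zero>} \<subseteq> T" "u \<in> carrier (free_mod R S)" for T u
    using that
  proof (induction T arbitrary: u rule: finite_induct)
    case empty
    then have "u = \<zero>\<^bsub>free_mod R S\<^esub>" by (auto simp: free_mod_simps)
    then show ?case using zero by simp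
  next
    case (insert t T)
    show ?case
    proof (cases "t \<in> S")
      case False
      \<comment> \<open>Outside S all coordinates vanish, so the smaller set already contains the
        support.\<close>
      then show ?thesis using insert by (intro insert.IH) (auto simp: free_mod_simps)
    next
      case True
      let ?u = "u(t := \<zero>)"
      have "{s. ?u s \<noteq> \<zero>} \<subseteq> {s. u s \<noteq> \<zero>}" by auto
      then have u': "?u \<in> carrier (free_mod R S)"
        using insert.prems by (auto simp: free_mod_simps intro: finite_subset)
      have "{s. ?u s \<noteq> \<zero>} \<subseteq> T" using insert.prems by auto
      then have "Q ?u" using u' by (rule insert.IH)
      moreover have ut: "u t \<in> carrier R" using insert.prems by (auto simp: free_mod_simps)
      ultimately have "Q (?u \<oplus>\<^bsub>free_mod R S\<^esub> u t \<odot>\<^bsub>free_mod R S\<^esub> basis_vec R t)"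
        using u' True basis_vec_closed[OF True] by (intro add basis) auto
      also have "?u \<oplus>\<^bsub>free_mod R S\<^esub> u t \<odot>\<^bsub>free_mod R S\<^esub> basis_vec R t = u"
        using insert.prems ut by (auto simp: free_mod_simps basis_vec_def)
      finally show ?thesis .
    qed
  qed
  then show ?thesis using u by (auto simp: free_mod_simps)
qed

lemma free_mod_lift:
  assumes "module R P" and phi: "\<And>s. s \<in> S \<Longrightarrow> \<phi> s \<in> carrier P"
  shows "\<exists>f. linear_map R (free_mod R S) P f \<and> (\<forall>s\<in>S. f (basis_vec R s) = \<phi> s)"
proof -
  interpret P: module R P by fact
  let ?c = "\<lambda>s u. u s \<odot>\<^bsub>P\<^esub> \<phi> s"
  let ?f = "\<lambda>u. \<Oplus>\<^bsub>P\<^esub>s\<in>{s \<in> S. ?c s u \<noteq> \<zero>\<^bsub>P\<^esub>}. ?c s u"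
  have "linear_map R (free_mod R S) P ?f"
  proof (rule linear_map_finsum_support[OF module_free_mod \<open>module R P\<close>])
    show "linear_map R (free_mod R S) P (?c s)" if "s \<in> S" for s
      using phi[OF that] by (auto intro!: linear_mapI
          simp: free_mod_simps P.smult_l_distr P.smult_assoc1)
    show "finite {s \<in> S. ?c s u \<noteq> \<zero>\<^bsub>P\<^esub>}" if "u \<in> carrier (free_mod R S)" for u
    proof -
      have "{s \<in> S. ?c s u \<noteq> \<zero>\<^bsub>P\<^esub>} \<subseteq> {s. u s \<noteq> \<zero>}" using phi by auto
      then show ?thesis using that by (auto simp: free_mod_simps intro: finite_subset)
    qed
  qed
  moreover have "?f (basis_vec R t) = \<phi> t" if t: "t \<in> S" for t
  proof -
    \<comment> \<open>The index set is enlarged to {t} rather than identified with it, because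
      \<phi> t itself may be zero.\<close>
    have "?f (basis_vec R t) = (\<Oplus>\<^bsub>P\<^esub>s\<in>{t}. ?c s (basis_vec R t))"
      using t phi by (intro P.add.finprod_mono_neutral_cong_left) (auto simp: basis_vec_def)
    also have "\<dots> = \<phi> t" using t phi by (simp add: basis_vec_def)
    finally show ?thesis .
  qed
  ultimately show ?thesis by blast
qed

text \<open>Opens the coset calculus of additive groups, such as \<open>a_rcos_sum\<close> and
  \<open>a_repr_independence'\<close>, to submodules.\<close>

lemma submodule_abelian_subgroup:
  assumes "module R M" "submodule K R M"
  shows "abelian_subgroup K M"
proof -
  interpret M: module R M by fact
  interpret K: submodule K R M by fact
  show ?thesis
    by (intro abelian_subgroupI2 M.a_comm_group K.subgroup_axioms)
qed

section \<open>Quotient modules and their universal property\<close>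

context
  fixes M :: "('a, 'c) module" and K
  assumes M: "module R M" and K: "submodule K R M"
begin

interpretation M: module R M by (rule M)
interpretation K: abelian_subgroup K M by (rule submodule_abelian_subgroup[OF M K])

text \<open>The scalar action is defined as a union over all representatives of a coset. The union
  is a single coset: representatives differ by elements of K, and K is closed under scalars, so each
  of them contributes the same coset.\<close>

lemma quot_mod_smult:
  assumes "r \<in> carrier R" "u \<in> carrier M"
  shows "r \<odot>\<^bsub>quot_mod M K\<^esub> (K +>\<^bsub>M\<^esub> u) = K +>\<^bsub>M\<^esub> (r \<odot>\<^bsub>M\<^esub> u)"
proof -
  have "K +>\<^bsub>M\<^esub> (r \<odot>\<^bsub>M\<^esub> v) = K +>\<^bsub>M\<^esub> (r \<odot>\<^bsub>M\<^esub> u)" if v: "v \<in> K +>\<^bsub>M\<^esub> u" for v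
  proof (rule K.a_repr_independence'[symmetric])
    obtain k where k: "k \<in> K" "v = k \<oplus>\<^bsub>M\<^esub> u" using v by (auto simp: a_r_coset_def')
    then have "r \<odot>\<^bsub>M\<^esub> v = r \<odot>\<^bsub>M\<^esub> k \<oplus>\<^bsub>M\<^esub> r \<odot>\<^bsub>M\<^esub> u"
      using assms by (simp add: M.smult_r_distr)
    moreover have "r \<odot>\<^bsub>M\<^esub> k \<in> K" using k assms M.submoduleE(4)[OF K] by blast
    ultimately show "r \<odot>\<^bsub>M\<^esub> v \<in> K +>\<^bsub>M\<^esub> (r \<odot>\<^bsub>M\<^esub> u)" by (auto simp: a_r_coset_def')
  qed (use assms in auto)
  moreover have "u \<in> K +>\<^bsub>M\<^esub> u" using assms K.a_rcos_self by blast
  ultimately have "(\<Union>v\<in>K +>\<^bsub>M\<^esub> u. K +>\<^bsub>M\<^esub> (r \<odot>\<^bsub>M\<^esub> v)) = K +>\<^bsub>M\<^esub> (r \<odot>\<^bsub>M\<^esub> u)"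
    by (intro SUP_eq_const) blast+
  then show ?thesis by (simp add: quot_mod_def)
qed

lemma quot_mod_add:
  assumes "u \<in> carrier M" "v \<in> carrier M"
  shows "(K +>\<^bsub>M\<^esub> u) \<oplus>\<^bsub>quot_mod M K\<^esub> (K +>\<^bsub>M\<^esub> v) = K +>\<^bsub>M\<^esub> (u \<oplus>\<^bsub>M\<^esub> v)"
  using assms by (simp add: quot_mod_def K.a_rcos_sum)

lemma quot_mod_zero: "\<zero>\<^bsub>quot_mod M K\<^esub> = K +>\<^bsub>M\<^esub> \<zero>\<^bsub>M\<^esub>"
  using K.a_subset by (simp add: quot_mod_def)

lemma quot_mod_carrier: "carrier (quot_mod M K) = (\<lambda>u. K +>\<^bsub>M\<^esub> u) ` carrier M"
  by (auto simp: quot_mod_def A_RCOSETS_def')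

lemma module_quot_mod: "module R (quot_mod M K)"
proof (rule moduleI)
  show "abelian_group (quot_mod M K)"
  proof (rule abelian_groupI)
    fix C assume "C \<in> carrier (quot_mod M K)"
    then obtain u where u: "u \<in> carrier M" "C = K +>\<^bsub>M\<^esub> u" by (auto simp: quot_mod_carrier)
    then have "(K +>\<^bsub>M\<^esub> (\<ominus>\<^bsub>M\<^esub> u)) \<oplus>\<^bsub>quot_mod M K\<^esub> C = \<zero>\<^bsub>quot_mod M K\<^esub>"
      by (simp add: quot_mod_add quot_mod_zero M.l_neg)
    with u(1) show "\<exists>D\<in>carrier (quot_mod M K). D \<oplus>\<^bsub>quot_mod M K\<^esub> C = \<zero>\<^bsub>quot_mod M K\<^esub>"
      by (auto simp: quot_mod_carrier)
  qed (auto simp: quot_mod_carrier quot_mod_add quot_mod_zero M.a_ac)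
qed (auto simp: quot_mod_carrier quot_mod_smult quot_mod_add is_cring M.smult_l_distr
    M.smult_r_distr M.smult_assoc1)

lemma quot_mod_eqI:
  assumes "u \<in> carrier M" "v \<in> carrier M" "u \<ominus>\<^bsub>M\<^esub> v \<in> K"
  shows "K +>\<^bsub>M\<^esub> u = K +>\<^bsub>M\<^esub> v"
proof (rule K.a_repr_independence'[symmetric])
  have "u = (u \<ominus>\<^bsub>M\<^esub> v) \<oplus>\<^bsub>M\<^esub> v"
    using assms by (simp add: a_minus_def M.a_assoc M.l_neg)
  with assms(3) show "u \<in> K +>\<^bsub>M\<^esub> v" by (auto simp: a_r_coset_def')
qed (use assms in auto)

lemma quot_mod_lift:
  assumes P: "module R P" and f: "linear_map R M P f" and ker: "\<And>u. u \<in> K \<Longrightarrow> f u = \<zero>\<^bsub>P\<^esub>"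
  shows "\<exists>h. linear_map R (quot_mod M K) P h \<and> (\<forall>u\<in>carrier M. h (K +>\<^bsub>M\<^esub> u) = f u)"
proof -
  interpret P: module R P by fact
  \<comment> \<open>An arbitrary representative is chosen; two representatives differ by an element
    of K, which f sends to zero.\<close>
  define h where "h C = f (SOME u. u \<in> C)" for C
  have h: "h (K +>\<^bsub>M\<^esub> u) = f u" if u: "u \<in> carrier M" for u
  proof -
    have "(SOME v. v \<in> K +>\<^bsub>M\<^esub> u) \<in> K +>\<^bsub>M\<^esub> u" using K.a_rcos_self[OF u] by (rule someI)
    then obtain k where k: "k \<in> K" "(SOME v. v \<in> K +>\<^bsub>M\<^esub> u) = k \<oplus>\<^bsub>M\<^esub> u"
      by (auto simp: a_r_coset_def')
    have "f (k \<oplus>\<^bsub>M\<^esub> u) = f u"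
      using k u ker by (simp add: linear_map_add[OF f] linear_map_closed[OF f])
    with k(2) show ?thesis by (simp add: h_def)
  qed
  have "linear_map R (quot_mod M K) P h"
    by (rule linear_mapI)
      (auto simp: quot_mod_carrier quot_mod_smult quot_mod_add h linear_map_add[OF f]
        linear_map_smult[OF f] linear_map_closed[OF f])
  with h show ?thesis by blast
qed

end

text \<open>Lets a linear map that kills a generating set kill its whole span: the kernel is one of
  the submodules over which the span is an intersection.\<close>

lemma submodule_kernel:
  assumes "module R M" "module R P" "linear_map R M P f"
  shows "submodule {u \<in> carrier M. f u = \<zero>\<^bsub>P\<^esub>} R M"
proof -
  interpret M: module R M by fact
  interpret P: module R P by fact
  have "f (\<ominus>\<^bsub>M\<^esub> u) = \<ominus>\<^bsub>P\<^esub> f u" if "u \<in> carrier M" for u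
    using linear_map_minus[OF assms, of "\<zero>\<^bsub>M\<^esub>" u] that linear_map_zero[OF assms]
    by (simp add: a_minus_def linear_map_closed[OF assms(3)])
  then show ?thesis
    by (intro M.submoduleI) (auto simp: linear_map_zero[OF assms] linear_map_add[OF assms(3)]
        linear_map_smult[OF assms(3)])
qed

lemma span_mod_submodule:
  assumes "module R M" "S \<subseteq> carrier M"
  shows "submodule (span_mod R M S) R M"
proof -
  interpret M: module R M by fact
  let ?C = "{K. submodule K R M \<and> S \<subseteq> K}"
  \<comment> \<open>The whole module belongs to the family, so the intersection is over a nonempty
    family and stays inside the carrier.\<close>
  have "carrier M \<in> ?C" using M.carrier_is_submodule assms(2) by blast
  then have sub: "\<Inter>?C \<subseteq> carrier M" by blast
  have zero: "\<zero>\<^bsub>M\<^esub> \<in> K" if "submodule K R M" for K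
    using subgroup.one_closed[OF submodule.axioms(1)[OF that]] by simp
  show ?thesis
    unfolding span_mod_def
  proof (rule M.submoduleI[OF sub])
    show "\<zero>\<^bsub>M\<^esub> \<in> \<Inter>?C" using zero by blast
    fix a b assume ab: "a \<in> \<Inter>?C" "b \<in> \<Inter>?C"
    then show "\<ominus>\<^bsub>M\<^esub> a \<in> \<Inter>?C" "a \<oplus>\<^bsub>M\<^esub> b \<in> \<Inter>?C"
      using M.submoduleE(3,5) by auto
  next
    fix r a assume "r \<in> carrier R" "a \<in> \<Inter>?C"
    then show "r \<odot>\<^bsub>M\<^esub> a \<in> \<Inter>?C" using M.submoduleE(4) by auto
  qed
qed

lemma span_mod_superset: "S \<subseteq> span_mod R M S"
  by (auto simp: span_mod_def)

lemma span_mod_minimal: "submodule K R M \<Longrightarrow> S \<subseteq> K \<Longrightarrow> span_mod R M S \<subseteq> K"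
  by (auto simp: span_mod_def)

end

section \<open>Tensor products\<close>

definition bilinear_map where
  "bilinear_map R M N P f \<longleftrightarrow>
     (\<forall>b\<in>carrier N. linear_map R M P (\<lambda>a. f a b)) \<and> (\<forall>a\<in>carrier M. linear_map R N P (f a))"

lemma
  assumes "bilinear_map R M N P f"
  shows bilinear_map_left: "b \<in> carrier N \<Longrightarrow> linear_map R M P (\<lambda>a. f a b)"
    and bilinear_map_right: "a \<in> carrier M \<Longrightarrow> linear_map R N P (f a)"
  using assms by (auto simp: bilinear_map_def)

lemma bilinear_map_closed:
  "bilinear_map R M N P f \<Longrightarrow> a \<in> carrier M \<Longrightarrow> b \<in> carrier N \<Longrightarrow> f a b \<in> carrier P"
  by (auto simp: bilinear_map_def linear_map_def)

lemma bilinear_map_comp: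
  assumes "bilinear_map R M' N' P \<beta>" "linear_map R M M' f" "linear_map R N N' g"
  shows "bilinear_map R M N P (\<lambda>a b. \<beta> (f a) (g b))"
  using assms by (auto simp: bilinear_map_def intro: linear_map_comp linear_map_closed)

lemma linear_bilinear_map_comp:
  assumes "bilinear_map R M N P \<beta>" "linear_map R P Q h"
  shows "bilinear_map R M N Q (\<lambda>a b. h (\<beta> a b))"
  using assms by (auto simp: bilinear_map_def intro: linear_map_comp)

text \<open>Maps out of iterated tensor products and tensor products of direct sums are obtained by currying.\<close>
definition hom_mod ::
  "('r, 'm) ring_scheme \<Rightarrow> ('r, 'a) module \<Rightarrow> ('r, 'b) module \<Rightarrow> ('r, 'a \<Rightarrow> 'b) module" where
  "hom_mod R M N = \<lparr>carrier = lin R M N, mult = undefined, one = undefined,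
     zero = (\<lambda>a\<in>carrier M. \<zero>\<^bsub>N\<^esub>), add = (\<lambda>f g. \<lambda>a\<in>carrier M. f a \<oplus>\<^bsub>N\<^esub> g a),
     smult = (\<lambda>r f. \<lambda>a\<in>carrier M. r \<odot>\<^bsub>N\<^esub> f a)\<rparr>"

lemma module_hom_mod:
  assumes "module R M" "module R N"
  shows "module R (hom_mod R M N)"
proof -
  interpret M: module R M by fact
  interpret N: module R N by fact
  have add: "(\<lambda>a\<in>carrier M. f a \<oplus>\<^bsub>N\<^esub> g a) \<in> lin R M N"
    if "f \<in> lin R M N" "g \<in> lin R M N" for f g
  proof -
    note f = that(1)[THEN lin_linear] and g = that(2)[THEN lin_linear]
    show ?thesis
      by (intro restrict_lin assms linear_mapI)
        (simp_all add: f g linear_map_closed[OF f] linear_map_closed[OF g] linear_map_add[OF f]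
          linear_map_add[OF g] linear_map_smult[OF f] linear_map_smult[OF g] N.a_ac N.smult_r_distr)
  qed
  \<comment> \<open>Homogeneity of the multiple r f requires moving r past another scalar; this is
    where commutativity of R enters.\<close>
  have smult: "(\<lambda>a\<in>carrier M. r \<odot>\<^bsub>N\<^esub> f a) \<in> lin R M N"
    if "r \<in> carrier R" "f \<in> lin R M N" for r f
  proof -
    note f = that(2)[THEN lin_linear]
    show ?thesis
      using that(1) by (intro restrict_lin assms linear_mapI)
        (simp_all add: linear_map_closed[OF f] linear_map_add[OF f] linear_map_smult[OF f]
          N.smult_r_distr N.smult_assoc1[symmetric] M.m_comm)
  qed
  have zero: "(\<lambda>a\<in>carrier M. \<zero>\<^bsub>N\<^esub>) \<in> lin R M N"
    by (intro restrict_lin assms linear_map_const_zero)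
  \<comment> \<open>Sums and multiples in the hom module are restricted to the carrier. Laws such as
    1 f = f are equalities of functions and thus rely on f being extensional.\<close>
  have ext: "(\<lambda>a\<in>carrier M. h a) = f" if "f \<in> lin R M N" "\<And>a. a \<in> carrier M \<Longrightarrow> h a = f a" for f h
    using that by (intro extensionalityI[where A = "carrier M"]) (simp_all add: lin_iff)
  have cl: "f a \<in> carrier N" if "f \<in> lin R M N" "a \<in> carrier M" for f a
    by (rule linear_map_closed[OF lin_linear[OF that(1)] that(2)])
  show ?thesis
  proof (rule moduleI)
    show "abelian_group (hom_mod R M N)"
    proof (rule abelian_groupI)
      fix f assume f: "f \<in> carrier (hom_mod R M N)"
      then have "(\<lambda>a\<in>carrier M. (\<ominus>\<^bsub>R\<^esub> \<one>\<^bsub>R\<^esub>) \<odot>\<^bsub>N\<^esub> f a) \<in> carrier (hom_mod R M N)"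
        using smult[of "\<ominus>\<^bsub>R\<^esub> \<one>\<^bsub>R\<^esub>" f] by (simp add: hom_mod_def)
      moreover have "(\<lambda>a\<in>carrier M. (\<ominus>\<^bsub>R\<^esub> \<one>\<^bsub>R\<^esub>) \<odot>\<^bsub>N\<^esub> f a) \<oplus>\<^bsub>hom_mod R M N\<^esub> f = \<zero>\<^bsub>hom_mod R M N\<^esub>"
        using f by (auto simp: hom_mod_def cl N.smult_l_minus N.l_neg intro!: restrict_ext)
      ultimately show "\<exists>g\<in>carrier (hom_mod R M N). g \<oplus>\<^bsub>hom_mod R M N\<^esub> f = \<zero>\<^bsub>hom_mod R M N\<^esub>"
        by blast
    qed (auto simp: hom_mod_def add zero cl N.a_ac intro!: restrict_ext ext)
  qed (auto simp: hom_mod_def smult cl M.is_cring N.smult_l_distr N.smult_r_distr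
      N.smult_assoc1 intro!: restrict_ext ext)
qed

text \<open>One half of the tensor-hom adjunction. The inner restriction is what places each partial
  map in \<open>lin\<close>, the carrier of the hom module.\<close>

lemma bilinear_map_curry:
  assumes "module R N" "module R P" "bilinear_map R M N P f"
  shows "linear_map R M (hom_mod R N P) (\<lambda>a. \<lambda>b\<in>carrier N. f a b)"
proof -
  interpret N: module R N by fact
  show ?thesis
    by (intro linear_mapI)
      (auto simp: hom_mod_def linear_map_add[OF bilinear_map_left[OF assms(3)]]
        linear_map_smult[OF bilinear_map_left[OF assms(3)]]
        intro!: restrict_ext restrict_lin[OF assms(1)] bilinear_map_right[OF assms(3)])
qed

lemma bilinear_map_uncurry:
  assumes "linear_map R M (hom_mod R N P) f"
  shows "bilinear_map R M N P f"
proof -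
  have f: "f a \<in> lin R N P" if "a \<in> carrier M" for a
    using linear_map_closed[OF assms that] by (simp add: hom_mod_def)
  have cl: "f a b \<in> carrier P" if "a \<in> carrier M" "b \<in> carrier N" for a b
    by (rule linear_map_closed[OF lin_linear[OF f[OF that(1)]] that(2)])
  show ?thesis
    unfolding bilinear_map_def
    by (auto simp: cl lin_linear[OF f] linear_map_add[OF assms] linear_map_smult[OF assms]
        intro!: linear_mapI) (simp_all add: hom_mod_def)
qed

context cring
begin

section \<open>Construction and universal property of the tensor product\<close>

context
  fixes M :: "('a, 'c) module" and N :: "('a, 'd) module"
  assumes M: "module R M" and N: "module R N"
begin

interpretation M: module R M by (rule M)
interpretation N: module R N by (rule N)

private abbreviation "F \<equiv> free_mod R (carrier M \<times> carrier N)"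

interpretation F: module R F by (rule module_free_mod)

lemma tensor_relators_closed: "tensor_relators R M N \<subseteq> carrier F"
  unfolding tensor_relators_def Let_def
  by (auto intro!: basis_vec_closed)

lemma tensor_kernel_submodule: "submodule (tensor_kernel R M N) R F"
  unfolding tensor_kernel_def
  by (rule span_mod_submodule[OF module_free_mod tensor_relators_closed])

lemma tensor_relators_kernel: "tensor_relators R M N \<subseteq> tensor_kernel R M N"
  unfolding tensor_kernel_def by (rule span_mod_superset)

lemma module_tensor: "module R (tensor R M N)"
  unfolding tensor_def by (rule module_quot_mod[OF module_free_mod tensor_kernel_submodule])

text \<open>Each of the four families of relators is one of the four bilinearity laws: a difference
  lying in the kernel is an equality of cosets.\<close>

lemma pure_tensor_bilinear: "bilinear_map R M N (tensor R M N) (pure_tensor R M N)"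
proof -
  note K = module_free_mod tensor_kernel_submodule
  have cl: "pure_tensor R M N a b \<in> carrier (tensor R M N)"
    if "a \<in> carrier M" "b \<in> carrier N" for a b
    using that by (auto simp: pure_tensor_def tensor_def quot_mod_carrier[OF K] basis_vec_closed)
  have eqI: "tensor_kernel R M N +>\<^bsub>F\<^esub> u = tensor_kernel R M N +>\<^bsub>F\<^esub> v"
    if "u \<ominus>\<^bsub>F\<^esub> v \<in> tensor_relators R M N" "u \<in> carrier F" "v \<in> carrier F" for u v
    using that tensor_relators_kernel by (intro quot_mod_eqI[OF K]) auto
  have add: "pure_tensor R M N a b = pure_tensor R M N c d \<oplus>\<^bsub>tensor R M N\<^esub> pure_tensor R M N c' d'"
    if "basis_vec R (a, b) \<ominus>\<^bsub>F\<^esub> (basis_vec R (c, d) \<oplus>\<^bsub>F\<^esub> basis_vec R (c', d')) \<in> tensor_relators R M N"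
      "a \<in> carrier M" "b \<in> carrier N" "c \<in> carrier M" "d \<in> carrier N" "c' \<in> carrier M" "d' \<in> carrier N"
    for a b c d c' d'
    using that by (simp add: pure_tensor_def tensor_def quot_mod_add[OF K] basis_vec_closed eqI)
  have smult: "pure_tensor R M N a b = r \<odot>\<^bsub>tensor R M N\<^esub> pure_tensor R M N c d"
    if "basis_vec R (a, b) \<ominus>\<^bsub>F\<^esub> (r \<odot>\<^bsub>F\<^esub> basis_vec R (c, d)) \<in> tensor_relators R M N" "r \<in> carrier R"
      "a \<in> carrier M" "b \<in> carrier N" "c \<in> carrier M" "d \<in> carrier N"
    for r a b c d
    using that by (simp add: pure_tensor_def tensor_def quot_mod_smult[OF K] basis_vec_closed eqI)
  show ?thesis
    unfolding bilinear_map_def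
  proof (intro conjI ballI linear_mapI)
    fix a a' b assume "a \<in> carrier M" "a' \<in> carrier M" "b \<in> carrier N"
    then show "pure_tensor R M N (a \<oplus>\<^bsub>M\<^esub> a') b =
        pure_tensor R M N a b \<oplus>\<^bsub>tensor R M N\<^esub> pure_tensor R M N a' b"
      by (intro add) (simp_all, unfold tensor_relators_def Let_def, blast)
  next
    fix a b b' assume "a \<in> carrier M" "b \<in> carrier N" "b' \<in> carrier N"
    then show "pure_tensor R M N a (b \<oplus>\<^bsub>N\<^esub> b') =
        pure_tensor R M N a b \<oplus>\<^bsub>tensor R M N\<^esub> pure_tensor R M N a b'"
      by (intro add) (simp_all, unfold tensor_relators_def Let_def, blast)
  next
    fix r a b assume "r \<in> carrier R" "a \<in> carrier M" "b \<in> carrier N"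
    then show "pure_tensor R M N (r \<odot>\<^bsub>M\<^esub> a) b = r \<odot>\<^bsub>tensor R M N\<^esub> pure_tensor R M N a b"
      "pure_tensor R M N a (r \<odot>\<^bsub>N\<^esub> b) = r \<odot>\<^bsub>tensor R M N\<^esub> pure_tensor R M N a b"
      by (intro smult; simp_all; unfold tensor_relators_def Let_def; blast)+
  qed (simp_all add: cl)
qed

lemmas pure_tensor_closed = bilinear_map_closed[OF pure_tensor_bilinear]

text \<open>The free module consists of sums of multiples of basis vectors. In the quotient a scalar
  is absorbed into the first factor of a pure tensor, so sums of pure tensors exhaust the module;
  zero is covered as 0 times the basis vector at (0, 0).\<close>

lemma tensor_induct:
  assumes t: "t \<in> carrier (tensor R M N)"
    and pure: "\<And>a b. a \<in> carrier M \<Longrightarrow> b \<in> carrier N \<Longrightarrow> Q (pure_tensor R M N a b)"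
    and add: "\<And>t u. t \<in> carrier (tensor R M N) \<Longrightarrow> u \<in> carrier (tensor R M N) \<Longrightarrow>
      Q t \<Longrightarrow> Q u \<Longrightarrow> Q (t \<oplus>\<^bsub>tensor R M N\<^esub> u)"
  shows "Q t"
proof -
  note K = module_free_mod tensor_kernel_submodule
  let ?q = "\<lambda>u. tensor_kernel R M N +>\<^bsub>F\<^esub> u"
  obtain u where u: "u \<in> carrier F" "t = ?q u"
    using t by (auto simp: tensor_def quot_mod_carrier[OF K])
  have smult: "Q (?q (r \<odot>\<^bsub>F\<^esub> basis_vec R s))" if r: "r \<in> carrier R" and s: "s \<in> carrier M \<times> carrier N" for r s
  proof -
    obtain a b where ab: "s = (a, b)" "a \<in> carrier M" "b \<in> carrier N" using s by auto
    have "?q (r \<odot>\<^bsub>F\<^esub> basis_vec R s) = r \<odot>\<^bsub>tensor R M N\<^esub> pure_tensor R M N a b"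
      using r s ab(1) unfolding tensor_def pure_tensor_def
      by (simp only: quot_mod_smult[OF K] basis_vec_closed)
    also have "\<dots> = pure_tensor R M N (r \<odot>\<^bsub>M\<^esub> a) b"
      using linear_map_smult[OF bilinear_map_left[OF pure_tensor_bilinear]] ab r by simp
    finally show ?thesis using pure r ab by simp
  qed
  have "Q (?q u)"
  proof (rule free_mod_induct[where Q = "\<lambda>u. Q (?q u)", OF u(1)])
    have "Q (?q (\<zero> \<odot>\<^bsub>F\<^esub> basis_vec R (\<zero>\<^bsub>M\<^esub>, \<zero>\<^bsub>N\<^esub>)))" by (intro smult) auto
    then show "Q (?q \<zero>\<^bsub>F\<^esub>)" by (simp add: basis_vec_closed)
  next
    fix u v assume uv: "u \<in> carrier F" "v \<in> carrier F" "Q (?q u)" "Q (?q v)"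
    then have "Q (?q u \<oplus>\<^bsub>tensor R M N\<^esub> ?q v)"
      by (intro add) (auto simp: tensor_def quot_mod_carrier[OF K])
    then show "Q (?q (u \<oplus>\<^bsub>F\<^esub> v))" using uv(1,2) by (simp add: tensor_def quot_mod_add[OF K])
  qed (rule smult)
  then show ?thesis using u by simp
qed

lemma tensor_ext:
  assumes "linear_map R (tensor R M N) P h" "linear_map R (tensor R M N) P h'"
    and "t \<in> carrier (tensor R M N)"
    and "\<And>a b. a \<in> carrier M \<Longrightarrow> b \<in> carrier N \<Longrightarrow>
      h (pure_tensor R M N a b) = h' (pure_tensor R M N a b)"
  shows "h t = h' t"
  using assms(3) by (rule tensor_induct)
    (simp_all add: assms(4) linear_map_add[OF assms(1)] linear_map_add[OF assms(2)])

text \<open>The values f a b extend linearly to the free module on pairs. Bilinearity says that this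
  extension kills the relators, hence their span, and so it descends to the quotient.\<close>

lemma tensor_lift:
  assumes P: "module R P" and f: "bilinear_map R M N P f"
  shows "\<exists>h. linear_map R (tensor R M N) P h \<and>
    (\<forall>a\<in>carrier M. \<forall>b\<in>carrier N. h (pure_tensor R M N a b) = f a b)"
proof -
  interpret P: module R P by (rule P)
  note K = module_free_mod tensor_kernel_submodule
  have "\<exists>\<phi>. linear_map R F P \<phi> \<and> (\<forall>s\<in>carrier M \<times> carrier N. \<phi> (basis_vec R s) = (case s of (a, b) \<Rightarrow> f a b))"
    using bilinear_map_closed[OF f] by (intro free_mod_lift[OF P]) auto
  then obtain \<phi> where lin: "linear_map R F P \<phi>"
    and phi: "\<And>a b. a \<in> carrier M \<Longrightarrow> b \<in> carrier N \<Longrightarrow> \<phi> (basis_vec R (a, b)) = f a b"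
    by auto
  note f_left = bilinear_map_left[OF f] and f_right = bilinear_map_right[OF f]
  note simps = linear_map_minus[OF module_free_mod P lin] linear_map_add[OF lin]
    linear_map_smult[OF lin] phi basis_vec_closed linear_map_add[OF f_left] linear_map_add[OF f_right]
    linear_map_smult[OF f_left] linear_map_smult[OF f_right] bilinear_map_closed[OF f]
  have "tensor_relators R M N \<subseteq> {u \<in> carrier F. \<phi> u = \<zero>\<^bsub>P\<^esub>}"
  proof
    fix u assume u: "u \<in> tensor_relators R M N"
    have self: "x \<ominus>\<^bsub>P\<^esub> x = \<zero>\<^bsub>P\<^esub>" if "x \<in> carrier P" for x
      using that by (simp add: a_minus_def P.r_neg)
    from u have "\<phi> u = \<zero>\<^bsub>P\<^esub>"
      unfolding tensor_relators_def Let_def by (auto simp: simps self)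
    then show "u \<in> {u \<in> carrier F. \<phi> u = \<zero>\<^bsub>P\<^esub>}" using u tensor_relators_closed by blast
  qed
  then have "tensor_kernel R M N \<subseteq> {u \<in> carrier F. \<phi> u = \<zero>\<^bsub>P\<^esub>}"
    unfolding tensor_kernel_def
    by (rule span_mod_minimal[OF submodule_kernel[OF module_free_mod P lin]])
  then have "\<exists>h. linear_map R (tensor R M N) P h \<and>
      (\<forall>u\<in>carrier F. h (tensor_kernel R M N +>\<^bsub>F\<^esub> u) = \<phi> u)"
    unfolding tensor_def by (intro quot_mod_lift[OF K P lin]) auto
  then show ?thesis
    by (auto simp: pure_tensor_def phi basis_vec_closed)
qed

text \<open>A bilinear map vanishes when one argument is zero, so all generators vanish. This
  disposes of the summands of I \<odot> M and M \<odot> I that involve an off-diagonal entry of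
  I.\<close>

lemma tensor_zero:
  assumes "carrier M = {\<zero>\<^bsub>M\<^esub>} \<or> carrier N = {\<zero>\<^bsub>N\<^esub>}" "t \<in> carrier (tensor R M N)"
  shows "t = \<zero>\<^bsub>tensor R M N\<^esub>"
proof -
  interpret T: module R "tensor R M N" by (rule module_tensor)
  note zero = linear_map_zero[OF _ module_tensor]
  have "pure_tensor R M N a b = \<zero>\<^bsub>tensor R M N\<^esub>" if "a \<in> carrier M" "b \<in> carrier N" for a b
    using assms(1) that zero[OF M bilinear_map_left[OF pure_tensor_bilinear that(2)]]
      zero[OF N bilinear_map_right[OF pure_tensor_bilinear that(1)]] by auto
  then show ?thesis
    by (intro tensor_induct[where Q = "\<lambda>t. t = \<zero>\<^bsub>tensor R M N\<^esub>", OF assms(2)]) simp_all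
qed

end

end

section \<open>Maps of several arguments and iterated tensor products\<close>

definition trilinear_map where
  "trilinear_map R M N P Q f \<longleftrightarrow>
     (\<forall>c\<in>carrier P. bilinear_map R M N Q (\<lambda>a b. f a b c)) \<and>
     (\<forall>a\<in>carrier M. bilinear_map R N P Q (f a))"

text \<open>The two bilinearity clauses of the definition overlap in the middle argument; together
  they amount to linearity in each argument separately.\<close>

lemma trilinear_mapI:
  assumes "\<And>b c. b \<in> carrier N \<Longrightarrow> c \<in> carrier P \<Longrightarrow> linear_map R M Q (\<lambda>a. f a b c)"
    and "\<And>a c. a \<in> carrier M \<Longrightarrow> c \<in> carrier P \<Longrightarrow> linear_map R N Q (\<lambda>b. f a b c)"
    and "\<And>a b. a \<in> carrier M \<Longrightarrow> b \<in> carrier N \<Longrightarrow> linear_map R P Q (f a b)"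
  shows "trilinear_map R M N P Q f"
  using assms by (simp add: trilinear_map_def bilinear_map_def)

text \<open>Serves the case of four arguments, where a variable of the second pair has to come first
  before the variables of the first pair are curried away.\<close>

lemma trilinear_map_rotate:
  "trilinear_map R M N P Q f \<Longrightarrow> trilinear_map R P M N Q (\<lambda>c a b. f a b c)"
  by (simp add: trilinear_map_def bilinear_map_def)

lemma trilinear_map_curry:
  assumes P: "module R P" and Q: "module R Q" and f: "trilinear_map R M N P Q f"
  shows "bilinear_map R M N (hom_mod R P Q) (\<lambda>a b. \<lambda>c\<in>carrier P. f a b c)"
proof -
  have "bilinear_map R M P Q (\<lambda>a c. f a b c)" if "b \<in> carrier N" for b
    using f that by (simp add: trilinear_map_def bilinear_map_def)
  moreover have "bilinear_map R N P Q (\<lambda>b c. f a b c)" if "a \<in> carrier M" for a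
    using f that by (simp add: trilinear_map_def)
  ultimately show ?thesis
    unfolding bilinear_map_def[of R M N "hom_mod R P Q"]
    by (intro conjI ballI bilinear_map_curry[OF P Q])
qed

context cring
begin

lemma linear_map_pure_left:
  assumes "module R M" "module R N" "linear_map R P M f" "b \<in> carrier N"
  shows "linear_map R P (tensor R M N) (\<lambda>x. pure_tensor R M N (f x) b)"
  using linear_map_comp[OF assms(3) bilinear_map_left[OF pure_tensor_bilinear[OF assms(1,2)] assms(4)]] .

lemma linear_map_pure_right:
  assumes "module R M" "module R N" "linear_map R P N f" "a \<in> carrier M"
  shows "linear_map R P (tensor R M N) (\<lambda>x. pure_tensor R M N a (f x))"
  using linear_map_comp[OF assms(3) bilinear_map_right[OF pure_tensor_bilinear[OF assms(1,2)] assms(4)]] .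

text \<open>Existence comes from the universal property and uniqueness from generation by pure
  tensors; every description by values on pure tensors of two factors is an instance.\<close>

lemma tensor_the:
  assumes M: "module R M" and N: "module R N" and Q: "module R Q"
    and f: "bilinear_map R M N Q f"
  defines "h \<equiv> THE h. h \<in> lin R (tensor R M N) Q \<and>
    (\<forall>a\<in>carrier M. \<forall>b\<in>carrier N. h (pure_tensor R M N a b) = f a b)"
  shows "h \<in> lin R (tensor R M N) Q"
    and "\<And>a b. a \<in> carrier M \<Longrightarrow> b \<in> carrier N \<Longrightarrow> h (pure_tensor R M N a b) = f a b"
proof -
  obtain g where g: "linear_map R (tensor R M N) Q g"
    and gp: "\<And>a b. a \<in> carrier M \<Longrightarrow> b \<in> carrier N \<Longrightarrow> g (pure_tensor R M N a b) = f a b"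
    using tensor_lift[OF M N Q f] by blast
  let ?P = "\<lambda>h. \<forall>a\<in>carrier M. \<forall>b\<in>carrier N. h (pure_tensor R M N a b) = f a b"
  have "h \<in> lin R (tensor R M N) Q \<and> ?P h"
    unfolding h_def
  proof (rule lin_the[where P = ?P, OF module_tensor[OF M N] g])
    fix k k' t assume k: "linear_map R (tensor R M N) Q k" and k': "linear_map R (tensor R M N) Q k'"
      and eq: "\<forall>a\<in>carrier M. \<forall>b\<in>carrier N. k (pure_tensor R M N a b) = f a b" "\<forall>a\<in>carrier M. \<forall>b\<in>carrier N. k' (pure_tensor R M N a b) = f a b"
      and t: "t \<in> carrier (tensor R M N)"
    show "k t = k' t" by (rule tensor_ext[OF M N k k' t]) (simp add: eq)
  qed (simp add: gp pure_tensor_closed[OF M N])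
  then show "h \<in> lin R (tensor R M N) Q"
    and "\<And>a b. a \<in> carrier M \<Longrightarrow> b \<in> carrier N \<Longrightarrow> h (pure_tensor R M N a b) = f a b"
    by simp_all
qed

text \<open>For fixed c the map u \<mapsto> h (u \<otimes> c) is linear on the inner tensor product,
  so extensionality for two factors can be applied twice.\<close>

lemma tensor_ext3:
  assumes M: "module R M" and N: "module R N" and P: "module R P"
    and h: "linear_map R (tensor R (tensor R M N) P) Q h"
    and h': "linear_map R (tensor R (tensor R M N) P) Q h'"
    and t: "t \<in> carrier (tensor R (tensor R M N) P)"
    and eq: "\<And>a b c. a \<in> carrier M \<Longrightarrow> b \<in> carrier N \<Longrightarrow> c \<in> carrier P \<Longrightarrow>
      h (pure_tensor R (tensor R M N) P (pure_tensor R M N a b) c) =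
      h' (pure_tensor R (tensor R M N) P (pure_tensor R M N a b) c)"
  shows "h t = h' t"
proof (rule tensor_ext[OF module_tensor[OF M N] P h h' t])
  fix u c assume u: "u \<in> carrier (tensor R M N)" and c: "c \<in> carrier P"
  note lin = linear_map_pure_left[OF module_tensor[OF M N] P linear_map_id c]
  show "h (pure_tensor R (tensor R M N) P u c) = h' (pure_tensor R (tensor R M N) P u c)"
    by (rule tensor_ext[OF M N linear_map_comp[OF lin h] linear_map_comp[OF lin h'] u])
      (rule eq[OF _ _ c])
qed

lemma tensor_ext4:
  assumes M: "module R M" and N: "module R N" and P: "module R P" and P': "module R P'"
    and h: "linear_map R (tensor R (tensor R M N) (tensor R P P')) Q h"
    and h': "linear_map R (tensor R (tensor R M N) (tensor R P P')) Q h'"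
    and t: "t \<in> carrier (tensor R (tensor R M N) (tensor R P P'))"
    and eq: "\<And>a b c d. a \<in> carrier M \<Longrightarrow> b \<in> carrier N \<Longrightarrow> c \<in> carrier P \<Longrightarrow> d \<in> carrier P' \<Longrightarrow>
      h (pure_tensor R (tensor R M N) (tensor R P P') (pure_tensor R M N a b) (pure_tensor R P P' c d)) =
      h' (pure_tensor R (tensor R M N) (tensor R P P') (pure_tensor R M N a b) (pure_tensor R P P' c d))"
  shows "h t = h' t"
proof (rule tensor_ext3[OF M N module_tensor[OF P P'] h h' t])
  fix a b u assume a: "a \<in> carrier M" and b: "b \<in> carrier N" and u: "u \<in> carrier (tensor R P P')"
  note lin = linear_map_pure_right[OF module_tensor[OF M N] module_tensor[OF P P'] linear_map_id
      pure_tensor_closed[OF M N a b]]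
  show "h (pure_tensor R (tensor R M N) (tensor R P P') (pure_tensor R M N a b) u) =
      h' (pure_tensor R (tensor R M N) (tensor R P P') (pure_tensor R M N a b) u)"
    by (rule tensor_ext[OF P P' linear_map_comp[OF lin h] linear_map_comp[OF lin h'] u])
      (rule eq[OF a b])
qed

text \<open>Currying in c gives a bilinear map into the hom module of P and Q, which factors through
  M \<otimes> N. Uncurrying the factored map makes it bilinear on M \<otimes> N and P, so that it
  lifts once more.\<close>

lemma tensor_lift3:
  assumes M: "module R M" and N: "module R N" and P: "module R P" and Q: "module R Q"
    and f: "trilinear_map R M N P Q f"
  shows "\<exists>h. linear_map R (tensor R (tensor R M N) P) Q h \<and>
    (\<forall>a\<in>carrier M. \<forall>b\<in>carrier N. \<forall>c\<in>carrier P.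
      h (pure_tensor R (tensor R M N) P (pure_tensor R M N a b) c) = f a b c)"
proof -
  obtain g where g: "linear_map R (tensor R M N) (hom_mod R P Q) g"
    and gp: "\<And>a b. a \<in> carrier M \<Longrightarrow> b \<in> carrier N \<Longrightarrow>
      g (pure_tensor R M N a b) = (\<lambda>c\<in>carrier P. f a b c)"
    using tensor_lift[OF M N module_hom_mod[OF P Q] trilinear_map_curry[OF P Q f]] by blast
  obtain h where "linear_map R (tensor R (tensor R M N) P) Q h"
    "\<forall>u\<in>carrier (tensor R M N). \<forall>c\<in>carrier P. h (pure_tensor R (tensor R M N) P u c) = g u c"
    using tensor_lift[OF module_tensor[OF M N] P Q bilinear_map_uncurry[OF g]] by blast
  then show ?thesis
    by (intro exI[of _ h]) (simp add: gp pure_tensor_closed[OF M N])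
qed

text \<open>The second pair is lifted first, with the first pair hidden in an iterated hom module;
  what results is a map of three arguments a, b and an element of P \<otimes> P'. The two hypotheses
  on f fix c or d respectively, and between them express linearity in all four arguments.\<close>

lemma tensor_lift4:
  assumes M: "module R M" and N: "module R N" and P: "module R P" and P': "module R P'"
    and Q: "module R Q"
    and f: "\<And>c. c \<in> carrier P \<Longrightarrow> trilinear_map R M N P' Q (\<lambda>a b d. f a b c d)"
    and f': "\<And>d. d \<in> carrier P' \<Longrightarrow> trilinear_map R M N P Q (\<lambda>a b c. f a b c d)"
  shows "\<exists>h. linear_map R (tensor R (tensor R M N) (tensor R P P')) Q h \<and>
    (\<forall>a\<in>carrier M. \<forall>b\<in>carrier N. \<forall>c\<in>carrier P. \<forall>d\<in>carrier P'.
      h (pure_tensor R (tensor R M N) (tensor R P P') (pure_tensor R M N a b) (pure_tensor R P P' c d))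
      = f a b c d)"
proof -
  note H = module_hom_mod[OF N Q] module_hom_mod[OF M module_hom_mod[OF N Q]]
  \<comment> \<open>Rotation puts the free variable of the second pair first; currying in b and then
    in a leaves a linear map of that variable alone.\<close>
  have "bilinear_map R P P' (hom_mod R M (hom_mod R N Q))
      (\<lambda>c d. \<lambda>a\<in>carrier M. \<lambda>b\<in>carrier N. f a b c d)"
    unfolding bilinear_map_def
    by (intro conjI ballI bilinear_map_curry[OF M H(1)] trilinear_map_curry[OF N Q]
        f[THEN trilinear_map_rotate] f'[THEN trilinear_map_rotate])
  then obtain L where L: "linear_map R (tensor R P P') (hom_mod R M (hom_mod R N Q)) L"
    and Lp: "\<And>c d. c \<in> carrier P \<Longrightarrow> d \<in> carrier P' \<Longrightarrow>
      L (pure_tensor R P P' c d) = (\<lambda>a\<in>carrier M. \<lambda>b\<in>carrier N. f a b c d)"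
    using tensor_lift[OF P P' H(2)] by blast
  note L1 = bilinear_map_uncurry[OF L]
  have "trilinear_map R M N (tensor R P P') Q (\<lambda>a b u. L u a b)"
  proof (rule trilinear_mapI)
    fix a b assume a: "a \<in> carrier M" and b: "b \<in> carrier N"
    show "linear_map R (tensor R P P') Q (\<lambda>u. L u a b)"
      using bilinear_map_left[OF bilinear_map_uncurry[OF bilinear_map_left[OF L1 a]] b] .
  next
    fix b u assume u: "u \<in> carrier (tensor R P P')" and b: "b \<in> carrier N"
    show "linear_map R M Q (\<lambda>a. L u a b)"
      using bilinear_map_left[OF bilinear_map_uncurry[OF bilinear_map_right[OF L1 u]] b] .
  next
    fix a u assume u: "u \<in> carrier (tensor R P P')" and a: "a \<in> carrier M"
    show "linear_map R N Q (\<lambda>b. L u a b)"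
      using bilinear_map_right[OF bilinear_map_uncurry[OF bilinear_map_right[OF L1 u]] a] .
  qed
  from tensor_lift3[OF M N module_tensor[OF P P'] Q this]
  show ?thesis by (auto simp: Lp pure_tensor_closed[OF P P'])
qed

section \<open>Functoriality, associativity, exchange and units of the tensor product\<close>

lemma
  assumes mods: "module R M" "module R N" "module R M'" "module R N'"
    and f: "linear_map R M M' f" and g: "linear_map R N N' g"
  shows tensor_map_lin: "tensor_map R M N M' N' f g \<in> lin R (tensor R M N) (tensor R M' N')"
    and tensor_map_pure: "\<And>a b. a \<in> carrier M \<Longrightarrow> b \<in> carrier N \<Longrightarrow>
      tensor_map R M N M' N' f g (pure_tensor R M N a b) = pure_tensor R M' N' (f a) (g b)"
  using tensor_the[OF mods(1,2) module_tensor[OF mods(3,4)]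
      bilinear_map_comp[OF pure_tensor_bilinear[OF mods(3,4)] f g]]
  unfolding tensor_map_def by simp_all

lemmas tensor_map_linear = lin_linear[OF tensor_map_lin]

text \<open>In the comparison of axioms this fuses, inside a tensor product, the inclusion of a
  summand with \<mu> into a single map with the values of \<open>m\<close>.\<close>

lemma tensor_map_comp:
  assumes mods: "module R M" "module R N" "module R M'" "module R N'" "module R M''" "module R N''"
    and f: "linear_map R M M' f" and g: "linear_map R N N' g"
    and f': "linear_map R M' M'' f'" and g': "linear_map R N' N'' g'"
    and t: "t \<in> carrier (tensor R M N)"
  shows "tensor_map R M' N' M'' N'' f' g' (tensor_map R M N M' N' f g t) =
    tensor_map R M N M'' N'' (\<lambda>a. f' (f a)) (\<lambda>b. g' (g b)) t"
proof -
  note ff = linear_map_comp[OF f f'] and gg = linear_map_comp[OF g g']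
  note l = tensor_map_linear[OF mods(1-4) f g] and l' = tensor_map_linear[OF mods(3-6) f' g']
  show ?thesis
    by (rule tensor_ext[OF mods(1,2) linear_map_comp[OF l l'] tensor_map_linear[OF mods(1,2,5,6) ff gg] t])
      (simp add: tensor_map_pure mods f g f' g' ff gg linear_map_closed[OF f] linear_map_closed[OF g])
qed

text \<open>The description behind \<open>tensor_map\<close> evaluates both maps only on the
  carriers, so maps that agree there give the same function. This allows \<open>m\<close> to replace
  the composite of \<mu> with an inclusion, from which it may differ elsewhere.\<close>

lemma tensor_map_cong:
  assumes "\<And>a. a \<in> carrier M \<Longrightarrow> f a = f' a" "\<And>b. b \<in> carrier N \<Longrightarrow> g b = g' b"
  shows "tensor_map R M N M' N' f g = tensor_map R M N M' N' f' g'"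
  unfolding tensor_map_def using assms by (simp cong: ball_cong)

lemma
  assumes M: "module R M" and N: "module R N" and P: "module R P"
  shows tensor_assoc_linear:
      "linear_map R (tensor R (tensor R M N) P) (tensor R M (tensor R N P)) (tensor_assoc R M N P)"
    and tensor_assoc_pure: "\<And>a b c. a \<in> carrier M \<Longrightarrow> b \<in> carrier N \<Longrightarrow> c \<in> carrier P \<Longrightarrow>
      tensor_assoc R M N P (pure_tensor R (tensor R M N) P (pure_tensor R M N a b) c) =
      pure_tensor R M (tensor R N P) a (pure_tensor R N P b c)"
proof -
  let ?D = "tensor R (tensor R M N) P" and ?Q = "tensor R M (tensor R N P)"
  let ?p = "\<lambda>a b c. pure_tensor R (tensor R M N) P (pure_tensor R M N a b) c"
  let ?q = "\<lambda>a b c. pure_tensor R M (tensor R N P) a (pure_tensor R N P b c)"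
  note mods = M N P module_tensor
  have "trilinear_map R M N P ?Q ?q"
    by (intro trilinear_mapI linear_map_pure_left linear_map_pure_right linear_map_id mods
        pure_tensor_closed)
  then obtain g where g: "linear_map R ?D ?Q g"
    and gp: "\<And>a b c. a \<in> carrier M \<Longrightarrow> b \<in> carrier N \<Longrightarrow> c \<in> carrier P \<Longrightarrow> g (?p a b c) = ?q a b c"
    using tensor_lift3[of M N P ?Q ?q] mods by metis
  let ?P = "\<lambda>h. \<forall>a\<in>carrier M. \<forall>b\<in>carrier N. \<forall>c\<in>carrier P. h (?p a b c) = ?q a b c"
  have "tensor_assoc R M N P \<in> lin R ?D ?Q \<and> ?P (tensor_assoc R M N P)"
    unfolding tensor_assoc_def
  proof (rule lin_the[where P = ?P, OF _ g])
    fix k k' t assume k: "linear_map R ?D ?Q k" and k': "linear_map R ?D ?Q k'"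
      and eq: "\<forall>a\<in>carrier M. \<forall>b\<in>carrier N. \<forall>c\<in>carrier P. k (?p a b c) = ?q a b c" "\<forall>a\<in>carrier M. \<forall>b\<in>carrier N. \<forall>c\<in>carrier P. k' (?p a b c) = ?q a b c"
      and t: "t \<in> carrier ?D"
    show "k t = k' t" by (rule tensor_ext3[OF M N P k k' t]) (simp add: eq)
  qed (simp_all add: mods gp pure_tensor_closed)
  then show "linear_map R ?D ?Q (tensor_assoc R M N P)"
    "\<And>a b c. a \<in> carrier M \<Longrightarrow> b \<in> carrier N \<Longrightarrow> c \<in> carrier P \<Longrightarrow>
      tensor_assoc R M N P (?p a b c) = ?q a b c"
    by (simp_all add: lin_linear)
qed

lemma
  assumes M: "module R M" and N: "module R N" and P: "module R P" and P': "module R P'"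
  shows tensor_switch_linear: "linear_map R (tensor R (tensor R M N) (tensor R P P'))
      (tensor R (tensor R M P) (tensor R N P')) (tensor_switch R M N P P')"
    and tensor_switch_pure:
      "\<And>a b c d. a \<in> carrier M \<Longrightarrow> b \<in> carrier N \<Longrightarrow> c \<in> carrier P \<Longrightarrow> d \<in> carrier P' \<Longrightarrow>
      tensor_switch R M N P P'
        (pure_tensor R (tensor R M N) (tensor R P P') (pure_tensor R M N a b) (pure_tensor R P P' c d)) =
      pure_tensor R (tensor R M P) (tensor R N P') (pure_tensor R M P a c) (pure_tensor R N P' b d)"
proof -
  let ?D = "tensor R (tensor R M N) (tensor R P P')" and ?Q = "tensor R (tensor R M P) (tensor R N P')"
  let ?p = "\<lambda>a b c d.
    pure_tensor R (tensor R M N) (tensor R P P') (pure_tensor R M N a b) (pure_tensor R P P' c d)"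
  let ?q = "\<lambda>a b c d.
    pure_tensor R (tensor R M P) (tensor R N P') (pure_tensor R M P a c) (pure_tensor R N P' b d)"
  note mods = M N P P' module_tensor
  have "trilinear_map R M N P' ?Q (\<lambda>a b d. ?q a b c d)" if "c \<in> carrier P" for c
    by (intro trilinear_mapI linear_map_pure_left linear_map_pure_right linear_map_id mods
        pure_tensor_closed that)
  moreover have "trilinear_map R M N P ?Q (\<lambda>a b c. ?q a b c d)" if "d \<in> carrier P'" for d
    by (intro trilinear_mapI linear_map_pure_left linear_map_pure_right linear_map_id mods
        pure_tensor_closed that)
  ultimately obtain g where g: "linear_map R ?D ?Q g"
    and gp: "\<And>a b c d. a \<in> carrier M \<Longrightarrow> b \<in> carrier N \<Longrightarrow> c \<in> carrier P \<Longrightarrow> d \<in> carrier P' \<Longrightarrow>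
      g (?p a b c d) = ?q a b c d"
    using tensor_lift4[of M N P P' ?Q ?q] mods by metis
  let ?P = "\<lambda>h. \<forall>a\<in>carrier M. \<forall>b\<in>carrier N. \<forall>c\<in>carrier P. \<forall>d\<in>carrier P'.
    h (?p a b c d) = ?q a b c d"
  have "tensor_switch R M N P P' \<in> lin R ?D ?Q \<and> ?P (tensor_switch R M N P P')"
    unfolding tensor_switch_def
  proof (rule lin_the[where P = ?P, OF _ g])
    fix k k' t assume k: "linear_map R ?D ?Q k" and k': "linear_map R ?D ?Q k'"
      and eq: "\<forall>a\<in>carrier M. \<forall>b\<in>carrier N. \<forall>c\<in>carrier P. \<forall>d\<in>carrier P'. k (?p a b c d) = ?q a b c d" "\<forall>a\<in>carrier M. \<forall>b\<in>carrier N. \<forall>c\<in>carrier P. \<forall>d\<in>carrier P'. k' (?p a b c d) = ?q a b c d"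
      and t: "t \<in> carrier ?D"
    show "k t = k' t" by (rule tensor_ext4[OF M N P P' k k' t]) (simp add: eq)
  qed (simp_all add: mods gp pure_tensor_closed)
  then show "linear_map R ?D ?Q (tensor_switch R M N P P')"
    "\<And>a b c d. a \<in> carrier M \<Longrightarrow> b \<in> carrier N \<Longrightarrow> c \<in> carrier P \<Longrightarrow> d \<in> carrier P' \<Longrightarrow>
      tensor_switch R M N P P' (?p a b c d) = ?q a b c d"
    by (simp_all add: lin_linear)
qed

lemma reg_mod_simps [simp]:
  "carrier (reg_mod R) = carrier R" "\<zero>\<^bsub>reg_mod R\<^esub> = \<zero>"
  "a \<oplus>\<^bsub>reg_mod R\<^esub> b = a \<oplus> b" "r \<odot>\<^bsub>reg_mod R\<^esub> a = r \<otimes> a"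
  by (simp_all add: reg_mod_def)

lemma
  assumes M: "module R M"
  shows tensor_lunit_linear: "linear_map R (tensor R (reg_mod R) M) M (tensor_lunit R M)"
    and tensor_lunit_pure: "\<And>r a. r \<in> carrier R \<Longrightarrow> a \<in> carrier M \<Longrightarrow>
      tensor_lunit R M (pure_tensor R (reg_mod R) M r a) = r \<odot>\<^bsub>M\<^esub> a"
proof -
  interpret M: module R M by (rule M)
  \<comment> \<open>Homogeneity in the second argument exchanges two scalars, which uses
    commutativity of R.\<close>
  have "bilinear_map R (reg_mod R) M M (\<lambda>r a. r \<odot>\<^bsub>M\<^esub> a)"
    unfolding bilinear_map_def
    by (auto intro!: linear_mapI simp: M.smult_l_distr M.smult_r_distr M.smult_assoc1[symmetric] m_comm)
  from tensor_the[OF module_reg_mod M M this]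
  show "linear_map R (tensor R (reg_mod R) M) M (tensor_lunit R M)"
    "\<And>r a. r \<in> carrier R \<Longrightarrow> a \<in> carrier M \<Longrightarrow>
      tensor_lunit R M (pure_tensor R (reg_mod R) M r a) = r \<odot>\<^bsub>M\<^esub> a"
    by (simp_all add: tensor_lunit_def lin_linear)
qed

lemma
  assumes M: "module R M"
  shows tensor_runit_linear: "linear_map R (tensor R M (reg_mod R)) M (tensor_runit R M)"
    and tensor_runit_pure: "\<And>r a. r \<in> carrier R \<Longrightarrow> a \<in> carrier M \<Longrightarrow>
      tensor_runit R M (pure_tensor R M (reg_mod R) a r) = r \<odot>\<^bsub>M\<^esub> a"
proof -
  interpret M: module R M by (rule M)
  have "bilinear_map R M (reg_mod R) M (\<lambda>a r. r \<odot>\<^bsub>M\<^esub> a)"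
    unfolding bilinear_map_def
    by (auto intro!: linear_mapI simp: M.smult_l_distr M.smult_r_distr M.smult_assoc1[symmetric] m_comm)
  \<comment> \<open>The definition quantifies over the scalar first; the description is restated in
    the order of the tensor factors so that \<open>tensor_the\<close> matches it.\<close>
  moreover have "tensor_runit R M = (THE h. h \<in> lin R (tensor R M (reg_mod R)) M \<and>
      (\<forall>a\<in>carrier M. \<forall>r\<in>carrier (reg_mod R). h (pure_tensor R M (reg_mod R) a r) = r \<odot>\<^bsub>M\<^esub> a))"
    unfolding tensor_runit_def reg_mod_simps by (rule arg_cong[where f = The]) blast
  ultimately show "linear_map R (tensor R M (reg_mod R)) M (tensor_runit R M)"
    "\<And>r a. r \<in> carrier R \<Longrightarrow> a \<in> carrier M \<Longrightarrow>
      tensor_runit R M (pure_tensor R M (reg_mod R) a r) = r \<odot>\<^bsub>M\<^esub> a"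
    using tensor_the[OF M module_reg_mod M] by (simp_all add: lin_linear)
qed

end

section \<open>Direct sums\<close>

lemma dsum_simps:
  "carrier (dsum X M) = {s \<in> \<Pi>\<^sub>E y\<in>X. carrier (M y). finite {y \<in> X. s y \<noteq> \<zero>\<^bsub>M y\<^esub>}}"
  "\<zero>\<^bsub>dsum X M\<^esub> = (\<lambda>y\<in>X. \<zero>\<^bsub>M y\<^esub>)"
  "s \<oplus>\<^bsub>dsum X M\<^esub> t = (\<lambda>y\<in>X. s y \<oplus>\<^bsub>M y\<^esub> t y)"
  "r \<odot>\<^bsub>dsum X M\<^esub> s = (\<lambda>y\<in>X. r \<odot>\<^bsub>M y\<^esub> s y)"
  by (simp_all add: dsum_def)

context cring
begin

context
  fixes X :: "'x set" and M :: "'x \<Rightarrow> ('a, 'c) module"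
  assumes M: "\<And>y. y \<in> X \<Longrightarrow> module R (M y)"
begin

text \<open>The entries are modules only at indices in X, so no single interpretation of the module
  locale is available; the laws are collected in conditional form instead.\<close>

private lemmas module_simps =
  abelian_groupE(1,2,5)[OF module.axioms(2)[OF M]] module.smult_closed[OF M]
  module.smult_l_null[OF M] module.smult_r_null[OF M] module.smult_one[OF M]
  abelian_group.l_neg[OF module.axioms(2)[OF M]]
  abelian_monoid.r_zero[OF abelian_group.axioms(1)[OF module.axioms(2)[OF M]]]

lemma dsum_closed: "s \<in> carrier (dsum X M) \<Longrightarrow> y \<in> X \<Longrightarrow> s y \<in> carrier (M y)"
  by (auto simp: dsum_simps)

lemma module_dsum: "module R (dsum X M)"
proof (rule moduleI)
  have add: "s \<oplus>\<^bsub>dsum X M\<^esub> t \<in> carrier (dsum X M)"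
    if st: "s \<in> carrier (dsum X M)" "t \<in> carrier (dsum X M)" for s t
  proof -
    have "{y \<in> X. s y \<oplus>\<^bsub>M y\<^esub> t y \<noteq> \<zero>\<^bsub>M y\<^esub>} \<subseteq>
        {y \<in> X. s y \<noteq> \<zero>\<^bsub>M y\<^esub>} \<union> {y \<in> X. t y \<noteq> \<zero>\<^bsub>M y\<^esub>}"
      by (auto simp: module_simps)
    moreover have "finite ({y \<in> X. s y \<noteq> \<zero>\<^bsub>M y\<^esub>} \<union> {y \<in> X. t y \<noteq> \<zero>\<^bsub>M y\<^esub>})"
      using st by (simp add: dsum_simps)
    ultimately have "finite {y \<in> X. s y \<oplus>\<^bsub>M y\<^esub> t y \<noteq> \<zero>\<^bsub>M y\<^esub>}" by (rule finite_subset)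
    moreover have "{y \<in> X. (\<lambda>y\<in>X. s y \<oplus>\<^bsub>M y\<^esub> t y) y \<noteq> \<zero>\<^bsub>M y\<^esub>} = {y \<in> X. s y \<oplus>\<^bsub>M y\<^esub> t y \<noteq> \<zero>\<^bsub>M y\<^esub>}"
      by auto
    ultimately show ?thesis
      using dsum_closed[OF st(1)] dsum_closed[OF st(2)]
      by (simp add: dsum_simps module_simps PiE_iff)
  qed
  have smult: "r \<odot>\<^bsub>dsum X M\<^esub> s \<in> carrier (dsum X M)"
    if r: "r \<in> carrier R" and s: "s \<in> carrier (dsum X M)" for r s
  proof -
    have "{y \<in> X. (\<lambda>y\<in>X. r \<odot>\<^bsub>M y\<^esub> s y) y \<noteq> \<zero>\<^bsub>M y\<^esub>} \<subseteq> {y \<in> X. s y \<noteq> \<zero>\<^bsub>M y\<^esub>}"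
      using r by (auto simp: module_simps)
    moreover have "finite {y \<in> X. s y \<noteq> \<zero>\<^bsub>M y\<^esub>}" using s by (simp add: dsum_simps)
    ultimately have "finite {y \<in> X. (\<lambda>y\<in>X. r \<odot>\<^bsub>M y\<^esub> s y) y \<noteq> \<zero>\<^bsub>M y\<^esub>}" by (rule finite_subset)
    then show ?thesis
      using dsum_closed[OF s] r by (simp add: dsum_simps module_simps PiE_iff)
  qed
  have eqI: "(\<lambda>y\<in>X. h y) = s"
    if "s \<in> carrier (dsum X M)" "\<And>y. y \<in> X \<Longrightarrow> h y = s y" for s h
    using that by (intro extensionalityI[where A = X]) (auto simp: dsum_simps PiE_iff)
  have zero: "\<zero>\<^bsub>dsum X M\<^esub> \<in> carrier (dsum X M)"
    by (simp add: dsum_simps PiE_iff module_simps)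
  show "abelian_group (dsum X M)"
  proof (rule abelian_groupI)
    fix s assume s: "s \<in> carrier (dsum X M)"
    have "\<ominus> \<one> \<odot>\<^bsub>dsum X M\<^esub> s \<in> carrier (dsum X M)" by (rule smult[OF _ s]) simp
    moreover have "(\<ominus> \<one> \<odot>\<^bsub>dsum X M\<^esub> s) \<oplus>\<^bsub>dsum X M\<^esub> s = \<zero>\<^bsub>dsum X M\<^esub>"
      using dsum_closed[OF s]
      by (auto simp: dsum_simps module.smult_l_minus[OF M] module_simps intro!: restrict_ext)
    ultimately show "\<exists>t\<in>carrier (dsum X M). t \<oplus>\<^bsub>dsum X M\<^esub> s = \<zero>\<^bsub>dsum X M\<^esub>" by blast
  next
    fix s t u assume "s \<in> carrier (dsum X M)" "t \<in> carrier (dsum X M)" "u \<in> carrier (dsum X M)"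
    note cl = this[THEN dsum_closed]
    show "s \<oplus>\<^bsub>dsum X M\<^esub> t \<oplus>\<^bsub>dsum X M\<^esub> u = s \<oplus>\<^bsub>dsum X M\<^esub> (t \<oplus>\<^bsub>dsum X M\<^esub> u)"
      unfolding dsum_simps by (rule restrict_ext) (simp add: cl module_simps abelian_groupE(3)[OF module.axioms(2)[OF M]])
  next
    fix s t assume "s \<in> carrier (dsum X M)" "t \<in> carrier (dsum X M)"
    note cl = this[THEN dsum_closed]
    show "s \<oplus>\<^bsub>dsum X M\<^esub> t = t \<oplus>\<^bsub>dsum X M\<^esub> s"
      unfolding dsum_simps by (rule restrict_ext) (rule abelian_groupE(4)[OF module.axioms(2)[OF M] cl])
  next
    fix s assume s: "s \<in> carrier (dsum X M)"
    show "\<zero>\<^bsub>dsum X M\<^esub> \<oplus>\<^bsub>dsum X M\<^esub> s = s"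
      unfolding dsum_simps(2,3) by (rule eqI[OF s]) (simp add: module_simps dsum_closed[OF s])
  qed (fact add zero)+
  show "\<And>r s. r \<in> carrier R \<Longrightarrow> s \<in> carrier (dsum X M) \<Longrightarrow> r \<odot>\<^bsub>dsum X M\<^esub> s \<in> carrier (dsum X M)"
    by (rule smult)
next
  fix r q s assume "r \<in> carrier R" "q \<in> carrier R" and s: "s \<in> carrier (dsum X M)"
  then show "(r \<oplus> q) \<odot>\<^bsub>dsum X M\<^esub> s = r \<odot>\<^bsub>dsum X M\<^esub> s \<oplus>\<^bsub>dsum X M\<^esub> q \<odot>\<^bsub>dsum X M\<^esub> s"
    and "r \<otimes> q \<odot>\<^bsub>dsum X M\<^esub> s = r \<odot>\<^bsub>dsum X M\<^esub> (q \<odot>\<^bsub>dsum X M\<^esub> s)"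
    unfolding dsum_simps(3,4)
    by (auto intro!: restrict_ext
        simp: module.smult_l_distr[OF M] module.smult_assoc1[OF M] dsum_closed[OF s])
next
  fix r s t assume "r \<in> carrier R" and s: "s \<in> carrier (dsum X M)" and t: "t \<in> carrier (dsum X M)"
  then show "r \<odot>\<^bsub>dsum X M\<^esub> (s \<oplus>\<^bsub>dsum X M\<^esub> t) = r \<odot>\<^bsub>dsum X M\<^esub> s \<oplus>\<^bsub>dsum X M\<^esub> r \<odot>\<^bsub>dsum X M\<^esub> t"
    unfolding dsum_simps(3,4)
    by (auto intro!: restrict_ext
        simp: module.smult_r_distr[OF M] dsum_closed[OF s] dsum_closed[OF t])
next
  fix s assume s: "s \<in> carrier (dsum X M)"
  show "\<one> \<odot>\<^bsub>dsum X M\<^esub> s = s"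
    unfolding dsum_simps(4)
    using s dsum_closed[OF s]
    by (intro extensionalityI[where A = X]) (auto simp: dsum_simps PiE_iff module_simps)
qed (rule is_cring)

lemma dsum_in_linear:
  assumes y: "y \<in> X"
  shows "linear_map R (M y) (dsum X M) (dsum_in X M y)"
proof (rule linear_mapI)
  fix a assume a: "a \<in> carrier (M y)"
  have "{z \<in> X. dsum_in X M y a z \<noteq> \<zero>\<^bsub>M z\<^esub>} \<subseteq> {y}" by (auto simp: dsum_in_def)
  then have "finite {z \<in> X. dsum_in X M y a z \<noteq> \<zero>\<^bsub>M z\<^esub>}" by (rule finite_subset) simp
  then show "dsum_in X M y a \<in> carrier (dsum X M)"
    using a by (auto simp: dsum_simps dsum_in_def module_simps)
qed (auto simp: dsum_in_def dsum_simps module_simps intro!: restrict_ext)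

text \<open>Same peeling as for free modules: a coordinate at an index in X is split off as the
  image of an inclusion, until the zero vector remains. There both maps vanish because they are
  linear.\<close>

lemma dsum_ext:
  assumes h: "linear_map R (dsum X M) P h" and h': "linear_map R (dsum X M) P h'"
    and P: "module R P"
    and eq: "\<And>y a. y \<in> X \<Longrightarrow> a \<in> carrier (M y) \<Longrightarrow> h (dsum_in X M y a) = h' (dsum_in X M y a)"
    and s: "s \<in> carrier (dsum X M)"
  shows "h s = h' s"
proof -
  have "h s = h' s" if "finite T" "{y \<in> X. s y \<noteq> \<zero>\<^bsub>M y\<^esub>} \<subseteq> T" "s \<in> carrier (dsum X M)" for T s
    using that
  proof (induction T arbitrary: s rule: finite_induct)
    case empty
    then have "s = \<zero>\<^bsub>dsum X M\<^esub>"
      by (intro extensionalityI[where A = X]) (auto simp: dsum_simps PiE_iff)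
    then show ?case
      using linear_map_zero[OF module_dsum P h] linear_map_zero[OF module_dsum P h'] by simp
  next
    case (insert t T)
    show ?case
    proof (cases "t \<in> X")
      case False
      then show ?thesis using insert.prems by (intro insert.IH) auto
    next
      case True
      let ?s = "s(t := \<zero>\<^bsub>M t\<^esub>)"
      have "{y \<in> X. ?s y \<noteq> \<zero>\<^bsub>M y\<^esub>} \<subseteq> {y \<in> X. s y \<noteq> \<zero>\<^bsub>M y\<^esub>}" by auto
      moreover have "finite {y \<in> X. s y \<noteq> \<zero>\<^bsub>M y\<^esub>}" using insert.prems by (simp add: dsum_simps)
      ultimately have "finite {y \<in> X. ?s y \<noteq> \<zero>\<^bsub>M y\<^esub>}" by (rule finite_subset)
      then have s': "?s \<in> carrier (dsum X M)"
        using insert.prems True by (auto simp: dsum_simps PiE_iff module_simps extensional_def)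
      have "{y \<in> X. ?s y \<noteq> \<zero>\<^bsub>M y\<^esub>} \<subseteq> T" using insert.prems by auto
      then have IH: "h ?s = h' ?s" using s' by (rule insert.IH)
      have st: "s t \<in> carrier (M t)" using dsum_closed[OF insert.prems(2) True] .
      note cl = dsum_closed[OF insert.prems(2)]
      have "s = ?s \<oplus>\<^bsub>dsum X M\<^esub> dsum_in X M t (s t)"
        using insert.prems True cl
        by (intro extensionalityI[where A = X])
          (auto simp: dsum_simps PiE_iff dsum_in_def module_simps)
      moreover have "h (?s \<oplus>\<^bsub>dsum X M\<^esub> dsum_in X M t (s t)) = h' (?s \<oplus>\<^bsub>dsum X M\<^esub> dsum_in X M t (s t))"
        using linear_map_closed[OF dsum_in_linear[OF True] st] s'
        by (simp only: linear_map_add[OF h] linear_map_add[OF h'] IH eq[OF True st])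
      ultimately show ?thesis by simp
    qed
  qed
  then show ?thesis using s by (auto simp: dsum_simps)
qed

lemma dsum_lift:
  assumes P: "module R P" and g: "\<And>y. y \<in> X \<Longrightarrow> linear_map R (M y) P (g y)"
  shows "\<exists>h. linear_map R (dsum X M) P h \<and>
    (\<forall>y\<in>X. \<forall>a\<in>carrier (M y). h (dsum_in X M y a) = g y a)"
proof -
  interpret P: module R P by (rule P)
  let ?c = "\<lambda>y s. g y (s y)"
  let ?h = "\<lambda>s. \<Oplus>\<^bsub>P\<^esub>y\<in>{y \<in> X. ?c y s \<noteq> \<zero>\<^bsub>P\<^esub>}. ?c y s"
  \<comment> \<open>Ensures that a vanishing coordinate contributes nothing, so that finite support
    of s bounds the set of nonzero contributions.\<close>
  have g0: "g y \<zero>\<^bsub>M y\<^esub> = \<zero>\<^bsub>P\<^esub>" if "y \<in> X" for y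
    by (rule linear_map_zero[OF M[OF that] P g[OF that]])
  have "linear_map R (dsum X M) P ?h"
  proof (rule linear_map_finsum_support[OF module_dsum P])
    fix y assume y: "y \<in> X"
    show "linear_map R (dsum X M) P (?c y)"
      by (rule linear_mapI)
        (simp_all add: y dsum_simps(3,4) linear_map_closed[OF g] linear_map_add[OF g]
          linear_map_smult[OF g] dsum_closed)
  next
    fix s assume s: "s \<in> carrier (dsum X M)"
    have "{y \<in> X. ?c y s \<noteq> \<zero>\<^bsub>P\<^esub>} \<subseteq> {y \<in> X. s y \<noteq> \<zero>\<^bsub>M y\<^esub>}" using g0 by auto
    then show "finite {y \<in> X. ?c y s \<noteq> \<zero>\<^bsub>P\<^esub>}"
      by (rule finite_subset) (use s in \<open>simp add: dsum_simps\<close>)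
  qed
  moreover have "?h (dsum_in X M t a) = g t a" if t: "t \<in> X" and a: "a \<in> carrier (M t)" for t a
  proof -
    have "?h (dsum_in X M t a) = (\<Oplus>\<^bsub>P\<^esub>y\<in>{t}. ?c y (dsum_in X M t a))"
      using t a g0 linear_map_closed[OF g]
      by (intro P.add.finprod_mono_neutral_cong_left) (auto simp: dsum_in_def)
    also have "\<dots> = g t a" using t a linear_map_closed[OF g] by (simp add: dsum_in_def)
    finally show ?thesis .
  qed
  ultimately show ?thesis by blast
qed

text \<open>The descriptions prescribe values on generators of different shapes, abstracted here as
  Q. What is required is that, for linear maps, Q is equivalent to having the components
  \<open>g y\<close> on whole summands.\<close>

lemma dsum_the:
  assumes P: "module R P" and g: "\<And>y. y \<in> X \<Longrightarrow> linear_map R (M y) P (g y)"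
    and ex: "\<And>h. linear_map R (dsum X M) P h \<Longrightarrow>
      (\<And>y a. y \<in> X \<Longrightarrow> a \<in> carrier (M y) \<Longrightarrow> h (dsum_in X M y a) = g y a) \<Longrightarrow> Q h"
    and uniq: "\<And>h y a. linear_map R (dsum X M) P h \<Longrightarrow> Q h \<Longrightarrow> y \<in> X \<Longrightarrow> a \<in> carrier (M y) \<Longrightarrow>
      h (dsum_in X M y a) = g y a"
    and f: "f = (THE h. h \<in> lin R (dsum X M) P \<and> Q h)"
  shows "f \<in> lin R (dsum X M) P"
    and "\<And>y a. y \<in> X \<Longrightarrow> a \<in> carrier (M y) \<Longrightarrow> f (dsum_in X M y a) = g y a"
proof -
  obtain h where h: "linear_map R (dsum X M) P h"
    and hg: "\<And>y a. y \<in> X \<Longrightarrow> a \<in> carrier (M y) \<Longrightarrow> h (dsum_in X M y a) = g y a"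
    using dsum_lift[OF P g] by blast
  have "f \<in> lin R (dsum X M) P \<and> Q f"
    unfolding f
  proof (rule lin_the[where P = Q, OF module_dsum h])
    show "Q (restrict h (carrier (dsum X M)))"
      using linear_map_restrict[OF module_dsum] h hg linear_map_closed[OF dsum_in_linear]
      by (intro ex) auto
    fix k k' s assume k: "linear_map R (dsum X M) P k" "Q k"
      and k': "linear_map R (dsum X M) P k'" "Q k'" and s: "s \<in> carrier (dsum X M)"
    show "k s = k' s"
      by (rule dsum_ext[OF k(1) k'(1) P _ s]) (simp add: uniq[OF k] uniq[OF k'])
  qed
  then show "f \<in> lin R (dsum X M) P" and
    "\<And>y a. y \<in> X \<Longrightarrow> a \<in> carrier (M y) \<Longrightarrow> f (dsum_in X M y a) = g y a"
    using uniq by (auto dest: lin_linear)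
qed

text \<open>Distributivity of the tensor product over direct sums, in the form of a lifting
  property. Each component is curried into the hom module of N and Q, the curried components are
  glued over the direct sum, and the result is uncurried.\<close>

lemma tensor_dsum_lift:
  assumes N: "module R N" and Q: "module R Q"
    and g: "\<And>y. y \<in> X \<Longrightarrow> linear_map R (tensor R (M y) N) Q (g y)"
  shows "\<exists>h. linear_map R (tensor R (dsum X M) N) Q h \<and>
    (\<forall>y\<in>X. \<forall>a\<in>carrier (M y). \<forall>b\<in>carrier N.
      h (pure_tensor R (dsum X M) N (dsum_in X M y a) b) = g y (pure_tensor R (M y) N a b))"
proof -
  have "linear_map R (M y) (hom_mod R N Q) (\<lambda>a. \<lambda>b\<in>carrier N. g y (pure_tensor R (M y) N a b))"
    if y: "y \<in> X" for y
    by (rule bilinear_map_curry[OF N Q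
          linear_bilinear_map_comp[OF pure_tensor_bilinear[OF M[OF y] N] g[OF y]]])
  from dsum_lift[OF module_hom_mod[OF N Q] this]
  obtain k where k: "linear_map R (dsum X M) (hom_mod R N Q) k"
    and kg: "\<And>y a. y \<in> X \<Longrightarrow> a \<in> carrier (M y) \<Longrightarrow>
      k (dsum_in X M y a) = (\<lambda>b\<in>carrier N. g y (pure_tensor R (M y) N a b))"
    by auto
  obtain h where "linear_map R (tensor R (dsum X M) N) Q h"
    "\<forall>s\<in>carrier (dsum X M). \<forall>b\<in>carrier N. h (pure_tensor R (dsum X M) N s b) = k s b"
    using tensor_lift[OF module_dsum N Q bilinear_map_uncurry[OF k]] by blast
  then show ?thesis
    using linear_map_closed[OF dsum_in_linear] by (intro exI[of _ h]) (simp add: kg)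
qed

end

end

section \<open>The matrix product and the duoidal structure maps\<close>

definition module_family where
  "module_family R X M \<longleftrightarrow> (\<forall>x\<in>X. \<forall>y\<in>X. module R (M x y))"

lemma module_familyD: "module_family R X M \<Longrightarrow> x \<in> X \<Longrightarrow> y \<in> X \<Longrightarrow> module R (M x y)"
  by (simp add: module_family_def)

text \<open>Counterpart of \<open>odo_gen\<close> for arbitrary elements of a summand. The category
  axioms quantify over all elements of tensor products, so the comparison takes place at this level
  and not on pure tensors.\<close>

abbreviation odo_in where
  "odo_in R X M N x z y \<equiv> dsum_in X (\<lambda>y. tensor R (M x y) (N y z)) y"

lemma odo_unit_simps [simp]:
  "odo_unit R x x = reg_mod R"
  "x \<noteq> y \<Longrightarrow> carrier (odo_unit R x y) = {\<zero>\<^bsub>R\<^esub>}"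
  "\<zero>\<^bsub>odo_unit R x y\<^esub> = \<zero>\<^bsub>R\<^esub>"
  by (simp_all add: odo_unit_def reg_mod_def)

lemma bul_unit_simp [simp]: "bul_unit R x y = reg_mod R"
  by (simp add: bul_unit_def)

context cring
begin

lemma module_odo_unit: "module R (odo_unit R x y)"
  by (simp add: odo_unit_def module_reg_mod module_zero_mod)

lemma module_family_unit: "module_family R X (odo_unit R)" "module_family R X (bul_unit R)"
  by (simp_all add: module_family_def module_odo_unit module_reg_mod)

lemma module_family_bul: "module_family R X M \<Longrightarrow> module_family R X N \<Longrightarrow> module_family R X (bul R M N)"
  by (simp add: module_family_def bul_def module_tensor)

section \<open>Linear maps out of an entry of a matrix product\<close>

context
  fixes X :: "'x set" and M :: "'x \<Rightarrow> 'x \<Rightarrow> ('a, 'c) module" and N :: "'x \<Rightarrow> 'x \<Rightarrow> ('a, 'd) module"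
    and x z :: 'x
  assumes M: "module_family R X M" and N: "module_family R X N" and x: "x \<in> X" and z: "z \<in> X"
begin

lemma module_odo_summand: "y \<in> X \<Longrightarrow> module R (tensor R (M x y) (N y z))"
  by (intro module_tensor module_familyD[OF M x] module_familyD[OF N _ z])

lemma module_odo: "module R (odo R X M N x z)"
  unfolding odo_def by (rule module_dsum[OF module_odo_summand])

lemma odo_in_linear:
  "y \<in> X \<Longrightarrow> linear_map R (tensor R (M x y) (N y z)) (odo R X M N x z) (odo_in R X M N x z y)"
  unfolding odo_def by (rule dsum_in_linear[OF module_odo_summand])

lemma odo_ext:
  assumes "linear_map R (odo R X M N x z) P h" "linear_map R (odo R X M N x z) P h'" "module R P"
    and "\<And>y u. y \<in> X \<Longrightarrow> u \<in> carrier (tensor R (M x y) (N y z)) \<Longrightarrow>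
      h (odo_in R X M N x z y u) = h' (odo_in R X M N x z y u)"
    and "s \<in> carrier (odo R X M N x z)"
  shows "h s = h' s"
  by (rule dsum_ext[OF module_odo_summand assms(1-3)[unfolded odo_def] assms(4)
        assms(5)[unfolded odo_def]])

lemma odo_lift:
  assumes "module R P" "\<And>y. y \<in> X \<Longrightarrow> linear_map R (tensor R (M x y) (N y z)) P (g y)"
  shows "\<exists>h. linear_map R (odo R X M N x z) P h \<and>
    (\<forall>y\<in>X. \<forall>u\<in>carrier (tensor R (M x y) (N y z)). h (odo_in R X M N x z y u) = g y u)"
  unfolding odo_def by (rule dsum_lift[OF module_odo_summand assms])

lemma odo_the:
  assumes P: "module R P"
    and g: "\<And>y. y \<in> X \<Longrightarrow> linear_map R (tensor R (M x y) (N y z)) P (g y)"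
    and ex: "\<And>h. linear_map R (odo R X M N x z) P h \<Longrightarrow>
      (\<And>y u. y \<in> X \<Longrightarrow> u \<in> carrier (tensor R (M x y) (N y z)) \<Longrightarrow>
        h (odo_in R X M N x z y u) = g y u) \<Longrightarrow> Q h"
    and uniq: "\<And>h y u. linear_map R (odo R X M N x z) P h \<Longrightarrow> Q h \<Longrightarrow> y \<in> X \<Longrightarrow>
      u \<in> carrier (tensor R (M x y) (N y z)) \<Longrightarrow> h (odo_in R X M N x z y u) = g y u"
    and f: "f = (THE h. h \<in> lin R (odo R X M N x z) P \<and> Q h)"
  shows "linear_map R (odo R X M N x z) P f"
    and "\<And>y u. y \<in> X \<Longrightarrow> u \<in> carrier (tensor R (M x y) (N y z)) \<Longrightarrow>
      f (odo_in R X M N x z y u) = g y u"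
proof -
  note ex' = ex[unfolded odo_def] and uniq' = uniq[unfolded odo_def]
  note the = dsum_the[where X = X and M = "\<lambda>y. tensor R (M x y) (N y z)" and Q = Q and g = g,
      OF module_odo_summand P g _ _ f[unfolded odo_def]]
  have "f \<in> lin R (dsum X (\<lambda>y. tensor R (M x y) (N y z))) P"
    by (rule the(1)) (assumption | fact ex' uniq')+
  then show "linear_map R (odo R X M N x z) P f"
    unfolding odo_def by (rule lin_linear)
  show "f (odo_in R X M N x z y u) = g y u"
    if "y \<in> X" "u \<in> carrier (tensor R (M x y) (N y z))" for y u
    by (rule the(2)) (assumption | fact ex' uniq' that)+
qed

text \<open>Passes from prescribed values k on generators to components g on whole summands. The two
  prescriptions agree because g has the values k on pure tensors, which determine a linear map on
  each summand.\<close>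

lemma odo_gen_the:
  assumes P: "module R P"
    and g: "\<And>y. y \<in> X \<Longrightarrow> linear_map R (tensor R (M x y) (N y z)) P (g y)"
    and gg: "\<And>y a b. y \<in> X \<Longrightarrow> a \<in> carrier (M x y) \<Longrightarrow> b \<in> carrier (N y z) \<Longrightarrow>
      g y (pure_tensor R (M x y) (N y z) a b) = k y a b"
    and f: "f = (THE h. h \<in> lin R (odo R X M N x z) P \<and>
      (\<forall>y\<in>X. \<forall>a\<in>carrier (M x y). \<forall>b\<in>carrier (N y z). h (odo_gen R X M N x z y a b) = k y a b))"
  shows "linear_map R (odo R X M N x z) P f"
    and "\<And>y u. y \<in> X \<Longrightarrow> u \<in> carrier (tensor R (M x y) (N y z)) \<Longrightarrow>
      f (odo_in R X M N x z y u) = g y u"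
proof -
  note mods = module_familyD[OF M x] module_familyD[OF N _ z]
  let ?Q = "\<lambda>h. \<forall>y\<in>X. \<forall>a\<in>carrier (M x y). \<forall>b\<in>carrier (N y z). h (odo_gen R X M N x z y a b) = k y a b"
  have ex: "?Q h" if "linear_map R (odo R X M N x z) P h"
      "\<And>y u. y \<in> X \<Longrightarrow> u \<in> carrier (tensor R (M x y) (N y z)) \<Longrightarrow>
        h (odo_in R X M N x z y u) = g y u" for h
    unfolding odo_gen_def by (simp add: that(2) gg pure_tensor_closed mods)
  have uniq: "h (odo_in R X M N x z y u) = g y u"
    if h: "linear_map R (odo R X M N x z) P h" and Q: "?Q h" and y: "y \<in> X"
      and u: "u \<in> carrier (tensor R (M x y) (N y z))" for h y u
    by (rule tensor_ext[OF mods(1)[OF y] mods(2)[OF y] linear_map_comp[OF odo_in_linear[OF y] h] g[OF y] u])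
      (use Q y in \<open>simp add: gg odo_gen_def\<close>)
  show "linear_map R (odo R X M N x z) P f" by (rule odo_the(1)[where Q = ?Q and g = g, OF P g _ _ f]) (assumption | fact ex uniq)+
  show "f (odo_in R X M N x z y u) = g y u"
    if "y \<in> X" "u \<in> carrier (tensor R (M x y) (N y z))" for y u
    by (rule odo_the(2)[where Q = ?Q and g = g, OF P g _ _ f]) (assumption | fact ex uniq that)+
qed

end

lemma module_family_odo: "module_family R X M \<Longrightarrow> module_family R X N \<Longrightarrow> module_family R X (odo R X M N)"
  by (simp add: module_family_def module_odo)

section \<open>Functoriality of the matrix product\<close>

context
  fixes X :: "'x set" and M :: "'x \<Rightarrow> 'x \<Rightarrow> ('a, 'c) module" and N :: "'x \<Rightarrow> 'x \<Rightarrow> ('a, 'd) module"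
    and M' :: "'x \<Rightarrow> 'x \<Rightarrow> ('a, 'e) module" and N' :: "'x \<Rightarrow> 'x \<Rightarrow> ('a, 'f) module"
    and x z :: 'x and f g
  assumes fam: "module_family R X M" "module_family R X N" "module_family R X M'" "module_family R X N'"
    and xz: "x \<in> X" "z \<in> X"
    and f: "\<And>y. y \<in> X \<Longrightarrow> linear_map R (M x y) (M' x y) (f x y)"
    and g: "\<And>y. y \<in> X \<Longrightarrow> linear_map R (N y z) (N' y z) (g y z)"
begin

lemma odo_map_linear: "linear_map R (odo R X M N x z) (odo R X M' N' x z) (odo_map R X M N M' N' f g x z)"
  and odo_map_in: "\<And>y u. y \<in> X \<Longrightarrow> u \<in> carrier (tensor R (M x y) (N y z)) \<Longrightarrow>
    odo_map R X M N M' N' f g x z (odo_in R X M N x z y u) =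
    odo_in R X M' N' x z y (tensor_map R (M x y) (N y z) (M' x y) (N' y z) (f x y) (g y z) u)"
proof -
  let ?g = "\<lambda>y u. odo_in R X M' N' x z y (tensor_map R (M x y) (N y z) (M' x y) (N' y z) (f x y) (g y z) u)"
  note mods = fam[THEN module_familyD]
  have 1: "linear_map R (tensor R (M x y) (N y z)) (odo R X M' N' x z) (?g y)" if y: "y \<in> X" for y
    by (rule linear_map_comp[OF tensor_map_linear odo_in_linear[OF fam(3,4) xz y]])
      (intro mods xz y f g)+
  have 2: "?g y (pure_tensor R (M x y) (N y z) a b) = odo_gen R X M' N' x z y (f x y a) (g y z b)"
    if "y \<in> X" "a \<in> carrier (M x y)" "b \<in> carrier (N y z)" for y a b
    using that by (simp add: odo_gen_def tensor_map_pure mods xz f g)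
  have 3: "odo_map R X M N M' N' f g x z = (THE h. h \<in> lin R (odo R X M N x z) (odo R X M' N' x z) \<and>
     (\<forall>y\<in>X. \<forall>a\<in>carrier (M x y). \<forall>b\<in>carrier (N y z).
        h (odo_gen R X M N x z y a b) = odo_gen R X M' N' x z y (f x y a) (g y z b)))"
    by (simp add: odo_map_def)
  note the = odo_gen_the[where g = ?g, OF fam(1,2) xz module_odo[OF fam(3,4) xz] 1 2 3]
  show "linear_map R (odo R X M N x z) (odo R X M' N' x z) (odo_map R X M N M' N' f g x z)"
    by (rule the(1))
  show "odo_map R X M N M' N' f g x z (odo_in R X M N x z y u) = ?g y u"
    if "y \<in> X" "u \<in> carrier (tensor R (M x y) (N y z))" for y u
    by (rule the(2)) (assumption | fact that)+
qed

end

context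
  fixes X :: "'x set" and x z :: 'x
  assumes xz: "x \<in> X" "z \<in> X"
begin

text \<open>The multiplication r \<otimes> s \<mapsto> r s of the base ring is its own left unit
  constraint. Writing the component as \<open>tensor_lunit\<close> gives it the shape in which it
  occurs in \<open>tensor_counit\<close>.\<close>

lemma varpi_linear: "linear_map R (odo R X (bul_unit R) (bul_unit R) x z) (reg_mod R) (varpi R X x z)"
  and varpi_in: "\<And>y u. y \<in> X \<Longrightarrow> u \<in> carrier (tensor R (reg_mod R) (reg_mod R)) \<Longrightarrow>
    varpi R X x z (odo_in R X (bul_unit R) (bul_unit R) x z y u) = tensor_lunit R (reg_mod R) u"
proof -
  have "varpi R X x z = (THE h. h \<in> lin R (odo R X (bul_unit R) (bul_unit R) x z) (reg_mod R) \<and>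
     (\<forall>y\<in>X. \<forall>a\<in>carrier (bul_unit R x y). \<forall>b\<in>carrier (bul_unit R y z).
        h (odo_gen R X (bul_unit R) (bul_unit R) x z y a b) = a \<otimes> b))"
    by (simp add: varpi_def)
  note the = odo_gen_the[where g = "\<lambda>y. tensor_lunit R (reg_mod R)",
      OF module_family_unit(2,2) xz module_reg_mod _ _ this]
  show "linear_map R (odo R X (bul_unit R) (bul_unit R) x z) (reg_mod R) (varpi R X x z)"
    by (rule the(1)) (simp_all add: module_reg_mod tensor_lunit_linear tensor_lunit_pure)
  show "varpi R X x z (odo_in R X (bul_unit R) (bul_unit R) x z y u) = tensor_lunit R (reg_mod R) u"
    if "y \<in> X" "u \<in> carrier (tensor R (reg_mod R) (reg_mod R))" for y u
    by (rule the(2)) (simp_all add: module_reg_mod tensor_lunit_linear tensor_lunit_pure that)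
qed

section \<open>Unit constraints of the matrix product\<close>

context
  fixes M :: "'x \<Rightarrow> 'x \<Rightarrow> ('a, 'c) module"
  assumes M: "module_family R X M"
begin

text \<open>For y \<noteq> x the first factor of the summand at y is zero, hence so is the summand,
  and all linear maps agree on it. Testing at the summand of index x therefore suffices.\<close>

lemma odo_unit_left_ext:
  assumes h: "linear_map R (odo R X (odo_unit R) M x z) P h"
    and h': "linear_map R (odo R X (odo_unit R) M x z) P h'" and P: "module R P"
    and eq: "\<And>u. u \<in> carrier (tensor R (reg_mod R) (M x z)) \<Longrightarrow>
      h (odo_in R X (odo_unit R) M x z x u) = h' (odo_in R X (odo_unit R) M x z x u)"
    and s: "s \<in> carrier (odo R X (odo_unit R) M x z)"
  shows "h s = h' s"
proof (rule odo_ext[OF module_family_unit(1) M xz h h' P _ s])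
  note odo = module_odo[OF module_family_unit(1) M xz]
  fix y u assume y: "y \<in> X" and u: "u \<in> carrier (tensor R (odo_unit R x y) (M y z))"
  show "h (odo_in R X (odo_unit R) M x z y u) = h' (odo_in R X (odo_unit R) M x z y u)"
  proof (cases "y = x")
    case True
    then show ?thesis using eq u by simp
  next
    case False
    have Myz: "module R (M y z)" by (rule module_familyD[OF M y xz(2)])
    have "u = \<zero>\<^bsub>tensor R (odo_unit R x y) (M y z)\<^esub>"
      using False by (intro tensor_zero[OF module_odo_unit Myz _ u]) simp
    then have "odo_in R X (odo_unit R) M x z y u = \<zero>\<^bsub>odo R X (odo_unit R) M x z\<^esub>"
      using linear_map_zero[OF module_tensor[OF module_odo_unit Myz] odo
          odo_in_linear[OF module_family_unit(1) M xz y]] by simp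
    then show ?thesis
      using linear_map_zero[OF odo P h] linear_map_zero[OF odo P h'] by simp
  qed
qed

lemma odo_unit_right_ext:
  assumes h: "linear_map R (odo R X M (odo_unit R) x z) P h"
    and h': "linear_map R (odo R X M (odo_unit R) x z) P h'" and P: "module R P"
    and eq: "\<And>u. u \<in> carrier (tensor R (M x z) (reg_mod R)) \<Longrightarrow>
      h (odo_in R X M (odo_unit R) x z z u) = h' (odo_in R X M (odo_unit R) x z z u)"
    and s: "s \<in> carrier (odo R X M (odo_unit R) x z)"
  shows "h s = h' s"
proof (rule odo_ext[OF M module_family_unit(1) xz h h' P _ s])
  note odo = module_odo[OF M module_family_unit(1) xz]
  fix y u assume y: "y \<in> X" and u: "u \<in> carrier (tensor R (M x y) (odo_unit R y z))"
  show "h (odo_in R X M (odo_unit R) x z y u) = h' (odo_in R X M (odo_unit R) x z y u)"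
  proof (cases "y = z")
    case True
    then show ?thesis using eq u by simp
  next
    case False
    have Mxy: "module R (M x y)" by (rule module_familyD[OF M xz(1) y])
    have "u = \<zero>\<^bsub>tensor R (M x y) (odo_unit R y z)\<^esub>"
      using False by (intro tensor_zero[OF Mxy module_odo_unit _ u]) simp
    then have "odo_in R X M (odo_unit R) x z y u = \<zero>\<^bsub>odo R X M (odo_unit R) x z\<^esub>"
      using linear_map_zero[OF module_tensor[OF Mxy module_odo_unit] odo
          odo_in_linear[OF M module_family_unit(1) xz y]] by simp
    then show ?thesis
      using linear_map_zero[OF odo P h] linear_map_zero[OF odo P h'] by simp
  qed
qed

lemma odo_lunit_linear: "linear_map R (odo R X (odo_unit R) M x z) (M x z) (odo_lunit R X M x z)"
  and odo_lunit_in: "\<And>u. u \<in> carrier (tensor R (reg_mod R) (M x z)) \<Longrightarrow>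
    odo_lunit R X M x z (odo_in R X (odo_unit R) M x z x u) = tensor_lunit R (M x z) u"
proof -
  note odo = module_odo[OF module_family_unit(1) M xz]
  have Mxz: "module R (M x z)" by (rule module_familyD[OF M xz])
  note in_lin = odo_in_linear[OF module_family_unit(1) M xz xz(1), unfolded odo_unit_simps(1)]
  let ?D = "odo R X (odo_unit R) M x z"
  \<comment> \<open>The description constrains the map only on the summand at x. The other summands
    are trivial, so zero maps complete the family from which a witness is glued.\<close>
  let ?g = "\<lambda>y. if y = x then tensor_lunit R (M x z) else (\<lambda>u. \<zero>\<^bsub>M x z\<^esub>)"
  let ?Q = "\<lambda>h. \<forall>r\<in>carrier R. \<forall>a\<in>carrier (M x z).
    h (odo_gen R X (odo_unit R) M x z x r a) = r \<odot>\<^bsub>M x z\<^esub> a"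
  have g: "linear_map R (tensor R (odo_unit R x y) (M y z)) (M x z) (?g y)" for y
    using tensor_lunit_linear[OF Mxz] by (simp add: linear_map_const_zero[OF Mxz])
  from odo_lift[where g = ?g, OF module_family_unit(1) M xz Mxz g]
  obtain k where k: "linear_map R ?D (M x z) k"
    and kg: "\<forall>y\<in>X. \<forall>u\<in>carrier (tensor R (odo_unit R x y) (M y z)).
      k (odo_in R X (odo_unit R) M x z y u) = ?g y u"
    by (elim exE conjE)
  have kx: "k (odo_in R X (odo_unit R) M x z x u) = tensor_lunit R (M x z) u"
    if "u \<in> carrier (tensor R (reg_mod R) (M x z))" for u
    using bspec[OF bspec[OF kg xz(1)], of u] that by simp
  have uniq: "h (odo_in R X (odo_unit R) M x z x u) = tensor_lunit R (M x z) u"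
    if h: "linear_map R ?D (M x z) h" and Q: "?Q h"
      and u: "u \<in> carrier (tensor R (reg_mod R) (M x z))" for h u
    by (rule tensor_ext[OF module_reg_mod Mxz linear_map_comp[OF in_lin h] tensor_lunit_linear[OF Mxz] u])
      (use Q in \<open>simp add: odo_gen_def tensor_lunit_pure[OF Mxz]\<close>)
  have "odo_lunit R X M x z \<in> lin R ?D (M x z) \<and> ?Q (odo_lunit R X M x z)"
    unfolding odo_lunit_def
  proof (rule lin_the[where P = ?Q, OF odo k])
    have "odo_in R X (odo_unit R) M x z x (pure_tensor R (reg_mod R) (M x z) r a) \<in> carrier ?D"
      if "r \<in> carrier R" "a \<in> carrier (M x z)" for r a
      using that by (intro linear_map_closed[OF in_lin] pure_tensor_closed[OF module_reg_mod Mxz]) simp_all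
    then show "?Q (restrict k (carrier ?D))"
      by (simp add: odo_gen_def kx pure_tensor_closed[OF module_reg_mod Mxz] tensor_lunit_pure[OF Mxz])
    fix h h' s assume h: "linear_map R ?D (M x z) h" and h': "linear_map R ?D (M x z) h'"
      and Q: "?Q h" "?Q h'" and s: "s \<in> carrier ?D"
    show "h s = h' s"
      by (rule odo_unit_left_ext[OF h h' Mxz _ s]) (simp add: uniq[OF h Q(1)] uniq[OF h' Q(2)])
  qed
  then show "linear_map R ?D (M x z) (odo_lunit R X M x z)"
    "\<And>u. u \<in> carrier (tensor R (reg_mod R) (M x z)) \<Longrightarrow>
      odo_lunit R X M x z (odo_in R X (odo_unit R) M x z x u) = tensor_lunit R (M x z) u"
    using uniq by (auto dest: lin_linear)
qed

lemma odo_runit_linear: "linear_map R (odo R X M (odo_unit R) x z) (M x z) (odo_runit R X M x z)"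
  and odo_runit_in: "\<And>u. u \<in> carrier (tensor R (M x z) (reg_mod R)) \<Longrightarrow>
    odo_runit R X M x z (odo_in R X M (odo_unit R) x z z u) = tensor_runit R (M x z) u"
proof -
  note odo = module_odo[OF M module_family_unit(1) xz]
  have Mxz: "module R (M x z)" by (rule module_familyD[OF M xz])
  note in_lin = odo_in_linear[OF M module_family_unit(1) xz xz(2), unfolded odo_unit_simps(1)]
  let ?D = "odo R X M (odo_unit R) x z"
  let ?g = "\<lambda>y. if y = z then tensor_runit R (M x z) else (\<lambda>u. \<zero>\<^bsub>M x z\<^esub>)"
  let ?Q = "\<lambda>h. \<forall>r\<in>carrier R. \<forall>a\<in>carrier (M x z).
    h (odo_gen R X M (odo_unit R) x z z a r) = r \<odot>\<^bsub>M x z\<^esub> a"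
  have g: "linear_map R (tensor R (M x y) (odo_unit R y z)) (M x z) (?g y)" for y
    using tensor_runit_linear[OF Mxz] by (simp add: linear_map_const_zero[OF Mxz])
  from odo_lift[where g = ?g, OF M module_family_unit(1) xz Mxz g]
  obtain k where k: "linear_map R ?D (M x z) k"
    and kg: "\<forall>y\<in>X. \<forall>u\<in>carrier (tensor R (M x y) (odo_unit R y z)).
      k (odo_in R X M (odo_unit R) x z y u) = ?g y u"
    by (elim exE conjE)
  have kz: "k (odo_in R X M (odo_unit R) x z z u) = tensor_runit R (M x z) u"
    if "u \<in> carrier (tensor R (M x z) (reg_mod R))" for u
    using bspec[OF bspec[OF kg xz(2)], of u] that by simp
  have uniq: "h (odo_in R X M (odo_unit R) x z z u) = tensor_runit R (M x z) u"
    if h: "linear_map R ?D (M x z) h" and Q: "?Q h"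
      and u: "u \<in> carrier (tensor R (M x z) (reg_mod R))" for h u
    by (rule tensor_ext[OF Mxz module_reg_mod linear_map_comp[OF in_lin h] tensor_runit_linear[OF Mxz] u])
      (use Q in \<open>simp add: odo_gen_def tensor_runit_pure[OF Mxz]\<close>)
  have "odo_runit R X M x z \<in> lin R ?D (M x z) \<and> ?Q (odo_runit R X M x z)"
    unfolding odo_runit_def
  proof (rule lin_the[where P = ?Q, OF odo k])
    have "odo_in R X M (odo_unit R) x z z (pure_tensor R (M x z) (reg_mod R) a r) \<in> carrier ?D"
      if "r \<in> carrier R" "a \<in> carrier (M x z)" for r a
      using that by (intro linear_map_closed[OF in_lin] pure_tensor_closed[OF Mxz module_reg_mod]) simp_all
    then show "?Q (restrict k (carrier ?D))"
      by (simp add: odo_gen_def kz pure_tensor_closed[OF Mxz module_reg_mod] tensor_runit_pure[OF Mxz])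
    fix h h' s assume h: "linear_map R ?D (M x z) h" and h': "linear_map R ?D (M x z) h'"
      and Q: "?Q h" "?Q h'" and s: "s \<in> carrier ?D"
    show "h s = h' s"
      by (rule odo_unit_right_ext[OF h h' Mxz _ s]) (simp add: uniq[OF h Q(1)] uniq[OF h' Q(2)])
  qed
  then show "linear_map R ?D (M x z) (odo_runit R X M x z)"
    "\<And>u. u \<in> carrier (tensor R (M x z) (reg_mod R)) \<Longrightarrow>
      odo_runit R X M x z (odo_in R X M (odo_unit R) x z z u) = tensor_runit R (M x z) u"
    using uniq by (auto dest: lin_linear)
qed

end

section \<open>Associativity of the matrix product\<close>

context
  fixes M :: "'x \<Rightarrow> 'x \<Rightarrow> ('a, 'c) module" and N :: "'x \<Rightarrow> 'x \<Rightarrow> ('a, 'd) module"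
    and P :: "'x \<Rightarrow> 'x \<Rightarrow> ('a, 'e) module"
  assumes M: "module_family R X M" and N: "module_family R X N" and P: "module_family R X P"
begin

text \<open>After fixing the outer index v and the factor c, the remaining argument runs through an
  inner direct sum, where extensionality applies again. The test elements are images of whole triple
  tensor products, which is the form in which associativity of composition is stated.\<close>

lemma odo_odo_ext:
  assumes h: "linear_map R (odo R X (odo R X M N) P x z) Q h"
    and h': "linear_map R (odo R X (odo R X M N) P x z) Q h'" and Q: "module R Q"
    and eq: "\<And>v y u. v \<in> X \<Longrightarrow> y \<in> X \<Longrightarrow>
      u \<in> carrier (tensor R (tensor R (M x y) (N y v)) (P v z)) \<Longrightarrow>
      h (odo_in R X (odo R X M N) P x z v
        (tensor_map R (tensor R (M x y) (N y v)) (P v z) (odo R X M N x v) (P v z)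
          (odo_in R X M N x v y) (\<lambda>c. c) u)) =
      h' (odo_in R X (odo R X M N) P x z v
        (tensor_map R (tensor R (M x y) (N y v)) (P v z) (odo R X M N x v) (P v z)
          (odo_in R X M N x v y) (\<lambda>c. c) u))"
    and s: "s \<in> carrier (odo R X (odo R X M N) P x z)"
  shows "h s = h' s"
proof (rule odo_ext[OF module_family_odo[OF M N] P xz h h' Q _ s])
  fix v w assume v: "v \<in> X" and w: "w \<in> carrier (tensor R (odo R X M N x v) (P v z))"
  have mods: "module R (odo R X M N x v)" "module R (P v z)"
    using module_odo[OF M N] module_familyD[OF P] xz v by blast+
  note in_lin = odo_in_linear[OF module_family_odo[OF M N] P xz v]
  show "h (odo_in R X (odo R X M N) P x z v w) = h' (odo_in R X (odo R X M N) P x z v w)"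
  proof (rule tensor_ext[OF mods linear_map_comp[OF in_lin h] linear_map_comp[OF in_lin h'] w])
    fix t c assume t: "t \<in> carrier (odo R X M N x v)" and c: "c \<in> carrier (P v z)"
    note lin = linear_map_comp[OF linear_map_pure_left[OF mods linear_map_id c] in_lin]
    show "h (odo_in R X (odo R X M N) P x z v (pure_tensor R (odo R X M N x v) (P v z) t c)) =
      h' (odo_in R X (odo R X M N) P x z v (pure_tensor R (odo R X M N x v) (P v z) t c))"
    proof (rule odo_ext[OF M N xz(1) v linear_map_comp[OF lin h] linear_map_comp[OF lin h'] Q _ t])
      fix y u assume y: "y \<in> X" and u: "u \<in> carrier (tensor R (M x y) (N y v))"
      note T = module_odo_summand[OF M N xz(1) v y]
      \<comment> \<open>A pure tensor with an included first factor is the image of a pure tensor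
        under inclusion \<otimes> identity, hence one of the test elements.\<close>
      have "pure_tensor R (odo R X M N x v) (P v z) (odo_in R X M N x v y u) c =
        tensor_map R (tensor R (M x y) (N y v)) (P v z) (odo R X M N x v) (P v z)
          (odo_in R X M N x v y) (\<lambda>c. c) (pure_tensor R (tensor R (M x y) (N y v)) (P v z) u c)"
        using tensor_map_pure[OF T mods(2) mods odo_in_linear[OF M N xz(1) v y] linear_map_id u c] ..
      then show "h (odo_in R X (odo R X M N) P x z v
          (pure_tensor R (odo R X M N x v) (P v z) (odo_in R X M N x v y u) c)) =
        h' (odo_in R X (odo R X M N) P x z v
          (pure_tensor R (odo R X M N x v) (P v z) (odo_in R X M N x v y u) c))"
        using eq[OF v y pure_tensor_closed[OF T mods(2) u c]] by simp
    qed
  qed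
qed

text \<open>Existence takes two gluings: over the inner index y inside a tensor product, by
  \<open>tensor_dsum_lift\<close>, and then over the outer index v. Uniqueness is reduced to pure
  triples on each pair of indices.\<close>

lemma odo_assoc_linear:
    "linear_map R (odo R X (odo R X M N) P x z) (odo R X M (odo R X N P) x z) (odo_assoc R X M N P x z)"
  and odo_assoc_in: "\<And>v y u. v \<in> X \<Longrightarrow> y \<in> X \<Longrightarrow>
    u \<in> carrier (tensor R (tensor R (M x y) (N y v)) (P v z)) \<Longrightarrow>
    odo_assoc R X M N P x z (odo_in R X (odo R X M N) P x z v
      (tensor_map R (tensor R (M x y) (N y v)) (P v z) (odo R X M N x v) (P v z)
        (odo_in R X M N x v y) (\<lambda>c. c) u)) =
    odo_in R X M (odo R X N P) x z y
      (tensor_map R (M x y) (tensor R (N y v) (P v z)) (M x y) (odo R X N P y z)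
        (\<lambda>a. a) (odo_in R X N P y z v) (tensor_assoc R (M x y) (N y v) (P v z) u))"
proof -
  let ?D = "odo R X (odo R X M N) P x z" and ?E = "odo R X M (odo R X N P) x z"
  \<comment> \<open>Component for the path x, y, v, z. The index v is outer and y inner in the
    source, whereas in the target y is outer and v inner.\<close>
  let ?G = "\<lambda>v y u. odo_in R X M (odo R X N P) x z y
      (tensor_map R (M x y) (tensor R (N y v) (P v z)) (M x y) (odo R X N P y z)
        (\<lambda>a. a) (odo_in R X N P y z v) (tensor_assoc R (M x y) (N y v) (P v z) u))"
  let ?Q = "\<lambda>h. \<forall>y\<in>X. \<forall>v\<in>X. \<forall>a\<in>carrier (M x y). \<forall>b\<in>carrier (N y v). \<forall>c\<in>carrier (P v z).
        h (odo_gen R X (odo R X M N) P x z v (odo_gen R X M N x v y a b) c) =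
        odo_gen R X M (odo R X N P) x z y a (odo_gen R X N P y z v b c)"
  note MN = module_family_odo[OF M N] and NP = module_family_odo[OF N P]
  have E: "module R ?E" by (rule module_odo[OF M NP xz])
  note mods = module_familyD[OF M] module_familyD[OF N] module_familyD[OF P] module_tensor
    module_familyD[OF MN] module_familyD[OF NP] xz
  have G: "linear_map R (tensor R (tensor R (M x y) (N y v)) (P v z)) ?E (?G v y)"
    if "v \<in> X" "y \<in> X" for v y
  proof -
    have "linear_map R (tensor R (M x y) (tensor R (N y v) (P v z))) (tensor R (M x y) (odo R X N P y z))
       (tensor_map R (M x y) (tensor R (N y v) (P v z)) (M x y) (odo R X N P y z)
        (\<lambda>a. a) (odo_in R X N P y z v))"
      using that by (intro tensor_map_linear mods linear_map_id odo_in_linear N P)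
    from linear_map_comp[OF linear_map_comp[OF tensor_assoc_linear this] odo_in_linear[OF M NP xz \<open>y \<in> X\<close>]]
    show ?thesis using that mods by blast
  qed
  have G_pure: "?G v y (pure_tensor R (tensor R (M x y) (N y v)) (P v z) (pure_tensor R (M x y) (N y v) a b) c) =
      odo_gen R X M (odo R X N P) x z y a (odo_gen R X N P y z v b c)"
    if "v \<in> X" "y \<in> X" "a \<in> carrier (M x y)" "b \<in> carrier (N y v)" "c \<in> carrier (P v z)" for v y a b c
    using that by (simp add: odo_gen_def tensor_assoc_pure tensor_map_pure pure_tensor_closed mods
        linear_map_id odo_in_linear[OF N P])
  \<comment> \<open>For a fixed outer index the inner direct sum is the left factor of a tensor
    product, so distributivity is what produces the map.\<close>
  have "\<forall>v\<in>X. \<exists>k. linear_map R (tensor R (odo R X M N x v) (P v z)) ?E k \<and>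
      (\<forall>y\<in>X. \<forall>u\<in>carrier (tensor R (M x y) (N y v)). \<forall>c\<in>carrier (P v z).
        k (pure_tensor R (odo R X M N x v) (P v z) (odo_in R X M N x v y u) c) =
        ?G v y (pure_tensor R (tensor R (M x y) (N y v)) (P v z) u c))" (is "\<forall>v\<in>X. ?ex v")
  proof
    fix v assume v: "v \<in> X"
    have "odo R X M N x v = dsum X (\<lambda>y. tensor R (M x y) (N y v))" by (simp add: odo_def)
    then show "?ex v"
      using tensor_dsum_lift[OF module_odo_summand[OF M N xz(1) v] mods(3)[OF v xz(2)] E G[OF v]]
      by simp
  qed
  from bchoice[OF this]
  obtain k where k_all: "\<forall>v\<in>X. linear_map R (tensor R (odo R X M N x v) (P v z)) ?E (k v) \<and>
      (\<forall>y\<in>X. \<forall>u\<in>carrier (tensor R (M x y) (N y v)). \<forall>c\<in>carrier (P v z).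
        k v (pure_tensor R (odo R X M N x v) (P v z) (odo_in R X M N x v y u) c) =
        ?G v y (pure_tensor R (tensor R (M x y) (N y v)) (P v z) u c))" ..
  have k: "linear_map R (tensor R (odo R X M N x v) (P v z)) ?E (k v)" if "v \<in> X" for v
    using k_all that by simp
  have kG: "k v (pure_tensor R (odo R X M N x v) (P v z) (odo_in R X M N x v y u) c) =
      ?G v y (pure_tensor R (tensor R (M x y) (N y v)) (P v z) u c)"
    if "v \<in> X" "y \<in> X" "u \<in> carrier (tensor R (M x y) (N y v))" "c \<in> carrier (P v z)" for v y u c
    using k_all that by simp
  \<comment> \<open>Identifies the generators used in the definition of the associator with test
    elements of \<open>odo_odo_ext\<close>.\<close>
  have gen: "odo_gen R X (odo R X M N) P x z v (odo_gen R X M N x v y a b) c =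
    odo_in R X (odo R X M N) P x z v (tensor_map R (tensor R (M x y) (N y v)) (P v z) (odo R X M N x v) (P v z)
        (odo_in R X M N x v y) (\<lambda>c. c)
        (pure_tensor R (tensor R (M x y) (N y v)) (P v z) (pure_tensor R (M x y) (N y v) a b) c))"
    if "v \<in> X" "y \<in> X" "a \<in> carrier (M x y)" "b \<in> carrier (N y v)" "c \<in> carrier (P v z)" for v y a b c
    using that by (simp add: odo_gen_def tensor_map_pure pure_tensor_closed mods linear_map_id
        odo_in_linear[OF M N])
  have "\<exists>f. linear_map R ?D ?E f \<and> (\<forall>v\<in>X. \<forall>w\<in>carrier (tensor R (odo R X M N x v) (P v z)).
      f (odo_in R X (odo R X M N) P x z v w) = k v w)"
    by (rule odo_lift[OF MN P xz E k])
  then obtain f where f: "linear_map R ?D ?E f"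
    and fk: "\<forall>v\<in>X. \<forall>w\<in>carrier (tensor R (odo R X M N x v) (P v z)).
      f (odo_in R X (odo R X M N) P x z v w) = k v w"
    by (elim exE conjE)
  have fQ: "?Q f"
    by (simp add: odo_gen_def fk kG pure_tensor_closed mods linear_map_closed[OF odo_in_linear[OF M N xz(1)]]
        G_pure[unfolded odo_gen_def])
  have gen_closed: "odo_gen R X (odo R X M N) P x z v (odo_gen R X M N x v y a b) c \<in> carrier ?D"
    if "v \<in> X" "y \<in> X" "a \<in> carrier (M x y)" "b \<in> carrier (N y v)" "c \<in> carrier (P v z)" for v y a b c
    unfolding odo_gen_def
    using that by (intro linear_map_closed[OF odo_in_linear[OF MN P xz]] pure_tensor_closed mods
        linear_map_closed[OF odo_in_linear[OF M N xz(1)]])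
  have uniq: "h (odo_in R X (odo R X M N) P x z v
      (tensor_map R (tensor R (M x y) (N y v)) (P v z) (odo R X M N x v) (P v z)
        (odo_in R X M N x v y) (\<lambda>c. c) u)) = ?G v y u"
    if h: "linear_map R ?D ?E h" and Q: "?Q h" and v: "v \<in> X" and y: "y \<in> X"
      and u: "u \<in> carrier (tensor R (tensor R (M x y) (N y v)) (P v z))" for h v y u
  proof -
    have "linear_map R (tensor R (tensor R (M x y) (N y v)) (P v z)) (tensor R (odo R X M N x v) (P v z))
       (tensor_map R (tensor R (M x y) (N y v)) (P v z) (odo R X M N x v) (P v z) (odo_in R X M N x v y) (\<lambda>c. c))"
      by (intro tensor_map_linear mods linear_map_id odo_in_linear M N v y)
    note lin = linear_map_comp[OF linear_map_comp[OF this odo_in_linear[OF MN P xz v]] h]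
    have "module R (M x y)" "module R (N y v)" "module R (P v z)"
      using mods v y by blast+
    \<comment> \<open>Both sides are linear on the triple tensor product, and on pure triples the
      property assumed of h prescribes the value.\<close>
    from tensor_ext3[OF this lin G[OF v y] u]
    show ?thesis by (simp add: gen[OF v y, symmetric] G_pure[OF v y] Q v y)
  qed
  have "odo_assoc R X M N P x z \<in> lin R ?D ?E \<and> ?Q (odo_assoc R X M N P x z)"
    unfolding odo_assoc_def
  proof (rule lin_the[where P = ?Q, OF module_odo[OF MN P xz] f])
    show "?Q (restrict f (carrier ?D))" using fQ by (simp add: gen_closed)
    fix h h' s assume h: "linear_map R ?D ?E h" and h': "linear_map R ?D ?E h'"
      and Q: "?Q h" "?Q h'" and s: "s \<in> carrier ?D"
    show "h s = h' s"
      by (rule odo_odo_ext[OF h h' E _ s]) (simp only: uniq[OF h Q(1)] uniq[OF h' Q(2)])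
  qed
  then have lin: "linear_map R ?D ?E (odo_assoc R X M N P x z)" and Q: "?Q (odo_assoc R X M N P x z)"
    by (simp_all add: lin_linear)
  show "linear_map R ?D ?E (odo_assoc R X M N P x z)" by (rule lin)
  show "\<And>v y u. v \<in> X \<Longrightarrow> y \<in> X \<Longrightarrow>
    u \<in> carrier (tensor R (tensor R (M x y) (N y v)) (P v z)) \<Longrightarrow>
    odo_assoc R X M N P x z (odo_in R X (odo R X M N) P x z v
      (tensor_map R (tensor R (M x y) (N y v)) (P v z) (odo R X M N x v) (P v z)
        (odo_in R X M N x v y) (\<lambda>c. c) u)) = ?G v y u"
    by (rule uniq[OF lin Q])
qed

end

section \<open>The interchange map\<close>

context
  fixes M :: "'x \<Rightarrow> 'x \<Rightarrow> ('a, 'c) module" and N :: "'x \<Rightarrow> 'x \<Rightarrow> ('a, 'd) module"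
    and P :: "'x \<Rightarrow> 'x \<Rightarrow> ('a, 'e) module" and Q :: "'x \<Rightarrow> 'x \<Rightarrow> ('a, 'f) module"
  assumes fam: "module_family R X M" "module_family R X N" "module_family R X P" "module_family R X Q"
begin

text \<open>The description prescribes values only where both factors of a summand are themselves
  pure tensors, so \<open>odo_gen_the\<close> does not match. The components are determined by
  extensionality in four factors and passed to \<open>odo_the\<close>. The target also contains
  mixed terms with two different middle indices, but the image uses the same index y twice.\<close>

lemma zeta_linear: "linear_map R (odo R X (bul R M N) (bul R P Q) x z)
      (bul R (odo R X M P) (odo R X N Q) x z) (zeta R X M N P Q x z)"
  and zeta_in: "\<And>y u. y \<in> X \<Longrightarrow>
    u \<in> carrier (tensor R (tensor R (M x y) (N x y)) (tensor R (P y z) (Q y z))) \<Longrightarrow>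
    zeta R X M N P Q x z (odo_in R X (bul R M N) (bul R P Q) x z y u) =
    tensor_map R (tensor R (M x y) (P y z)) (tensor R (N x y) (Q y z)) (odo R X M P x z) (odo R X N Q x z)
      (odo_in R X M P x z y) (odo_in R X N Q x z y) (tensor_switch R (M x y) (N x y) (P y z) (Q y z) u)"
proof -
  let ?D = "odo R X (bul R M N) (bul R P Q) x z" and ?E = "bul R (odo R X M P) (odo R X N Q) x z"
  let ?g = "\<lambda>y u. tensor_map R (tensor R (M x y) (P y z)) (tensor R (N x y) (Q y z)) (odo R X M P x z) (odo R X N Q x z)
      (odo_in R X M P x z y) (odo_in R X N Q x z y) (tensor_switch R (M x y) (N x y) (P y z) (Q y z) u)"
  let ?Q = "\<lambda>h. \<forall>y\<in>X. \<forall>m\<in>carrier (M x y). \<forall>n\<in>carrier (N x y). \<forall>p\<in>carrier (P y z). \<forall>q\<in>carrier (Q y z).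
        h (odo_gen R X (bul R M N) (bul R P Q) x z y
             (pure_tensor R (M x y) (N x y) m n) (pure_tensor R (P y z) (Q y z) p q)) =
        pure_tensor R (odo R X M P x z) (odo R X N Q x z)
          (odo_gen R X M P x z y m p) (odo_gen R X N Q x z y n q)"
  note MN = module_family_bul[OF fam(1,2)] and PQ = module_family_bul[OF fam(3,4)]
  note mods = fam[THEN module_familyD] module_tensor module_odo[OF fam(1,3) xz] module_odo[OF fam(2,4) xz] xz
  have E: "module R ?E" unfolding bul_def by (intro mods)
  have g: "linear_map R (tensor R (bul R M N x y) (bul R P Q y z)) ?E (?g y)" if y: "y \<in> X" for y
  proof -
    have "linear_map R (tensor R (tensor R (M x y) (P y z)) (tensor R (N x y) (Q y z))) ?E
      (tensor_map R (tensor R (M x y) (P y z)) (tensor R (N x y) (Q y z)) (odo R X M P x z) (odo R X N Q x z)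
        (odo_in R X M P x z y) (odo_in R X N Q x z y))"
      unfolding bul_def by (intro tensor_map_linear mods y odo_in_linear fam)
    from linear_map_comp[OF tensor_switch_linear this]
    show ?thesis unfolding bul_def using mods y by blast
  qed
  have g_pure: "?g y (pure_tensor R (tensor R (M x y) (N x y)) (tensor R (P y z) (Q y z))
        (pure_tensor R (M x y) (N x y) m n) (pure_tensor R (P y z) (Q y z) p q)) =
      pure_tensor R (odo R X M P x z) (odo R X N Q x z) (odo_gen R X M P x z y m p) (odo_gen R X N Q x z y n q)"
    if "y \<in> X" "m \<in> carrier (M x y)" "n \<in> carrier (N x y)" "p \<in> carrier (P y z)" "q \<in> carrier (Q y z)"
    for y m n p q
    using that by (simp add: odo_gen_def tensor_switch_pure tensor_map_pure pure_tensor_closed mods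
        odo_in_linear fam)
  have ex: "?Q h" if "linear_map R ?D ?E h"
      "\<And>y u. y \<in> X \<Longrightarrow> u \<in> carrier (tensor R (bul R M N x y) (bul R P Q y z)) \<Longrightarrow>
        h (odo_in R X (bul R M N) (bul R P Q) x z y u) = ?g y u" for h
    \<comment> \<open>Only the outer generator is unfolded; those in the target keep the form in
      which \<open>g_pure\<close> mentions them.\<close>
    using that(2) unfolding odo_gen_def[of R X "bul R M N"] unfolding bul_def
    by (simp add: g_pure pure_tensor_closed mods)
  have uniq: "h (odo_in R X (bul R M N) (bul R P Q) x z y u) = ?g y u"
    if h: "linear_map R ?D ?E h" and Q: "?Q h" and y: "y \<in> X"
      and u: "u \<in> carrier (tensor R (bul R M N x y) (bul R P Q y z))" for h y u
  proof -
    have m: "module R (M x y)" "module R (N x y)" "module R (P y z)" "module R (Q y z)"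
      using mods y by blast+
    have bul_eq: "bul R M N x y = tensor R (M x y) (N x y)" "bul R P Q y z = tensor R (P y z) (Q y z)"
      by (simp_all add: bul_def)
    show ?thesis
      by (rule tensor_ext4[OF m linear_map_comp[OF odo_in_linear[OF MN PQ xz y] h, unfolded bul_eq]
            g[OF y, unfolded bul_eq] u[unfolded bul_eq]])
        (use Q[rule_format, OF y] in \<open>simp add: g_pure y odo_gen_def[of R X "bul R M N"] bul_eq\<close>)
  qed
  have zeta: "zeta R X M N P Q x z = (THE h. h \<in> lin R ?D ?E \<and> ?Q h)"
    by (simp add: zeta_def)
  show "linear_map R ?D ?E (zeta R X M N P Q x z)"
    by (rule odo_the(1)[where Q = ?Q and g = ?g, OF MN PQ xz E g _ _ zeta]) (assumption | fact ex uniq)+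
  show "zeta R X M N P Q x z (odo_in R X (bul R M N) (bul R P Q) x z y u) = ?g y u"
    if y: "y \<in> X" and u: "u \<in> carrier (tensor R (tensor R (M x y) (N x y)) (tensor R (P y z) (Q y z)))"
    for y u
  proof -
    have u': "u \<in> carrier (tensor R (bul R M N x y) (bul R P Q y z))" using u by (simp add: bul_def)
    show ?thesis
      by (rule odo_the(2)[where Q = ?Q and g = ?g, OF MN PQ xz E g _ _ zeta])
        (assumption | fact ex uniq y u')+
  qed
qed

end

end

end

section \<open>The correspondence\<close>

context cring
begin

section \<open>Comparison of the axioms, one at a time\<close>

context
  fixes X :: "'x set" and A :: "'x \<Rightarrow> 'x \<Rightarrow> ('a, 'c) module" and \<mu> \<eta> \<Delta> \<epsilon> m
  assumes A: "module_family R X A"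
    and mu: "\<And>x z. x \<in> X \<Longrightarrow> z \<in> X \<Longrightarrow> linear_map R (odo R X A A x z) (A x z) (\<mu> x z)"
    and eta: "\<And>x z. x \<in> X \<Longrightarrow> z \<in> X \<Longrightarrow> linear_map R (odo_unit R x z) (A x z) (\<eta> x z)"
    and Delta: "\<And>x z. x \<in> X \<Longrightarrow> z \<in> X \<Longrightarrow>
      linear_map R (A x z) (tensor R (A x z) (A x z)) (\<Delta> x z)"
    and eps: "\<And>x z. x \<in> X \<Longrightarrow> z \<in> X \<Longrightarrow> linear_map R (A x z) (reg_mod R) (\<epsilon> x z)"
    and m: "\<And>x y z u. x \<in> X \<Longrightarrow> y \<in> X \<Longrightarrow> z \<in> X \<Longrightarrow> u \<in> carrier (tensor R (A x y) (A y z)) \<Longrightarrow>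
      m x y z u = \<mu> x z (odo_in R X A A x z y u)"
begin

private lemmas AA = module_family_odo[OF A A]

private lemmas mods = module_familyD[OF A] module_tensor module_reg_mod module_odo[OF A A]

text \<open>\<open>m\<close> is tied to \<mu> only through its values on carriers, so its linearity
  is transported from the composite with the inclusion by \<open>linear_map_cong\<close>.\<close>

lemma mult_linear:
  assumes "x \<in> X" "y \<in> X" "z \<in> X"
  shows "linear_map R (tensor R (A x y) (A y z)) (A x z) (m x y z)"
proof -
  have "linear_map R (tensor R (A x y) (A y z)) (A x z) (\<lambda>u. \<mu> x z (odo_in R X A A x z y u))"
    by (rule linear_map_comp[OF odo_in_linear[OF A A] mu]) (fact assms)+
  moreover have "linear_map R (tensor R (A x y) (A y z)) (A x z) (m x y z) \<longleftrightarrow>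
      linear_map R (tensor R (A x y) (A y z)) (A x z) (\<lambda>u. \<mu> x z (odo_in R X A A x z y u))"
    by (rule linear_map_cong) (simp_all add: mods m assms)
  ultimately show ?thesis by simp
qed

text \<open>Both composites are linear on the triple matrix product, so \<open>odo_odo_ext\<close>
  allows testing on one family of elements for each path x, y, z, t. There they become the two sides
  of the associativity law of \<open>m\<close>, in interchanged order.\<close>

lemma odo_assoc_iff:
  "mor_eq X (odo R X (odo R X A A) A)
     (\<mu> \<circ>\<^sub>X odo_map R X (odo R X A A) A A A \<mu> mor_id)
     (\<mu> \<circ>\<^sub>X odo_map R X A (odo R X A A) A A mor_id \<mu> \<circ>\<^sub>X odo_assoc R X A A A) \<longleftrightarrow>
   (\<forall>x\<in>X. \<forall>y\<in>X. \<forall>z\<in>X. \<forall>t\<in>X.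
     \<forall>u\<in>carrier (tensor R (tensor R (A x y) (A y z)) (A z t)).
       m x y t (tensor_map R (A x y) (tensor R (A y z) (A z t)) (A x y) (A y t)
         (\<lambda>a. a) (m y z t) (tensor_assoc R (A x y) (A y z) (A z t) u)) =
       m x z t (tensor_map R (tensor R (A x y) (A y z)) (A z t) (A x z) (A z t)
         (m x y z) (\<lambda>a. a) u))"
  (is "?l \<longleftrightarrow> ?r")
proof -
  let ?L = "\<lambda>x t. odo_map R X (odo R X A A) A A A \<mu> mor_id x t"
  let ?R = "\<lambda>x t. odo_map R X A (odo R X A A) A A mor_id \<mu> x t"
  let ?gen = "\<lambda>x y z t u. odo_in R X (odo R X A A) A x t z
    (tensor_map R (tensor R (A x y) (A y z)) (A z t) (odo R X A A x z) (A z t)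
      (odo_in R X A A x z y) (\<lambda>c. c) u)"
  have L: "linear_map R (odo R X (odo R X A A) A x t) (A x t) (\<lambda>s. \<mu> x t (?L x t s))"
    if "x \<in> X" "t \<in> X" for x t
    by (rule linear_map_comp[OF odo_map_linear[OF AA A A A] mu])
      (simp_all add: that mu mor_id_def linear_map_id)
  have R: "linear_map R (odo R X (odo R X A A) A x t) (A x t)
      (\<lambda>s. \<mu> x t (?R x t (odo_assoc R X A A A x t s)))" if "x \<in> X" "t \<in> X" for x t
    by (rule linear_map_comp[OF linear_map_comp[OF odo_assoc_linear[OF _ _ A A A]
            odo_map_linear[OF A AA A A]] mu])
      (simp_all add: that mu mor_id_def linear_map_id)
  have L_in: "\<mu> x t (?L x t (?gen x y z t u)) =
      m x z t (tensor_map R (tensor R (A x y) (A y z)) (A z t) (A x z) (A z t) (m x y z) (\<lambda>a. a) u)"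
    if X: "x \<in> X" "y \<in> X" "z \<in> X" "t \<in> X"
      and u: "u \<in> carrier (tensor R (tensor R (A x y) (A y z)) (A z t))" for x y z t u
  proof -
    let ?i = "tensor_map R (tensor R (A x y) (A y z)) (A z t) (odo R X A A x z) (A z t)
      (odo_in R X A A x z y) (\<lambda>c. c)"
    let ?m = "tensor_map R (tensor R (A x y) (A y z)) (A z t) (A x z) (A z t) (m x y z) (\<lambda>a. a)"
    have i: "linear_map R (tensor R (tensor R (A x y) (A y z)) (A z t))
        (tensor R (odo R X A A x z) (A z t)) ?i"
      by (intro tensor_map_linear mods X odo_in_linear[OF A A] linear_map_id)
    have iu: "?i u \<in> carrier (tensor R (odo R X A A x z) (A z t))"
      by (rule linear_map_closed[OF i u])
    have 1: "?L x t (?gen x y z t u) = odo_in R X A A x t z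
        (tensor_map R (odo R X A A x z) (A z t) (A x z) (A z t) (\<mu> x z) (mor_id z t) (?i u))"
      by (rule odo_map_in[OF AA A A A X(1,4) _ _ X(3) iu])
        (simp_all add: mu X mor_id_def linear_map_id)
    \<comment> \<open>Functoriality of the tensor product contracts the inclusion and \<mu> to one
      map, which the next step exchanges for \<open>m\<close>.\<close>
    have 2: "tensor_map R (odo R X A A x z) (A z t) (A x z) (A z t) (\<mu> x z) (mor_id z t) (?i u) =
        tensor_map R (tensor R (A x y) (A y z)) (A z t) (A x z) (A z t)
          (\<lambda>a. \<mu> x z (odo_in R X A A x z y a)) (\<lambda>b. b) u"
      unfolding mor_id_def
      by (rule tensor_map_comp) (simp_all add: mods X odo_in_linear[OF A A] linear_map_id mu u)
    have 3: "\<dots> = ?m u"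
      by (rule fun_cong[OF tensor_map_cong]) (simp_all add: m X)
    have "?m u \<in> carrier (tensor R (A x z) (A z t))"
      by (intro linear_map_closed[OF tensor_map_linear] mods X mult_linear linear_map_id u)
    then show ?thesis unfolding 1 2 3 by (simp only: m[OF X(1,3,4)])
  qed
  have R_in: "\<mu> x t (?R x t (odo_assoc R X A A A x t (?gen x y z t u))) =
      m x y t (tensor_map R (A x y) (tensor R (A y z) (A z t)) (A x y) (A y t)
         (\<lambda>a. a) (m y z t) (tensor_assoc R (A x y) (A y z) (A z t) u))"
    if X: "x \<in> X" "y \<in> X" "z \<in> X" "t \<in> X"
      and u: "u \<in> carrier (tensor R (tensor R (A x y) (A y z)) (A z t))" for x y z t u
  proof -
    let ?i = "tensor_map R (A x y) (tensor R (A y z) (A z t)) (A x y) (odo R X A A y t)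
      (\<lambda>a. a) (odo_in R X A A y t z)"
    let ?m = "tensor_map R (A x y) (tensor R (A y z) (A z t)) (A x y) (A y t) (\<lambda>a. a) (m y z t)"
    let ?a = "tensor_assoc R (A x y) (A y z) (A z t) u"
    have i: "linear_map R (tensor R (A x y) (tensor R (A y z) (A z t)))
        (tensor R (A x y) (odo R X A A y t)) ?i"
      by (intro tensor_map_linear mods X odo_in_linear[OF A A] linear_map_id)
    have a: "?a \<in> carrier (tensor R (A x y) (tensor R (A y z) (A z t)))"
      by (intro linear_map_closed[OF tensor_assoc_linear] mods X u)
    have 1: "odo_assoc R X A A A x t (?gen x y z t u) = odo_in R X A (odo R X A A) x t y (?i ?a)"
      by (rule odo_assoc_in[OF X(1,4) A A A X(3,2) u])
    have 2: "?R x t \<dots> = odo_in R X A A x t y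
        (tensor_map R (A x y) (odo R X A A y t) (A x y) (A y t) (mor_id x y) (\<mu> y t) (?i ?a))"
      by (rule odo_map_in[OF A AA A A X(1,4) _ _ X(2) linear_map_closed[OF i a]])
        (simp_all add: mu X mor_id_def linear_map_id)
    have 3: "tensor_map R (A x y) (odo R X A A y t) (A x y) (A y t) (mor_id x y) (\<mu> y t) (?i ?a) =
        tensor_map R (A x y) (tensor R (A y z) (A z t)) (A x y) (A y t)
          (\<lambda>a. a) (\<lambda>b. \<mu> y t (odo_in R X A A y t z b)) ?a"
      unfolding mor_id_def
      by (rule tensor_map_comp) (simp_all add: mods X odo_in_linear[OF A A] linear_map_id mu a)
    have 4: "\<dots> = ?m ?a"
      by (rule fun_cong[OF tensor_map_cong]) (simp_all add: m X)
    have "?m ?a \<in> carrier (tensor R (A x y) (A y t))"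
      by (intro linear_map_closed[OF tensor_map_linear] mods X mult_linear linear_map_id a)
    then show ?thesis unfolding 1 2 3 4 by (simp only: m[OF X(1,2,4)])
  qed
  show ?thesis
  proof
    assume l: ?l
    show ?r
    proof (intro ballI)
      fix x y z t u assume X: "x \<in> X" "y \<in> X" "z \<in> X" "t \<in> X"
        and u: "u \<in> carrier (tensor R (tensor R (A x y) (A y z)) (A z t))"
      have "?gen x y z t u \<in> carrier (odo R X (odo R X A A) A x t)"
        by (intro linear_map_closed[OF odo_in_linear[OF AA A]] linear_map_closed[OF tensor_map_linear]
            mods X odo_in_linear[OF A A] linear_map_id u)
      then have "\<mu> x t (?L x t (?gen x y z t u)) = \<mu> x t (?R x t (odo_assoc R X A A A x t (?gen x y z t u)))"
        using l X by (simp add: mor_eq_def mor_comp_def)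
      then show "m x y t (tensor_map R (A x y) (tensor R (A y z) (A z t)) (A x y) (A y t)
         (\<lambda>a. a) (m y z t) (tensor_assoc R (A x y) (A y z) (A z t) u)) =
       m x z t (tensor_map R (tensor R (A x y) (A y z)) (A z t) (A x z) (A z t) (m x y z) (\<lambda>a. a) u)"
        unfolding L_in[OF X u] R_in[OF X u] ..
    qed
  next
    assume r: ?r
    have "\<mu> x t (?L x t s) = \<mu> x t (?R x t (odo_assoc R X A A A x t s))"
      if X: "x \<in> X" "t \<in> X" and s: "s \<in> carrier (odo R X (odo R X A A) A x t)" for x t s
    proof (rule odo_odo_ext[OF X A A A L[OF X] R[OF X] mods(1)[OF X] _ s])
      \<comment> \<open>The outer index comes first in \<open>odo_odo_ext\<close>: here z is outer
        and y inner, against their order along the path.\<close>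
      fix z y u assume zy: "z \<in> X" "y \<in> X"
        and u: "u \<in> carrier (tensor R (tensor R (A x y) (A y z)) (A z t))"
      show "\<mu> x t (?L x t (?gen x y z t u)) = \<mu> x t (?R x t (odo_assoc R X A A A x t (?gen x y z t u)))"
        unfolding L_in[OF X(1) zy(2,1) X(2) u] R_in[OF X(1) zy(2,1) X(2) u]
        using r X zy u by simp
    qed
    then show ?l by (simp add: mor_eq_def mor_comp_def)
  qed
qed

text \<open>By \<open>odo_unit_left_ext\<close> only the summand at x has to be tested. On it the
  unit constraint of the matrix product is that of modules, and the unit enters through its diagonal
  component.\<close>

lemma odo_lunit_iff:
  "mor_eq X (odo R X (odo_unit R) A) (\<mu> \<circ>\<^sub>X odo_map R X (odo_unit R) A A A \<eta> mor_id) (odo_lunit R X A) \<longleftrightarrow>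
   (\<forall>x\<in>X. \<forall>y\<in>X. \<forall>u\<in>carrier (tensor R (reg_mod R) (A x y)).
     m x x y (tensor_map R (reg_mod R) (A x y) (A x x) (A x y) (\<eta> x x) (\<lambda>a. a) u) =
     tensor_lunit R (A x y) u)"
  (is "?l \<longleftrightarrow> ?r")
proof -
  note U = module_family_unit(1)
  let ?L = "\<lambda>x t. odo_map R X (odo_unit R) A A A \<eta> mor_id x t"
  have L: "linear_map R (odo R X (odo_unit R) A x t) (A x t) (\<lambda>s. \<mu> x t (?L x t s))"
    if "x \<in> X" "t \<in> X" for x t
    by (rule linear_map_comp[OF odo_map_linear[OF U A A A] mu])
      (simp_all add: that eta mu mor_id_def linear_map_id)
  have etax: "linear_map R (reg_mod R) (A x x) (\<eta> x x)" if "x \<in> X" for x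
    using eta[OF that that] by simp
  have L_in: "\<mu> x t (?L x t (odo_in R X (odo_unit R) A x t x u)) =
      m x x t (tensor_map R (reg_mod R) (A x t) (A x x) (A x t) (\<eta> x x) (\<lambda>a. a) u)"
    if X: "x \<in> X" "t \<in> X" and u: "u \<in> carrier (tensor R (reg_mod R) (A x t))" for x t u
  proof -
    \<comment> \<open>The base ring is rewritten as the diagonal entry of the unit family, the form
      that \<open>odo_map_in\<close> expects.\<close>
    have u': "u \<in> carrier (tensor R (odo_unit R x x) (A x t))" using u by simp
    have "?L x t (odo_in R X (odo_unit R) A x t x u) = odo_in R X A A x t x
      (tensor_map R (reg_mod R) (A x t) (A x x) (A x t) (\<eta> x x) (\<lambda>a. a) u)"
      using odo_map_in[OF U A A A X, of \<eta> mor_id, OF _ _ X(1) u']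
      by (simp add: X eta mor_id_def linear_map_id)
    moreover have "tensor_map R (reg_mod R) (A x t) (A x x) (A x t) (\<eta> x x) (\<lambda>a. a) u
        \<in> carrier (tensor R (A x x) (A x t))"
      by (intro linear_map_closed[OF tensor_map_linear] mods X etax linear_map_id u)
    ultimately show ?thesis by (simp add: m X)
  qed
  show ?thesis
  proof
    assume l: ?l
    show ?r
    proof (intro ballI)
      fix x t u assume X: "x \<in> X" "t \<in> X" and u: "u \<in> carrier (tensor R (reg_mod R) (A x t))"
      have "odo_in R X (odo_unit R) A x t x u \<in> carrier (odo R X (odo_unit R) A x t)"
        by (intro linear_map_closed[OF odo_in_linear[OF U A]] X) (simp add: u)
      then have "\<mu> x t (?L x t (odo_in R X (odo_unit R) A x t x u)) =
          odo_lunit R X A x t (odo_in R X (odo_unit R) A x t x u)"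
        using l X by (simp add: mor_eq_def mor_comp_def)
      then show "m x x t (tensor_map R (reg_mod R) (A x t) (A x x) (A x t) (\<eta> x x) (\<lambda>a. a) u) =
          tensor_lunit R (A x t) u"
        unfolding L_in[OF X u] odo_lunit_in[OF X A u] .
    qed
  next
    assume r: ?r
    have "\<mu> x t (?L x t s) = odo_lunit R X A x t s"
      if X: "x \<in> X" "t \<in> X" and s: "s \<in> carrier (odo R X (odo_unit R) A x t)" for x t s
      by (rule odo_unit_left_ext[OF X A L[OF X] odo_lunit_linear[OF X A] mods(1)[OF X] _ s])
        (use r X in \<open>simp add: L_in odo_lunit_in[OF X A]\<close>)
    then show ?l by (simp add: mor_eq_def mor_comp_def)
  qed
qed

lemma odo_runit_iff:
  "mor_eq X (odo R X A (odo_unit R)) (\<mu> \<circ>\<^sub>X odo_map R X A (odo_unit R) A A mor_id \<eta>) (odo_runit R X A) \<longleftrightarrow>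
   (\<forall>x\<in>X. \<forall>y\<in>X. \<forall>u\<in>carrier (tensor R (A x y) (reg_mod R)).
     m x y y (tensor_map R (A x y) (reg_mod R) (A x y) (A y y) (\<lambda>a. a) (\<eta> y y) u) =
     tensor_runit R (A x y) u)"
  (is "?l \<longleftrightarrow> ?r")
proof -
  note U = module_family_unit(1)
  let ?L = "\<lambda>x t. odo_map R X A (odo_unit R) A A mor_id \<eta> x t"
  have L: "linear_map R (odo R X A (odo_unit R) x t) (A x t) (\<lambda>s. \<mu> x t (?L x t s))"
    if "x \<in> X" "t \<in> X" for x t
    by (rule linear_map_comp[OF odo_map_linear[OF A U A A] mu])
      (simp_all add: that eta mu mor_id_def linear_map_id)
  have etax: "linear_map R (reg_mod R) (A x x) (\<eta> x x)" if "x \<in> X" for x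
    using eta[OF that that] by simp
  have L_in: "\<mu> x t (?L x t (odo_in R X A (odo_unit R) x t t u)) =
      m x t t (tensor_map R (A x t) (reg_mod R) (A x t) (A t t) (\<lambda>a. a) (\<eta> t t) u)"
    if X: "x \<in> X" "t \<in> X" and u: "u \<in> carrier (tensor R (A x t) (reg_mod R))" for x t u
  proof -
    have u': "u \<in> carrier (tensor R (A x t) (odo_unit R t t))" using u by simp
    have "?L x t (odo_in R X A (odo_unit R) x t t u) = odo_in R X A A x t t
      (tensor_map R (A x t) (reg_mod R) (A x t) (A t t) (\<lambda>a. a) (\<eta> t t) u)"
      using odo_map_in[OF A U A A X, of mor_id \<eta>, OF _ _ X(2) u']
      by (simp add: X eta mor_id_def linear_map_id)
    moreover have "tensor_map R (A x t) (reg_mod R) (A x t) (A t t) (\<lambda>a. a) (\<eta> t t) u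
        \<in> carrier (tensor R (A x t) (A t t))"
      by (intro linear_map_closed[OF tensor_map_linear] mods X etax linear_map_id u)
    ultimately show ?thesis by (simp add: m X)
  qed
  show ?thesis
  proof
    assume l: ?l
    show ?r
    proof (intro ballI)
      fix x t u assume X: "x \<in> X" "t \<in> X" and u: "u \<in> carrier (tensor R (A x t) (reg_mod R))"
      have "odo_in R X A (odo_unit R) x t t u \<in> carrier (odo R X A (odo_unit R) x t)"
        by (intro linear_map_closed[OF odo_in_linear[OF A U]] X) (simp add: u)
      then have "\<mu> x t (?L x t (odo_in R X A (odo_unit R) x t t u)) =
          odo_runit R X A x t (odo_in R X A (odo_unit R) x t t u)"
        using l X by (simp add: mor_eq_def mor_comp_def)
      then show "m x t t (tensor_map R (A x t) (reg_mod R) (A x t) (A t t) (\<lambda>a. a) (\<eta> t t) u) =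
          tensor_runit R (A x t) u"
        unfolding L_in[OF X u] odo_runit_in[OF X A u] .
    qed
  next
    assume r: ?r
    have "\<mu> x t (?L x t s) = odo_runit R X A x t s"
      if X: "x \<in> X" "t \<in> X" and s: "s \<in> carrier (odo R X A (odo_unit R) x t)" for x t s
      by (rule odo_unit_right_ext[OF X A L[OF X] odo_runit_linear[OF X A] mods(1)[OF X] _ s])
        (use r X in \<open>simp add: L_in odo_runit_in[OF X A]\<close>)
    then show ?l by (simp add: mor_eq_def mor_comp_def)
  qed
qed

text \<open>Serves both compatibilities of the multiplication with the coalgebra structure, whose
  two sides are parallel morphisms out of A \<odot> A.\<close>

lemma mor_eq_odo_iff:
  assumes f: "\<And>x z. x \<in> X \<Longrightarrow> z \<in> X \<Longrightarrow> linear_map R (odo R X A A x z) (P x z) (f x z)"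
    and g: "\<And>x z. x \<in> X \<Longrightarrow> z \<in> X \<Longrightarrow> linear_map R (odo R X A A x z) (P x z) (g x z)"
    and P: "module_family R X P"
  shows "mor_eq X (odo R X A A) f g \<longleftrightarrow>
    (\<forall>x\<in>X. \<forall>y\<in>X. \<forall>z\<in>X. \<forall>u\<in>carrier (tensor R (A x y) (A y z)).
      f x z (odo_in R X A A x z y u) = g x z (odo_in R X A A x z y u))" (is "?l \<longleftrightarrow> ?r")
proof
  assume l: ?l
  show ?r
    using l linear_map_closed[OF odo_in_linear[OF A A]] by (simp add: mor_eq_def)
next
  assume r: ?r
  show ?l
    unfolding mor_eq_def
  proof (intro ballI)
    fix x z s assume X: "x \<in> X" "z \<in> X" and s: "s \<in> carrier (odo R X A A x z)"
    show "f x z s = g x z s"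
      by (rule odo_ext[OF A A X f[OF X] g[OF X] module_familyD[OF P X] _ s]) (use r X in simp)
  qed
qed

text \<open>On the summand at y the longer composite is \<Delta> \<otimes> \<Delta>, the switch, two
  inclusions and then \<mu> \<otimes> \<mu>. The first two form the comultiplication of the tensor
  product coalgebra, and the last two contract to \<open>m\<close> \<otimes> \<open>m\<close>. The
  axiom thus says that \<open>m\<close> preserves comultiplication.\<close>

lemma comult_mult_iff:
  "mor_eq X (odo R X A A) (\<Delta> \<circ>\<^sub>X \<mu>)
     (bul_map R (odo R X A A) (odo R X A A) A A \<mu> \<mu> \<circ>\<^sub>X zeta R X A A A A \<circ>\<^sub>X
      odo_map R X A A (bul R A A) (bul R A A) \<Delta> \<Delta>) \<longleftrightarrow>
   (\<forall>x\<in>X. \<forall>y\<in>X. \<forall>z\<in>X. \<forall>u\<in>carrier (tensor R (A x y) (A y z)).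
     \<Delta> x z (m x y z u) =
     tensor_map R (tensor R (A x y) (A y z)) (tensor R (A x y) (A y z)) (A x z) (A x z) (m x y z) (m x y z)
       (tensor_comult R (A x y) (\<Delta> x y) (A y z) (\<Delta> y z) u))"
proof -
  note B = module_family_bul[OF A A]
  let ?Z = "\<lambda>x z. zeta R X A A A A x z"
  let ?O = "\<lambda>x z. odo_map R X A A (bul R A A) (bul R A A) \<Delta> \<Delta> x z"
  let ?M = "\<lambda>x z. tensor_map R (odo R X A A x z) (odo R X A A x z) (A x z) (A x z) (\<mu> x z) (\<mu> x z)"
  have Delta': "linear_map R (A x z) (bul R A A x z) (\<Delta> x z)" if "x \<in> X" "z \<in> X" for x z
    using Delta[OF that] by (simp add: bul_def)
  have O: "linear_map R (odo R X A A x z) (odo R X (bul R A A) (bul R A A) x z) (?O x z)"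
    if "x \<in> X" "z \<in> X" for x z
    using that by (intro odo_map_linear[OF A A B B] Delta')
  have Z: "linear_map R (odo R X (bul R A A) (bul R A A) x z) (tensor R (odo R X A A x z) (odo R X A A x z)) (?Z x z)"
    if "x \<in> X" "z \<in> X" for x z
    using zeta_linear[OF that A A A A] by (simp add: bul_def[of R "odo R X A A"])
  have Mlin: "linear_map R (tensor R (odo R X A A x z) (odo R X A A x z)) (tensor R (A x z) (A x z)) (?M x z)"
    if "x \<in> X" "z \<in> X" for x z
    using that by (intro tensor_map_linear mods mu)
  have "?M x z (?Z x z (?O x z (odo_in R X A A x z y u))) =
     tensor_map R (tensor R (A x y) (A y z)) (tensor R (A x y) (A y z)) (A x z) (A x z) (m x y z) (m x y z)
       (tensor_comult R (A x y) (\<Delta> x y) (A y z) (\<Delta> y z) u)"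
    if X: "x \<in> X" "y \<in> X" "z \<in> X" and u: "u \<in> carrier (tensor R (A x y) (A y z))" for x y z u
  proof -
    let ?T = "tensor R (A x y) (A y z)"
    let ?d = "tensor_map R (A x y) (A y z) (tensor R (A x y) (A x y)) (tensor R (A y z) (A y z)) (\<Delta> x y) (\<Delta> y z) u"
    let ?s = "tensor_switch R (A x y) (A x y) (A y z) (A y z) ?d"
    have d: "?d \<in> carrier (tensor R (tensor R (A x y) (A x y)) (tensor R (A y z) (A y z)))"
      by (intro linear_map_closed[OF tensor_map_linear] mods X Delta u)
    have s: "?s \<in> carrier (tensor R ?T ?T)"
      by (intro linear_map_closed[OF tensor_switch_linear] mods X d)
    have 1: "?O x z (odo_in R X A A x z y u) = odo_in R X (bul R A A) (bul R A A) x z y ?d"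
      using odo_map_in[OF A A B B X(1,3) _ _ X(2) u, of \<Delta> \<Delta>] Delta' X
      by (simp add: bul_def[of R A A])
    have 2: "?Z x z \<dots> = tensor_map R ?T ?T (odo R X A A x z) (odo R X A A x z)
        (odo_in R X A A x z y) (odo_in R X A A x z y) ?s"
      by (rule zeta_in[OF X(1,3) A A A A X(2) d])
    have 3: "?M x z \<dots> = tensor_map R ?T ?T (A x z) (A x z)
        (\<lambda>a. \<mu> x z (odo_in R X A A x z y a)) (\<lambda>a. \<mu> x z (odo_in R X A A x z y a)) ?s"
      by (rule tensor_map_comp) (simp_all add: mods X odo_in_linear[OF A A] mu s)
    have 4: "\<dots> = tensor_map R ?T ?T (A x z) (A x z) (m x y z) (m x y z) ?s"
      by (rule fun_cong[OF tensor_map_cong]) (simp_all add: m X)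
    have 5: "?s = tensor_comult R (A x y) (\<Delta> x y) (A y z) (\<Delta> y z) u"
      using u by (simp add: tensor_comult_def)
    show ?thesis unfolding 1 2 3 4 unfolding 5 ..
  qed
  moreover have "mor_eq X (odo R X A A) (\<lambda>x z s. \<Delta> x z (\<mu> x z s)) (\<lambda>x z s. ?M x z (?Z x z (?O x z s))) \<longleftrightarrow>
    (\<forall>x\<in>X. \<forall>y\<in>X. \<forall>z\<in>X. \<forall>u\<in>carrier (tensor R (A x y) (A y z)).
      \<Delta> x z (\<mu> x z (odo_in R X A A x z y u)) = ?M x z (?Z x z (?O x z (odo_in R X A A x z y u))))"
  proof (rule mor_eq_odo_iff[OF _ _ B])
    fix x z assume X: "x \<in> X" "z \<in> X"
    show "linear_map R (odo R X A A x z) (bul R A A x z) (\<lambda>s. \<Delta> x z (\<mu> x z s))"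
      by (rule linear_map_comp[OF mu[OF X] Delta'[OF X]])
    show "linear_map R (odo R X A A x z) (bul R A A x z) (\<lambda>s. ?M x z (?Z x z (?O x z s)))"
      using linear_map_comp[OF linear_map_comp[OF O[OF X] Z[OF X]] Mlin[OF X]]
      by (simp add: bul_def[of R A A])
  qed
  ultimately show ?thesis
    by (simp add: mor_comp_def comp_def bul_map_def m)
qed

text \<open>Restricted to a summand, \<open>varpi\<close> after \<epsilon> \<odot> \<epsilon>
  multiplies the two counits, which is the counit of the tensor product coalgebra.\<close>

lemma counit_mult_iff:
  "mor_eq X (odo R X A A) (varpi R X \<circ>\<^sub>X odo_map R X A A (bul_unit R) (bul_unit R) \<epsilon> \<epsilon>) (\<epsilon> \<circ>\<^sub>X \<mu>) \<longleftrightarrow>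
   (\<forall>x\<in>X. \<forall>y\<in>X. \<forall>z\<in>X. \<forall>u\<in>carrier (tensor R (A x y) (A y z)).
     \<epsilon> x z (m x y z u) = tensor_counit R (A x y) (\<epsilon> x y) (A y z) (\<epsilon> y z) u)"
proof -
  note J = module_family_unit(2)
  let ?O = "\<lambda>x z. odo_map R X A A (bul_unit R) (bul_unit R) \<epsilon> \<epsilon> x z"
  have eps': "linear_map R (A x z) (bul_unit R x z) (\<epsilon> x z)" if "x \<in> X" "z \<in> X" for x z
    using eps[OF that] by simp
  have O: "linear_map R (odo R X A A x z) (odo R X (bul_unit R) (bul_unit R) x z) (?O x z)"
    if "x \<in> X" "z \<in> X" for x z
    using that by (intro odo_map_linear[OF A A J J] eps')
  have "varpi R X x z (?O x z (odo_in R X A A x z y u)) =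
      tensor_counit R (A x y) (\<epsilon> x y) (A y z) (\<epsilon> y z) u"
    if X: "x \<in> X" "y \<in> X" "z \<in> X" and u: "u \<in> carrier (tensor R (A x y) (A y z))" for x y z u
  proof -
    let ?d = "tensor_map R (A x y) (A y z) (reg_mod R) (reg_mod R) (\<epsilon> x y) (\<epsilon> y z) u"
    have d: "?d \<in> carrier (tensor R (reg_mod R) (reg_mod R))"
      by (intro linear_map_closed[OF tensor_map_linear] mods X eps u)
    have 1: "?O x z (odo_in R X A A x z y u) = odo_in R X (bul_unit R) (bul_unit R) x z y ?d"
      using odo_map_in[OF A A J J X(1,3) _ _ X(2) u, of \<epsilon> \<epsilon>] eps X by simp
    show ?thesis unfolding 1 varpi_in[OF X(1,3,2) d] using u by (simp add: tensor_counit_def)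
  qed
  moreover have "mor_eq X (odo R X A A) (\<lambda>x z s. varpi R X x z (?O x z s)) (\<lambda>x z s. \<epsilon> x z (\<mu> x z s)) \<longleftrightarrow>
    (\<forall>x\<in>X. \<forall>y\<in>X. \<forall>z\<in>X. \<forall>u\<in>carrier (tensor R (A x y) (A y z)).
      varpi R X x z (?O x z (odo_in R X A A x z y u)) = \<epsilon> x z (\<mu> x z (odo_in R X A A x z y u)))"
  proof (rule mor_eq_odo_iff[OF _ _ J])
    fix x z assume X: "x \<in> X" "z \<in> X"
    show "linear_map R (odo R X A A x z) (bul_unit R x z) (\<lambda>s. \<epsilon> x z (\<mu> x z s))"
      using linear_map_comp[OF mu[OF X] eps[OF X]] by simp
    show "linear_map R (odo R X A A x z) (bul_unit R x z) (\<lambda>s. varpi R X x z (?O x z s))"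
      using linear_map_comp[OF O[OF X] varpi_linear[OF X]] by simp
  qed
  ultimately show ?thesis
    by (auto simp: mor_comp_def comp_def m)
qed

text \<open>On the diagonal \<open>delta\<close> sends r to r \<otimes> 1, which is the
  comultiplication of the base ring. Off the diagonal the source is zero and both sides vanish by
  linearity, in accordance with the category side imposing no condition there.\<close>

lemma comult_unit_iff:
  "mor_eq X (odo_unit R) (bul_map R (odo_unit R) (odo_unit R) A A \<eta> \<eta> \<circ>\<^sub>X delta R) (\<Delta> \<circ>\<^sub>X \<eta>) \<longleftrightarrow>
   (\<forall>x\<in>X. \<forall>r\<in>carrier R.
     \<Delta> x x (\<eta> x x r) = tensor_map R (reg_mod R) (reg_mod R) (A x x) (A x x) (\<eta> x x) (\<eta> x x) (base_comult R r))"
proof -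
  have off: "bul_map R (odo_unit R) (odo_unit R) A A \<eta> \<eta> x y (delta R x y r) = \<Delta> x y (\<eta> x y r)"
    if X: "x \<in> X" "y \<in> X" and ne: "x \<noteq> y" and r: "r \<in> carrier (odo_unit R x y)" for x y r
  proof -
    have [simp]: "r = \<zero>" using r ne by simp
    have "bul_map R (odo_unit R) (odo_unit R) A A \<eta> \<eta> x y (delta R x y r) = \<zero>\<^bsub>tensor R (A x y) (A x y)\<^esub>"
      using ne r linear_map_zero[OF _ _ tensor_map_linear[OF module_odo_unit module_odo_unit
            mods(1)[OF X] mods(1)[OF X] eta[OF X] eta[OF X]]]
      by (simp add: bul_map_def delta_def bul_def module_odo_unit mods X module_tensor)
    also have "\<dots> = \<Delta> x y (\<eta> x y r)"
      using linear_map_zero[OF module_odo_unit mods(1)[OF X] eta[OF X]]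
        linear_map_zero[OF mods(1)[OF X] _ Delta[OF X]] by (simp add: mods X)
    finally show ?thesis .
  qed
  have diag: "bul_map R (odo_unit R) (odo_unit R) A A \<eta> \<eta> x x (delta R x x r) =
      tensor_map R (reg_mod R) (reg_mod R) (A x x) (A x x) (\<eta> x x) (\<eta> x x) (base_comult R r)"
    if "r \<in> carrier R" for x r
    using that by (simp add: bul_map_def delta_def base_comult_def)
  show ?thesis
    (is "?l \<longleftrightarrow> ?r")
  proof
    assume l: ?l
    show ?r
    proof (intro ballI)
      fix x r assume "x \<in> X" "r \<in> carrier R"
      with l[unfolded mor_eq_def, rule_format, of x x r] show "\<Delta> x x (\<eta> x x r) =
        tensor_map R (reg_mod R) (reg_mod R) (A x x) (A x x) (\<eta> x x) (\<eta> x x) (base_comult R r)"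
        by (simp add: mor_comp_def diag)
    qed
  next
    assume r: ?r
    show ?l
      unfolding mor_eq_def
    proof (intro ballI)
      fix x y s assume X: "x \<in> X" "y \<in> X" and s: "s \<in> carrier (odo_unit R x y)"
      show "(bul_map R (odo_unit R) (odo_unit R) A A \<eta> \<eta> \<circ>\<^sub>X delta R) x y s = (\<Delta> \<circ>\<^sub>X \<eta>) x y s"
        using r X s off[OF X _ s] by (cases "x = y") (simp_all add: mor_comp_def diag)
    qed
  qed
qed

text \<open>On the diagonal \<open>tau\<close> is the counit of the base ring; off the diagonal both
  maps send the only element, zero, to zero.\<close>

lemma counit_unit_iff:
  "mor_eq X (odo_unit R) (\<epsilon> \<circ>\<^sub>X \<eta>) (tau R) \<longleftrightarrow>
   (\<forall>x\<in>X. \<forall>r\<in>carrier R. \<epsilon> x x (\<eta> x x r) = base_counit R r)" (is "?l \<longleftrightarrow> ?r")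
proof
  assume l: ?l
  show ?r
  proof (intro ballI)
    fix x r assume "x \<in> X" "r \<in> carrier R"
    with l[unfolded mor_eq_def, rule_format, of x x r] show "\<epsilon> x x (\<eta> x x r) = base_counit R r"
      by (simp add: mor_comp_def tau_def base_counit_def)
  qed
next
  assume r: ?r
  have off: "\<epsilon> x y (\<eta> x y \<zero>) = \<zero>" if X: "x \<in> X" "y \<in> X" for x y
    using linear_map_zero[OF module_odo_unit mods(1)[OF X] eta[OF X]]
      linear_map_zero[OF mods(1)[OF X] module_reg_mod eps[OF X]] by simp
  show ?l
    unfolding mor_eq_def
  proof (intro ballI)
    fix x y s assume X: "x \<in> X" "y \<in> X" and s: "s \<in> carrier (odo_unit R x y)"
    show "(\<epsilon> \<circ>\<^sub>X \<eta>) x y s = tau R x y s"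
      using r X s off[OF X] by (cases "x = y") (simp_all add: mor_comp_def tau_def base_counit_def)
  qed
qed

end

end

section \<open>Morphisms as extensional families and assembly of the bijection\<close>

lemma mor_iff:
  "f \<in> mor R X M N \<longleftrightarrow> f \<in> extensional X \<and>
    (\<forall>x\<in>X. f x \<in> extensional X \<and> (\<forall>y\<in>X. f x y \<in> lin R (M x y) (N x y)))"
  by (auto simp: mor_def PiE_iff)

lemma mor_lin: "f \<in> mor R X M N \<Longrightarrow> x \<in> X \<Longrightarrow> y \<in> X \<Longrightarrow> f x y \<in> lin R (M x y) (N x y)"
  by (simp add: mor_iff)

lemma mor_eqI:
  assumes f: "f \<in> mor R X M N" and g: "g \<in> mor R X M N"
    and eq: "\<And>x y. x \<in> X \<Longrightarrow> y \<in> X \<Longrightarrow> f x y = g x y"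
  shows "f = g"
proof (rule extensionalityI)
  show "f \<in> extensional X" "g \<in> extensional X" using f g by (simp_all add: mor_iff)
  fix x assume x: "x \<in> X"
  show "f x = g x"
    by (rule extensionalityI[of _ X]) (use f g x eq in \<open>simp_all add: mor_iff\<close>)
qed

context cring
begin

text \<open>The entrywise product and its constraints are defined componentwise, so the coalgebra
  axioms on the two sides coincide after unfolding.\<close>

lemma coalg_iff:
  assumes "\<Delta> \<in> mor R X A (bul R A A)" "\<epsilon> \<in> mor R X A (bul_unit R)"
  shows "(\<forall>x\<in>X. \<forall>y\<in>X. coalg R (A x y) (\<Delta> x y) (\<epsilon> x y)) \<longleftrightarrow> bul_coalgebra R X A \<Delta> \<epsilon>"
proof -
  have "\<Delta> x y \<in> lin R (A x y) (tensor R (A x y) (A x y))" "\<epsilon> x y \<in> lin R (A x y) (reg_mod R)"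
    if "x \<in> X" "y \<in> X" for x y
    using mor_lin[OF assms(1) that] mor_lin[OF assms(2) that] by (simp_all add: bul_def)
  then show ?thesis
    unfolding coalg_def bul_coalgebra_def mor_eq_def mor_comp_def mor_id_def bul_assoc_def bul_map_def
      bul_lunit_def bul_runit_def comp_def
    using assms by (simp add: bul_def bul_unit_def ball_conj_distrib)
qed

text \<open>The data are fixed and only axioms are compared. As an equivalence it serves twice: from
  left to right it shows that the correspondence lands in category structures, and from right to
  left it yields the axioms in the proof of surjectivity.\<close>

lemma bimonoid_structures_iff:
  assumes A: "module_family R X A"
    and mu: "\<mu> \<in> mor R X (odo R X A A) A" and eta: "\<eta> \<in> mor R X (odo_unit R) A"
    and Delta: "\<Delta> \<in> mor R X A (bul R A A)" and eps: "\<epsilon> \<in> mor R X A (bul_unit R)"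
  shows "(\<mu>, \<eta>, \<Delta>, \<epsilon>) \<in> bimonoid_structures R X A \<longleftrightarrow>
    bimonoid_to_category R X A (\<mu>, \<eta>, \<Delta>, \<epsilon>) \<in> coalg_category_structures R X A"
proof -
  define m where "m = (\<lambda>x\<in>X. \<lambda>y\<in>X. \<lambda>z\<in>X. \<lambda>u\<in>carrier (tensor R (A x y) (A y z)).
    \<mu> x z (odo_in R X A A x z y u))"
  define e where "e = (\<lambda>x\<in>X. \<eta> x x)"
  have mu': "linear_map R (odo R X A A x z) (A x z) (\<mu> x z)" if "x \<in> X" "z \<in> X" for x z
    by (rule lin_linear[OF mor_lin[OF mu that]])
  have eta': "linear_map R (odo_unit R x z) (A x z) (\<eta> x z)" if "x \<in> X" "z \<in> X" for x z
    by (rule lin_linear[OF mor_lin[OF eta that]])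
  have Delta': "linear_map R (A x z) (tensor R (A x z) (A x z)) (\<Delta> x z)" if "x \<in> X" "z \<in> X" for x z
    using lin_linear[OF mor_lin[OF Delta that]] by (simp add: bul_def)
  have eps': "linear_map R (A x z) (reg_mod R) (\<epsilon> x z)" if "x \<in> X" "z \<in> X" for x z
    using lin_linear[OF mor_lin[OF eps that]] by simp
  have m: "m x y z u = \<mu> x z (odo_in R X A A x z y u)"
    if "x \<in> X" "y \<in> X" "z \<in> X" "u \<in> carrier (tensor R (A x y) (A y z))" for x y z u
    using that by (simp add: m_def)
  have m_lin: "m x y z \<in> lin R (tensor R (A x y) (A y z)) (A x z)"
    if "x \<in> X" "y \<in> X" "z \<in> X" for x y z
    using mult_linear[where m = m, OF A mu' eta' Delta' eps' m that] that
    by (simp add: lin_iff) (simp add: m_def)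
  have e_lin: "e x \<in> lin R (reg_mod R) (A x x)" if "x \<in> X" for x
    using mor_lin[OF eta that that] that by (simp add: e_def)
  note iffs = odo_assoc_iff[where m = m, OF A mu' eta' Delta' eps' m]
    odo_lunit_iff[where m = m, OF A mu' eta' Delta' eps' m]
    odo_runit_iff[where m = m, OF A mu' eta' Delta' eps' m]
    comult_mult_iff[where m = m, OF A mu' eta' Delta' eps' m]
    counit_mult_iff[where m = m, OF A mu' eta' Delta' eps' m]
    comult_unit_iff[where m = m, OF A mu' eta' Delta' eps' m]
    counit_unit_iff[where m = m, OF A mu' eta' Delta' eps' m]
  have btc: "bimonoid_to_category R X A (\<mu>, \<eta>, \<Delta>, \<epsilon>) = (\<Delta>, \<epsilon>, m, e)"
    by (simp add: bimonoid_to_category_def m_def e_def)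
  \<comment> \<open>The typing conditions of a category structure hold outright for the restricted
    data; the axioms are what remains to be compared.\<close>
  have "m \<in> (\<Pi>\<^sub>E x\<in>X. \<Pi>\<^sub>E y\<in>X. \<Pi>\<^sub>E z\<in>X. lin R (tensor R (A x y) (A y z)) (A x z))"
    using m_lin by (auto simp: PiE_iff) (auto simp: m_def)
  moreover have "e \<in> (\<Pi>\<^sub>E x\<in>X. lin R (reg_mod R) (A x x))"
    using e_lin by (auto simp: PiE_iff) (auto simp: e_def)
  moreover have "\<Delta> \<in> (\<Pi>\<^sub>E x\<in>X. \<Pi>\<^sub>E y\<in>X. lin R (A x y) (tensor R (A x y) (A x y)))"
    "\<epsilon> \<in> (\<Pi>\<^sub>E x\<in>X. \<Pi>\<^sub>E y\<in>X. lin R (A x y) (reg_mod R))"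
    using Delta eps by (simp_all add: mor_def bul_def)
  \<comment> \<open>Linearity of \<open>m\<close> being known, a coalgebra morphism splits into one
    condition on comultiplications and one on counits, each matching a bimonoid axiom.\<close>
  moreover have "(\<forall>x\<in>X. \<forall>y\<in>X. \<forall>z\<in>X.
        coalg_hom R (tensor R (A x y) (A y z))
          (tensor_comult R (A x y) (\<Delta> x y) (A y z) (\<Delta> y z))
          (tensor_counit R (A x y) (\<epsilon> x y) (A y z) (\<epsilon> y z))
          (A x z) (\<Delta> x z) (\<epsilon> x z) (m x y z)) \<longleftrightarrow>
      (\<forall>x\<in>X. \<forall>y\<in>X. \<forall>z\<in>X. \<forall>u\<in>carrier (tensor R (A x y) (A y z)). \<Delta> x z (m x y z u) =
        tensor_map R (tensor R (A x y) (A y z)) (tensor R (A x y) (A y z)) (A x z) (A x z)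
          (m x y z) (m x y z) (tensor_comult R (A x y) (\<Delta> x y) (A y z) (\<Delta> y z) u)) \<and>
      (\<forall>x\<in>X. \<forall>y\<in>X. \<forall>z\<in>X. \<forall>u\<in>carrier (tensor R (A x y) (A y z)).
        \<epsilon> x z (m x y z u) = tensor_counit R (A x y) (\<epsilon> x y) (A y z) (\<epsilon> y z) u)"
    by (simp add: coalg_hom_def m_lin ball_conj_distrib)
  moreover have "(\<forall>x\<in>X. coalg_hom R (reg_mod R) (base_comult R) (base_counit R)
          (A x x) (\<Delta> x x) (\<epsilon> x x) (e x)) \<longleftrightarrow>
      (\<forall>x\<in>X. \<forall>r\<in>carrier R. \<Delta> x x (\<eta> x x r) =
        tensor_map R (reg_mod R) (reg_mod R) (A x x) (A x x) (\<eta> x x) (\<eta> x x) (base_comult R r)) \<and>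
      (\<forall>x\<in>X. \<forall>r\<in>carrier R. \<epsilon> x x (\<eta> x x r) = base_counit R r)"
    using e_lin by (simp add: coalg_hom_def ball_conj_distrib) (simp add: e_def)
  moreover have "(\<forall>x\<in>X. \<forall>y\<in>X. \<forall>u\<in>carrier (tensor R (reg_mod R) (A x y)).
        m x x y (tensor_map R (reg_mod R) (A x y) (A x x) (A x y) (e x) (\<lambda>a. a) u) =
        tensor_lunit R (A x y) u) \<longleftrightarrow>
      (\<forall>x\<in>X. \<forall>y\<in>X. \<forall>u\<in>carrier (tensor R (reg_mod R) (A x y)).
        m x x y (tensor_map R (reg_mod R) (A x y) (A x x) (A x y) (\<eta> x x) (\<lambda>a. a) u) =
        tensor_lunit R (A x y) u)"
    by (simp add: e_def)
  moreover have "(\<forall>x\<in>X. \<forall>y\<in>X. \<forall>u\<in>carrier (tensor R (A x y) (reg_mod R)).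
        m x y y (tensor_map R (A x y) (reg_mod R) (A x y) (A y y) (\<lambda>a. a) (e y) u) =
        tensor_runit R (A x y) u) \<longleftrightarrow>
      (\<forall>x\<in>X. \<forall>y\<in>X. \<forall>u\<in>carrier (tensor R (A x y) (reg_mod R)).
        m x y y (tensor_map R (A x y) (reg_mod R) (A x y) (A y y) (\<lambda>a. a) (\<eta> y y) u) =
        tensor_runit R (A x y) u)"
    by (simp add: e_def)
  \<comment> \<open>Once every axiom is replaced by its counterpart, the two conjunctions differ
    only in arrangement.\<close>
  ultimately show ?thesis
    unfolding btc bimonoid_structures_def coalg_category_structures_def odo_algebra_def mem_Collect_eq
      prod.case coalg_iff[OF Delta eps]
    using mu eta by (simp only: iffs simp_thms conj_ac)
qed

text \<open>Comultiplication and counit are kept unchanged. Two multiplications with the same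
  restrictions agree on the images of all inclusions, hence on the direct sum; extensionality in the
  indices and in the argument makes them equal as functions.\<close>

lemma bimonoid_to_category_inj:
  assumes A: "module_family R X A"
  shows "inj_on (bimonoid_to_category R X A) (bimonoid_structures R X A)"
proof (rule inj_onI)
  fix B B'
  assume B: "B \<in> bimonoid_structures R X A" "B' \<in> bimonoid_structures R X A"
    and eq: "bimonoid_to_category R X A B = bimonoid_to_category R X A B'"
  obtain \<mu> \<eta> \<Delta> \<epsilon> \<mu>' \<eta>' \<Delta>' \<epsilon>'
    where B_eq: "B = (\<mu>, \<eta>, \<Delta>, \<epsilon>)" "B' = (\<mu>', \<eta>', \<Delta>', \<epsilon>')"
    by (metis prod.collapse)
  have mu: "\<mu> \<in> mor R X (odo R X A A) A" "\<mu>' \<in> mor R X (odo R X A A) A"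
    and eta: "\<eta> \<in> mor R X (odo_unit R) A" "\<eta>' \<in> mor R X (odo_unit R) A"
    using B by (simp_all add: B_eq bimonoid_structures_def odo_algebra_def)
  let ?m = "\<lambda>\<mu>. \<lambda>x\<in>X. \<lambda>y\<in>X. \<lambda>z\<in>X. \<lambda>u\<in>carrier (tensor R (A x y) (A y z)). \<mu> x z (odo_in R X A A x z y u)"
  have m: "?m \<mu> = ?m \<mu>'" and e: "(\<lambda>x\<in>X. \<eta> x x) = (\<lambda>x\<in>X. \<eta>' x x)" and D: "\<Delta> = \<Delta>'" "\<epsilon> = \<epsilon>'"
    using eq by (simp_all add: B_eq bimonoid_to_category_def)
  have "\<mu> = \<mu>'"
  proof (rule mor_eqI[OF mu])
    fix x z assume X: "x \<in> X" "z \<in> X"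
    show "\<mu> x z = \<mu>' x z"
    proof (rule lin_eqI[OF mor_lin[OF mu(1) X] mor_lin[OF mu(2) X]])
      fix s assume s: "s \<in> carrier (odo R X A A x z)"
      show "\<mu> x z s = \<mu>' x z s"
      proof (rule odo_ext[OF A A X lin_linear[OF mor_lin[OF mu(1) X]] lin_linear[OF mor_lin[OF mu(2) X]]
            module_familyD[OF A X] _ s])
        fix y u assume y: "y \<in> X" and u: "u \<in> carrier (tensor R (A x y) (A y z))"
        have "?m \<mu> x y z u = ?m \<mu>' x y z u" by (simp only: m)
        then show "\<mu> x z (odo_in R X A A x z y u) = \<mu>' x z (odo_in R X A A x z y u)"
          using X y u by simp
      qed
    qed
  qed
  moreover have "\<eta> = \<eta>'"
  proof (rule mor_eqI[OF eta])
    fix x y assume X: "x \<in> X" "y \<in> X"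
    show "\<eta> x y = \<eta>' x y"
    proof (cases "x = y")
      case True
      then show ?thesis using fun_cong[OF e, of x] X by simp
    next
      case False
      note lin = mor_lin[OF eta(1) X] mor_lin[OF eta(2) X]
      note zero = linear_map_zero[OF module_odo_unit module_familyD[OF A X]]
      \<comment> \<open>The source has zero as its only element, and linear maps agree
        there.\<close>
      show ?thesis
        by (rule lin_eqI[OF lin])
          (use False zero[OF lin_linear[OF lin(1)]] zero[OF lin_linear[OF lin(2)]] in simp)
    qed
  qed
  ultimately show "B = B'" using D by (simp add: B_eq)
qed

text \<open>The preimage is built without regard to the axioms: \<mu> is glued from the given
  compositions and \<eta> is extended by zero. The axioms are then read off from the equivalence,
  since the constructed data translate back to C.\<close>

lemma bimonoid_to_category_surj:
  assumes A: "module_family R X A" and C: "C \<in> coalg_category_structures R X A"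
  shows "C \<in> bimonoid_to_category R X A ` bimonoid_structures R X A"
proof -
  obtain \<Delta> \<epsilon> m e where C_eq: "C = (\<Delta>, \<epsilon>, m, e)" by (metis prod.collapse)
  have Delta: "\<Delta> \<in> mor R X A (bul R A A)" and eps: "\<epsilon> \<in> mor R X A (bul_unit R)"
    and m_PiE: "m \<in> (\<Pi>\<^sub>E x\<in>X. \<Pi>\<^sub>E y\<in>X. \<Pi>\<^sub>E z\<in>X. lin R (tensor R (A x y) (A y z)) (A x z))"
    and e_PiE: "e \<in> (\<Pi>\<^sub>E x\<in>X. lin R (reg_mod R) (A x x))"
    using C unfolding C_eq coalg_category_structures_def by (simp_all add: mor_def bul_def)
  have m: "m x y z \<in> lin R (tensor R (A x y) (A y z)) (A x z)" if "x \<in> X" "y \<in> X" "z \<in> X" for x y z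
    using m_PiE that by (simp add: PiE_iff)
  have e: "e x \<in> lin R (reg_mod R) (A x x)" if "x \<in> X" for x
    using e_PiE that by (simp add: PiE_iff)
  have "\<exists>h. h \<in> lin R (odo R X A A x z) (A x z) \<and>
      (\<forall>y\<in>X. \<forall>u\<in>carrier (tensor R (A x y) (A y z)). h (odo_in R X A A x z y u) = m x y z u)"
    if X: "x \<in> X" "z \<in> X" for x z
  proof -
    have "\<exists>h. linear_map R (odo R X A A x z) (A x z) h \<and>
      (\<forall>y\<in>X. \<forall>u\<in>carrier (tensor R (A x y) (A y z)). h (odo_in R X A A x z y u) = m x y z u)"
      by (rule odo_lift[OF A A X module_familyD[OF A X]]) (rule lin_linear[OF m[OF X(1) _ X(2)]])
    then obtain h where h: "linear_map R (odo R X A A x z) (A x z) h"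
      and hm: "\<forall>y\<in>X. \<forall>u\<in>carrier (tensor R (A x y) (A y z)). h (odo_in R X A A x z y u) = m x y z u"
      by (elim exE conjE)
    \<comment> \<open>Restriction brings the glued map into \<open>lin\<close> without changing its
      values on the inclusions, whose images lie in the carrier.\<close>
    have "restrict h (carrier (odo R X A A x z)) \<in> lin R (odo R X A A x z) (A x z)"
      by (rule restrict_lin[OF module_odo[OF A A X] h])
    then show ?thesis
      using hm linear_map_closed[OF odo_in_linear[OF A A X]]
      by (intro exI[of _ "restrict h (carrier (odo R X A A x z))"]) simp
  qed
  \<comment> \<open>Both indices are packed into a pair so that one application of choice selects
    all components of \<mu>.\<close>
  then have "\<forall>p\<in>X \<times> X. \<exists>h. h \<in> lin R (odo R X A A (fst p) (snd p)) (A (fst p) (snd p)) \<and>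
      (\<forall>y\<in>X. \<forall>u\<in>carrier (tensor R (A (fst p) y) (A y (snd p))).
        h (odo_in R X A A (fst p) (snd p) y u) = m (fst p) y (snd p) u)"
    by simp
  from bchoice[OF this] obtain k where k: "\<forall>p\<in>X \<times> X.
      k p \<in> lin R (odo R X A A (fst p) (snd p)) (A (fst p) (snd p)) \<and>
      (\<forall>y\<in>X. \<forall>u\<in>carrier (tensor R (A (fst p) y) (A y (snd p))).
        k p (odo_in R X A A (fst p) (snd p) y u) = m (fst p) y (snd p) u)" ..
  define \<mu> where "\<mu> = (\<lambda>x\<in>X. \<lambda>z\<in>X. k (x, z))"
  \<comment> \<open>Off the diagonal the zero map is the only candidate; restricting it to the
    carrier makes it a member of \<open>lin\<close>.\<close>
  define \<eta> where "\<eta> = (\<lambda>x\<in>X. \<lambda>y\<in>X. if x = y then e x else (\<lambda>r\<in>carrier (odo_unit R x y). \<zero>\<^bsub>A x y\<^esub>))"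
  have mu: "\<mu> \<in> mor R X (odo R X A A) A"
    using k by (simp add: mor_iff \<mu>_def)
  have mu_in: "\<mu> x z (odo_in R X A A x z y u) = m x y z u"
    if "x \<in> X" "y \<in> X" "z \<in> X" "u \<in> carrier (tensor R (A x y) (A y z))" for x y z u
    using k that by (simp add: \<mu>_def)
  have "(\<lambda>r\<in>carrier (odo_unit R x y). \<zero>\<^bsub>A x y\<^esub>) \<in> lin R (odo_unit R x y) (A x y)"
    if "x \<in> X" "y \<in> X" for x y
    by (rule restrict_lin[OF module_odo_unit linear_map_const_zero[OF module_familyD[OF A that]]])
  \<comment> \<open>The simplification of off-diagonal carriers is disabled to keep the restriction
    in the form of the preceding fact.\<close>
  then have eta: "\<eta> \<in> mor R X (odo_unit R) A"
    using e by (simp add: mor_iff \<eta>_def del: odo_unit_simps(2))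
  have "(\<lambda>x\<in>X. \<lambda>y\<in>X. \<lambda>z\<in>X. \<lambda>u\<in>carrier (tensor R (A x y) (A y z)). \<mu> x z (odo_in R X A A x z y u)) = m"
  proof (intro ext)
    \<comment> \<open>Equality of functions includes arguments outside X and outside the carriers,
      where extensionality at each of the four levels makes both sides
      \<open>undefined\<close>.\<close>
    fix x y z u
    have "m x \<in> extensional X" if "x \<in> X" using m_PiE that by (auto simp: PiE_iff)
    moreover have "m x y \<in> extensional X" if "x \<in> X" "y \<in> X" using m_PiE that by (auto simp: PiE_iff)
    moreover have "m x y z \<in> extensional (carrier (tensor R (A x y) (A y z)))"
      if "x \<in> X" "y \<in> X" "z \<in> X" using m[OF that] by (simp add: lin_iff)
    moreover have "m \<in> extensional X" using m_PiE by (simp add: PiE_iff)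
    ultimately show "(\<lambda>x\<in>X. \<lambda>y\<in>X. \<lambda>z\<in>X. \<lambda>u\<in>carrier (tensor R (A x y) (A y z)).
        \<mu> x z (odo_in R X A A x z y u)) x y z u = m x y z u"
      by (simp add: restrict_def extensional_def mu_in)
  qed
  moreover have "(\<lambda>x\<in>X. \<eta> x x) = e"
    using e_PiE by (intro extensionalityI[of _ X]) (auto simp: \<eta>_def PiE_iff)
  ultimately have eq: "bimonoid_to_category R X A (\<mu>, \<eta>, \<Delta>, \<epsilon>) = C"
    by (simp add: bimonoid_to_category_def C_eq)
  then have "(\<mu>, \<eta>, \<Delta>, \<epsilon>) \<in> bimonoid_structures R X A"
    using bimonoid_structures_iff[OF A mu eta Delta eps] C by simp
  with eq show ?thesis by blast
qed

end

theorem theorem7p3: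
  fixes R :: "('r, 'm) ring_scheme"
    and X :: "'x set"
    and A :: "'x \<Rightarrow> 'x \<Rightarrow> ('r, 'a) module"
  assumes "cring R"
    and "\<And>x y. x \<in> X \<Longrightarrow> y \<in> X \<Longrightarrow> module R (A x y)"
  shows "bij_betw (bimonoid_to_category R X A)
    (bimonoid_structures R X A) (coalg_category_structures R X A)"
proof -
  interpret cring R by fact
  have A: "module_family R X A" using assms(2) by (simp add: module_family_def)
  have "bimonoid_to_category R X A B \<in> coalg_category_structures R X A"
    if B: "B \<in> bimonoid_structures R X A" for B
  proof -
    obtain \<mu> \<eta> \<Delta> \<epsilon> where B_eq: "B = (\<mu>, \<eta>, \<Delta>, \<epsilon>)" by (metis prod.collapse)
    have "\<mu> \<in> mor R X (odo R X A A) A" "\<eta> \<in> mor R X (odo_unit R) A"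
      "\<Delta> \<in> mor R X A (bul R A A)" "\<epsilon> \<in> mor R X A (bul_unit R)"
      using B by (simp_all add: B_eq bimonoid_structures_def odo_algebra_def bul_coalgebra_def)
    from bimonoid_structures_iff[OF A this] B show ?thesis by (simp add: B_eq)
  qed
  then show ?thesis
    using bimonoid_to_category_inj[OF A] bimonoid_to_category_surj[OF A]
    by (auto simp: bij_betw_def)
qed

end
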